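(* Let $n>2$, let $A$ be an $\mathbb S_n$-stable subgroup of $(\mathbb Z/2)^n$, $G=A\rtimes\mathbb S_n$, and $\sigma\in A$. Let $M=M(\mathcal O_\sigma^G,\rho^{(1)})\oplus M(\mathcal O_\sigma^G,\rho^{(2)})\oplus\cdots\oplus M(\mathcal O_\sigma^G,\rho^{(r)})$ with $\rho^{(i)}=\theta_{\chi,\mu^{(i)}}$ for $1\le i\le r$, where $\chi\in\widehat A$ is the same for all $i$ and $\mu^{(i)}\in\widehat{(\mathbb S_n^\sigma)_\chi}$. Then $\dim\mathfrak B(M)<\infty$ if and only if $\dim\mathfrak B(\mathcal O_\sigma^G,\rho^{(i)})<\infty$ for all $1\le i\le r$.
   Context: Group. $\mathbb S_n$ acts on $(\mathbb Z/2)^n$ (additive) by $(h\cdot a)_i=a_{h^{-1}(i)}$; $G=A\rtimes\mathbb S_n$ has product $(a,\sigma)(b,\tau)=(a+\sigma\cdot b,\sigma\tau)$, and $A,\mathbb S_n$ are viewed as subgroups. Nichols algebras. For a finite group $G$ and $s\in G$, $G^s$ is the centralizer, $\mathcal O_s^G$ the conjugacy class, $\widehat G$ the set of isomorphism classes of irreducible complex representations. For $(\rho,V)\in\widehat{G^s}$, $M(\mathcal O_s^G,\rho)$ is the Yetter-Drinfeld module $\mathbb CG\otimes_{\mathbb CG^s}V$ with the induced action and coaction $\delta(h\otimes v)=hsh^{-1}\otimes(h\otimes v)$; the braiding is $c(x\otimes y)=x_{(-1)}\cdot y\otimes x_{(0)}$, $\mathfrak B(M)$ is the Nichols algebra of $M$,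 and $\mathfrak B(\mathcal O_s^G,\rho)=\mathfrak B(M(\mathcal O_s^G,\rho))$. Representations. For $\sigma\in A$, $G^\sigma=A\rtimes\mathbb S_n^\sigma$ with $\mathbb S_n^\sigma=\{\tau\in\mathbb S_n:\tau\cdot\sigma=\sigma\}$; $(\mathbb S_n^\sigma)_\chi$ is the stabilizer of $\chi$ in $\mathbb S_n^\sigma$; $\theta_{\chi,\mu}$ is the representation of $G^\sigma$ induced from $\chi\otimes\mu$ on $A\rtimes(\mathbb S_n^\sigma)_\chi$. *)

theory Defs
  imports
    Complex_Main
    "HOL-Algebra.Sym_Groups"
    "HOL-Algebra.Product_Groups"
    "HOL-Algebra.Elementary_Groups"
    "HOL-Algebra.QuotRing"
    "HOL-Combinatorics.Permutations"
    "Jordan_Normal_Form.VS_Connect"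
begin

text \<open>Vector spaces are complex vector spaces with an explicit carrier, i.e. records of type
  \<open>(complex, 'v) module\<close> over the field \<open>class_ring\<close> of complex numbers.  The ring part
  (\<open>mult\<close>, \<open>one\<close>) of such a record is meaningful only for the free algebra and its quotient, the
  Nichols algebra; everywhere else it is never used.\<close>

abbreviation CC :: "complex ring"
  where "CC \<equiv> class_ring"

abbreviation lin_span :: "(complex, 'v, 'c) module_scheme \<Rightarrow> 'v set \<Rightarrow> 'v set"
  where "lin_span V S \<equiv> LinearCombinations.module.span CC V S"


section \<open>Linear algebra\<close>

definition quot_module :: "(complex, 'v, 'c) module_scheme \<Rightarrow> 'v set \<Rightarrow> (complex, 'v set) module"
  where "quot_module V N =
    \<lparr> carrier = a_rcosets\<^bsub>V\<^esub> N,
      mult = rcoset_mult V N,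
      one = N +>\<^bsub>V\<^esub> \<one>\<^bsub>V\<^esub>,
      zero = N,
      add = set_add V,
      smult = (\<lambda>c X. \<Union>x\<in>X. N +>\<^bsub>V\<^esub> (c \<odot>\<^bsub>V\<^esub> x)) \<rparr>"

definition prod_module :: "'i set \<Rightarrow> ('i \<Rightarrow> (complex, 'v, 'c) module_scheme) \<Rightarrow> (complex, 'i \<Rightarrow> 'v) module"
  where "prod_module I V =
    \<lparr> carrier = (\<Pi>\<^sub>E i\<in>I. carrier (V i)),
      mult = (\<lambda>f g. \<lambda>i\<in>I. f i \<otimes>\<^bsub>V i\<^esub> g i),
      one = (\<lambda>i\<in>I. \<one>\<^bsub>V i\<^esub>),
      zero = (\<lambda>i\<in>I. \<zero>\<^bsub>V i\<^esub>),
      add = (\<lambda>f g. \<lambda>i\<in>I. f i \<oplus>\<^bsub>V i\<^esub> g i),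
      smult = (\<lambda>c f. \<lambda>i\<in>I. c \<odot>\<^bsub>V i\<^esub> f i) \<rparr>"


section \<open>Representations\<close>

record ('g, 'v) rep = "(complex, 'v) module" +
  rep_act :: "'g \<Rightarrow> 'v \<Rightarrow> 'v"

definition representation :: "('g, 'b) monoid_scheme \<Rightarrow> ('g, 'v, 'c) rep_scheme \<Rightarrow> bool"
  where "representation G W \<longleftrightarrow>
    group G \<and> vectorspace CC W \<and>
    (\<forall>g\<in>carrier G. rep_act W g \<in> LinearCombinations.module_hom CC W W) \<and>
    (\<forall>x\<in>carrier W. rep_act W \<one>\<^bsub>G\<^esub> x = x) \<and>
    (\<forall>g\<in>carrier G. \<forall>h\<in>carrier G. \<forall>x\<in>carrier W.
       rep_act W (g \<otimes>\<^bsub>G\<^esub> h) x = rep_act W g (rep_act W h x))"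

definition irreducible_rep :: "('g, 'b) monoid_scheme \<Rightarrow> ('g, 'v, 'c) rep_scheme \<Rightarrow> bool"
  where "irreducible_rep G W \<longleftrightarrow>
    representation G W \<and> carrier W \<noteq> {\<zero>\<^bsub>W\<^esub>} \<and>
    (\<forall>U. VectorSpace.subspace CC U W \<and> (\<forall>g\<in>carrier G. rep_act W g ` U \<subseteq> U) \<longrightarrow> U = {\<zero>\<^bsub>W\<^esub>} \<or> U = carrier W)"

text \<open>For a finite group \<open>G\<close>, the space \<open>\<complex>G \<otimes> V\<close> is the direct sum of the \<open>g \<otimes> V\<close>; it is
  realised as the space of functions \<open>G \<rightarrow> V\<close>, the function \<open>f\<close> standing for the sum of all
  \<open>g \<otimes> f g\<close>.\<close>

definition grp_tensor :: "('g, 'b) monoid_scheme \<Rightarrow> (complex, 'v, 'c) module_scheme \<Rightarrow> (complex, 'g \<Rightarrow> 'v) module"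
  where "grp_tensor G V = prod_module (carrier G) (\<lambda>_. V)"

definition pure_tensor :: "('g, 'b) monoid_scheme \<Rightarrow> (complex, 'v, 'c) module_scheme \<Rightarrow> 'g \<Rightarrow> 'v \<Rightarrow> ('g \<Rightarrow> 'v)"
  where "pure_tensor G V g v = (\<lambda>x\<in>carrier G. if x = g then v else \<zero>\<^bsub>V\<^esub>)"

definition balancing :: "('g, 'b) monoid_scheme \<Rightarrow> 'g set \<Rightarrow> ('g, 'v, 'c) rep_scheme \<Rightarrow> ('g \<Rightarrow> 'v) set"
  where "balancing G H W = lin_span (grp_tensor G W)
    {pure_tensor G W (g \<otimes>\<^bsub>G\<^esub> h) v \<ominus>\<^bsub>grp_tensor G W\<^esub> pure_tensor G W g (rep_act W h v) | g h v.
      g \<in> carrier G \<and> h \<in> H \<and> v \<in> carrier W}"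

text \<open>The induced representation \<open>\<complex>G \<otimes>\<^bsub>\<complex>H\<^esub> W\<close> of a representation \<open>W\<close> of a subgroup \<open>H\<close>, with
  \<open>k \<cdot> (g \<otimes> v) = kg \<otimes> v\<close>.\<close>

definition induced :: "('g, 'b) monoid_scheme \<Rightarrow> 'g set \<Rightarrow> ('g, 'v, 'c) rep_scheme \<Rightarrow> ('g, ('g \<Rightarrow> 'v) set) rep"
  where "induced G H W =
    module.extend (quot_module (grp_tensor G W) (balancing G H W))
      (rep.fields (\<lambda>k X. \<Union>f\<in>X.
         balancing G H W +>\<^bsub>grp_tensor G W\<^esub> (\<lambda>x\<in>carrier G. f (inv\<^bsub>G\<^esub> k \<otimes>\<^bsub>G\<^esub> x))))"


section \<open>Yetter-Drinfeld modules over a finite group\<close>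

text \<open>The coaction \<open>M \<rightarrow> \<complex>G \<otimes> M\<close> is recorded by its components: \<open>\<delta>(x)\<close> is the sum of all
  \<open>g \<otimes> coact M x g\<close>.\<close>

record ('g, 'm) yd_module = "('g, 'm) rep" +
  coact :: "'m \<Rightarrow> 'g \<Rightarrow> 'm"

definition centralizer :: "('g, 'b) monoid_scheme \<Rightarrow> 'g \<Rightarrow> 'g set"
  where "centralizer G s = {g \<in> carrier G. g \<otimes>\<^bsub>G\<^esub> s = s \<otimes>\<^bsub>G\<^esub> g}"

text \<open>\<open>yd_induced G s W\<close> is \<open>M(\<O>\<^sub>s, \<rho>)\<close> for the representation \<open>\<rho>\<close> of the centralizer of \<open>s\<close> on \<open>W\<close>.
  As \<open>\<delta>(h \<otimes> v) = hsh\<inverse> \<otimes> (h \<otimes> v)\<close>, the component of degree \<open>g\<close> of the class of \<open>f\<close> collects the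
  summands \<open>h \<otimes> f h\<close> with \<open>hsh\<inverse> = g\<close>.\<close>

definition yd_induced :: "('g, 'b) monoid_scheme \<Rightarrow> 'g \<Rightarrow> ('g, 'v, 'c) rep_scheme \<Rightarrow> ('g, ('g \<Rightarrow> 'v) set) yd_module"
  where "yd_induced G s W = (let H = centralizer G s in
    rep.extend (induced G H W)
      (yd_module.fields (\<lambda>X g. \<Union>f\<in>X.
         balancing G H W +>\<^bsub>grp_tensor G W\<^esub>
           (\<lambda>h\<in>carrier G. if h \<otimes>\<^bsub>G\<^esub> s \<otimes>\<^bsub>G\<^esub> inv\<^bsub>G\<^esub> h = g then f h else \<zero>\<^bsub>W\<^esub>))))"

definition yd_direct_sum :: "'i set \<Rightarrow> ('i \<Rightarrow> ('g, 'm, 'c) yd_module_scheme) \<Rightarrow> ('g, 'i \<Rightarrow> 'm) yd_module"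
  where "yd_direct_sum I M =
    rep.extend
      (module.extend (prod_module I M) (rep.fields (\<lambda>g x. \<lambda>i\<in>I. rep_act (M i) g (x i))))
      (yd_module.fields (\<lambda>x g. \<lambda>i\<in>I. coact (M i) (x i) g))"


section \<open>Nichols algebras\<close>

text \<open>The free algebra on a set \<open>X\<close>: finitely supported functions on the words in \<open>X\<close>.\<close>

definition word :: "'x list \<Rightarrow> 'x list \<Rightarrow> complex"
  where "word w = (\<lambda>u. if u = w then 1 else 0)"

definition free_algebra :: "'x set \<Rightarrow> (complex, 'x list \<Rightarrow> complex) module"
  where "free_algebra X =
    \<lparr> carrier = {f. finite {w. f w \<noteq> 0} \<and> {w. f w \<noteq> 0} \<subseteq> lists X},
      mult = (\<lambda>f g w. \<Sum>k\<le>length w. f (take k w) * g (drop k w)),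
      one = word [],
      zero = (\<lambda>w. 0),
      add = (\<lambda>f g w. f w + g w),
      smult = (\<lambda>c f w. c * f w) \<rparr>"

definition lin_ext :: "('x list \<Rightarrow> 'x list \<Rightarrow> complex) \<Rightarrow> ('x list \<Rightarrow> complex) \<Rightarrow> 'x list \<Rightarrow> complex"
  where "lin_ext \<phi> f = (\<lambda>u. \<Sum>w | f w \<noteq> 0. f w * \<phi> w u)"

text \<open>The tensor algebra \<open>T(M)\<close> is the free algebra on the set \<open>M\<close> modulo the relations making
  words multilinear in their letters.  These span an ideal.\<close>

definition tensor_relations :: "(complex, 'm, 'c) module_scheme \<Rightarrow> ('m list \<Rightarrow> complex) set"
  where "tensor_relations M = lin_span (free_algebra (carrier M))
    ({(\<lambda>t. word (u @ [x \<oplus>\<^bsub>M\<^esub> y] @ v) t - word (u @ [x] @ v) t - word (u @ [y] @ v) t) | u v x y.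
        u \<in> lists (carrier M) \<and> v \<in> lists (carrier M) \<and> x \<in> carrier M \<and> y \<in> carrier M} \<union>
     {(\<lambda>t. word (u @ [c \<odot>\<^bsub>M\<^esub> x] @ v) t - c * word (u @ [x] @ v) t) | u v c x.
        u \<in> lists (carrier M) \<and> v \<in> lists (carrier M) \<and> x \<in> carrier M})"

text \<open>The braiding \<open>c(x \<otimes> y) = x\<^sub>(\<^sub>-\<^sub>1\<^sub>) \<cdot> y \<otimes> x\<^sub>(\<^sub>0\<^sub>)\<close> applied to the letters in positions \<open>i\<close> and \<open>i + 1\<close>
  (counted from 0) of a word, extended linearly.  It preserves the relations above, hence acts on
  the tensor powers of \<open>M\<close>.\<close>

definition braid :: "('g, 'b) monoid_scheme \<Rightarrow> ('g, 'm, 'c) yd_module_scheme \<Rightarrow> nat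
    \<Rightarrow> ('m list \<Rightarrow> complex) \<Rightarrow> ('m list \<Rightarrow> complex)"
  where "braid G M i = lin_ext (\<lambda>w u. \<Sum>g\<in>carrier G.
    word (take i w @ [rep_act M g (w ! Suc i), coact M (w ! i) g] @ drop (Suc (Suc i)) w) u)"

definition simple_prod :: "nat list \<Rightarrow> nat \<Rightarrow> nat"
  where "simple_prod is = foldr (\<lambda>i p. Transposition.transpose i (Suc i) \<circ> p) is id"

definition reduced_expr :: "nat \<Rightarrow> nat list \<Rightarrow> (nat \<Rightarrow> nat) \<Rightarrow> bool"
  where "reduced_expr n is w \<longleftrightarrow>
    set is \<subseteq> {i. Suc i < n} \<and> simple_prod is = w \<and>
    (\<forall>js. set js \<subseteq> {i. Suc i < n} \<and> simple_prod js = w \<longrightarrow> length is \<le> length js)"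

text \<open>The operator \<open>c\<^sub>i\<^sub>1 \<dots> c\<^sub>i\<^sub>k\<close> for a reduced expression \<open>w = s\<^sub>i\<^sub>1 \<dots> s\<^sub>i\<^sub>k\<close>; on tensor powers it does
  not depend on the choice of the expression, because \<open>c\<close> satisfies the braid equation.\<close>

definition braid_lift :: "('g, 'b) monoid_scheme \<Rightarrow> ('g, 'm, 'c) yd_module_scheme \<Rightarrow> nat \<Rightarrow> (nat \<Rightarrow> nat)
    \<Rightarrow> ('m list \<Rightarrow> complex) \<Rightarrow> ('m list \<Rightarrow> complex)"
  where "braid_lift G M n w = foldr (braid G M) (SOME is. reduced_expr n is w)"

definition quantum_symmetrizer :: "('g, 'b) monoid_scheme \<Rightarrow> ('g, 'm, 'c) yd_module_scheme \<Rightarrow> nat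
    \<Rightarrow> ('m list \<Rightarrow> complex) \<Rightarrow> ('m list \<Rightarrow> complex)"
  where "quantum_symmetrizer G M n f = (\<lambda>u. \<Sum>w | w permutes {..<n}. braid_lift G M n w f u)"

definition degree_part :: "nat \<Rightarrow> ('x list \<Rightarrow> complex) \<Rightarrow> ('x list \<Rightarrow> complex)"
  where "degree_part n f = (\<lambda>w. if length w = n then f w else 0)"

text \<open>The Nichols algebra is \<open>T(M)\<close> modulo the direct sum of the kernels of the quantum
  symmetrizers on the tensor powers.  Below, \<open>T(M)\<close> being itself a quotient, we divide the free
  algebra by the preimage of that ideal.\<close>

definition nichols_ideal :: "('g, 'b) monoid_scheme \<Rightarrow> ('g, 'm, 'c) yd_module_scheme \<Rightarrow> ('m list \<Rightarrow> complex) set"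
  where "nichols_ideal G M = {f \<in> carrier (free_algebra (carrier M)).
    \<forall>n. quantum_symmetrizer G M n (degree_part n f) \<in> tensor_relations M}"

definition nichols_algebra :: "('g, 'b) monoid_scheme \<Rightarrow> ('g, 'm, 'c) yd_module_scheme
    \<Rightarrow> (complex, ('m list \<Rightarrow> complex) set) module"
  where "nichols_algebra G M = quot_module (free_algebra (carrier M)) (nichols_ideal G M)"


section \<open>The groups\<close>

text \<open>The group \<open>(\<int>/2)\<^sup>n\<close>, its coordinates being indexed by \<open>{1..n}\<close>; its elements are extensional
  functions on \<open>{1..n}\<close>.\<close>

definition Z2_power :: "nat \<Rightarrow> (nat \<Rightarrow> int) monoid"
  where "Z2_power n = product_group {1..n} (\<lambda>_. integer_mod_group 2)"

definition perm_act :: "(nat \<Rightarrow> nat) \<Rightarrow> (nat \<Rightarrow> int) \<Rightarrow> (nat \<Rightarrow> int)"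
  where "perm_act h a = (\<lambda>i. a (inv' h i))"

definition semidirect :: "('a, 'c) monoid_scheme \<Rightarrow> ('h, 'd) monoid_scheme \<Rightarrow> ('h \<Rightarrow> 'a \<Rightarrow> 'a) \<Rightarrow> ('a \<times> 'h) monoid"
  where "semidirect N H \<phi> =
    \<lparr> carrier = carrier N \<times> carrier H,
      mult = (\<lambda>(a, x) (b, y). (a \<otimes>\<^bsub>N\<^esub> \<phi> x b, x \<otimes>\<^bsub>H\<^esub> y)),
      one = (\<one>\<^bsub>N\<^esub>, \<one>\<^bsub>H\<^esub>) \<rparr>"

definition A_group :: "nat \<Rightarrow> (nat \<Rightarrow> int) set \<Rightarrow> (nat \<Rightarrow> int) monoid"
  where "A_group n A = (Z2_power n)\<lparr>carrier := A\<rparr>"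

definition AS_group :: "nat \<Rightarrow> (nat \<Rightarrow> int) set \<Rightarrow> ((nat \<Rightarrow> int) \<times> (nat \<Rightarrow> nat)) monoid"
  where "AS_group n A = semidirect (A_group n A) (sym_group n) perm_act"

text \<open>As \<open>A\<close> is abelian, its irreducible representations are its characters.\<close>

definition characters :: "nat \<Rightarrow> (nat \<Rightarrow> int) set \<Rightarrow> ((nat \<Rightarrow> int) \<Rightarrow> complex) set"
  where "characters n A = hom (A_group n A) (units_of CC)"

definition sym_stab :: "nat \<Rightarrow> (nat \<Rightarrow> int) \<Rightarrow> (nat \<Rightarrow> nat) set"
  where "sym_stab n \<sigma> = {\<tau> \<in> carrier (sym_group n). perm_act \<tau> \<sigma> = \<sigma>}"

text \<open>The stabilizer of \<open>\<chi>\<close> in the stabilizer of \<open>\<sigma>\<close>, for the action \<open>(\<tau> \<cdot> \<chi>)(a) = \<chi>(\<tau>\<inverse> \<cdot> a)\<close>.\<close>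

definition char_stab :: "nat \<Rightarrow> (nat \<Rightarrow> int) set \<Rightarrow> (nat \<Rightarrow> int) \<Rightarrow> ((nat \<Rightarrow> int) \<Rightarrow> complex) \<Rightarrow> (nat \<Rightarrow> nat) set"
  where "char_stab n A \<sigma> \<chi> = {\<tau> \<in> sym_stab n \<sigma>. \<forall>a\<in>A. \<chi> (perm_act (inv' \<tau>) a) = \<chi> a}"

definition char_tensor :: "('a \<Rightarrow> complex) \<Rightarrow> ('h, 'v, 'c) rep_scheme \<Rightarrow> ('a \<times> 'h, 'v) rep"
  where "char_tensor \<chi> \<mu> =
    module.extend (module.truncate \<mu>) (rep.fields (\<lambda>(a, \<tau>) v. \<chi> a \<odot>\<^bsub>\<mu>\<^esub> rep_act \<mu> \<tau> v))"

text \<open>The centralizer of \<open>\<sigma>\<close> is \<open>A \<rtimes> sym_stab n \<sigma>\<close>; we induce to it from \<open>A \<rtimes> char_stab n A \<sigma> \<chi>\<close>.\<close>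

definition theta :: "nat \<Rightarrow> (nat \<Rightarrow> int) set \<Rightarrow> (nat \<Rightarrow> int) \<Rightarrow> ((nat \<Rightarrow> int) \<Rightarrow> complex)
    \<Rightarrow> (nat \<Rightarrow> nat, 'v, 'c) rep_scheme
    \<Rightarrow> ((nat \<Rightarrow> int) \<times> (nat \<Rightarrow> nat), ((nat \<Rightarrow> int) \<times> (nat \<Rightarrow> nat) \<Rightarrow> 'v) set) rep"
  where "theta n A \<sigma> \<chi> \<mu> =
    induced ((AS_group n A)\<lparr>carrier := centralizer (AS_group n A) (\<sigma>, id)\<rparr>)
      (A \<times> char_stab n A \<sigma> \<chi>) (char_tensor \<chi> \<mu>)"

end

theory Submission
  imports Defs "HOL-Library.Function_Algebras" "HOL-Combinatorics.Multiset_Permutations"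
begin

text \<open>
  Write \<open>s(u) = \<chi>(u \<cdot> \<sigma>)\<close> for a permutation \<open>u\<close>; it is \<open>1\<close> or \<open>-1\<close> because the elements of \<open>A\<close> have order at most two.
  Both sides of the theorem turn out to be equivalent to the condition, called \<open>trivial_braiding\<close> below,
  that \<open>s(1) = -1\<close> and \<open>s(u) s(u\<inverse>) = 1\<close> for all \<open>u\<close>, which involves neither \<open>r\<close> nor the \<open>\<mu>\<^sup>(\<^sup>i\<^sup>)\<close>.

  The degrees of \<open>M\<close> lie in the abelian group \<open>A\<close>, and \<open>A\<close> acts diagonally on \<open>M\<close>: the component \<open>t \<otimes> v\<close> has degree
  \<open>t \<cdot> \<sigma>\<close>, and \<open>a \<in> A\<close> acts on it by \<open>\<chi>(t\<inverse> \<cdot> a)\<close>.  So \<open>M\<close> is of diagonal type with matrix entries \<open>s(t\<inverse> t')\<close>, and the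
  same holds for each summand (\<open>theta_orbit_frame\<close>, \<open>direct_sum_orbit_frame\<close>).  Instead of a basis, a
  redundant family of functionals, indexed by group elements, is used as coordinates.  In these
  coordinates the defining ideal of the Nichols algebra is described by sums over permutations of
  products over inversions (\<open>nichols_ideal_iff\<close>), which are the structure constants of the quantum shuffle
  algebra (\<open>symmetrizer_nichols_word\<close>).

  If the condition holds, all letters square to zero and commute up to sign, and the Nichols algebra is
  finite-dimensional (\<open>finite_if_disconnected\<close>).  If \<open>s(1) = 1\<close>, it contains a polynomial ring.  Otherwise there is
  \<open>u\<close> with \<open>s(u) s(u\<inverse>) = -1\<close>, and the powers of \<open>u\<close>, modulo the stabilizer of \<open>\<sigma>\<close> and \<open>\<chi>\<close>, contain a cycle of length at
  least three in the generalized Dynkin diagram (\<open>infinite_if_edge\<close>).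

  That a cycle gives an infinite-dimensional Nichols algebra (\<open>nichols_cycle_infinite\<close>) is shown with highest weight
  modules of its Drinfeld double.  Each of these modules embeds as a vector space into the Nichols
  algebra (\<open>hw_span_subset\<close>), so it suffices to find one with nonzero vectors of arbitrarily large degree.
  Reflecting at a vertex turns a highest weight module into one with another highest weight and the same
  diagram (\<open>reflect_word\<close>).  Starting from the weight \<open>2\<close> at all vertices, and reflecting at the vertices of the
  cycle in their cyclic order, the absolute value of the weight at the pivot always stays above \<open>1\<close>; each
  reflection is then possible and raises the degree (\<open>cycle_words\<close>).
\<close>

section \<open>Creation operators on functions on words\<close>

text \<open>Functions on words are added and multiplied as elements of a ring of functions; the rules that
  evaluate such an expression at a word are applied only on demand, through \<open>pointwise\<close>.\<close>

declare plus_fun_apply [simp del] times_fun_apply [simp del] zero_fun_apply [simp del] minus_apply [simp del] uminus_apply [simp del]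

definition scl :: "complex \<Rightarrow> ('i \<Rightarrow> complex) \<Rightarrow> 'i \<Rightarrow> complex" where "scl c g = (\<lambda>v. c * g v)"

lemma scl_apply: "scl c g v = c * g v" by (simp add: scl_def)

lemmas pointwise = plus_fun_apply times_fun_apply zero_fun_apply minus_apply uminus_apply scl_apply

lemma scl_simps [simp]:
  "scl c (g + h) = scl c g + scl c h" "scl c (g - h) = scl c g - scl c h" "scl c (- g) = - scl c g"
  "scl a (scl b g) = scl (a * b) g" "scl 1 g = g" "scl (- c) g = - scl c g" "scl 0 g = 0" "scl c 0 = 0"
  by (auto simp: fun_eq_iff pointwise algebra_simps)

definition linear_op :: "(('i list \<Rightarrow> complex) \<Rightarrow> 'j list \<Rightarrow> complex) \<Rightarrow> bool" where
  "linear_op T \<longleftrightarrow> (\<forall>g h. T (g + h) = T g + T h) \<and> (\<forall>c g. T (scl c g) = scl c (T g))"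

lemma linear_opD:
  assumes "linear_op T"
  shows "T (g + h) = T g + T h" "T (scl c g) = scl c (T g)" "T 0 = 0" "T (- g) = - T g" "T (g - h) = T g - T h"
proof -
  show a: "\<And>g h. T (g + h) = T g + T h" and s: "\<And>c g. T (scl c g) = scl c (T g)"
    using assms unfolding linear_op_def by auto
  show z: "T 0 = 0" using a[of 0 0] by simp
  have n: "T (- g) = - T g" for g using a[of g "-g"] z by (metis add.right_inverse add_eq_0_iff)
  then show "T (- g) = - T g" .
  show "T (g - h) = T g - T h" using a[of g "-h"] n by (metis diff_conv_add_uminus)
qed

definition empty_word :: "'i list \<Rightarrow> complex" where "empty_word v = (if v = [] then 1 else 0)"

text \<open>The operators \<open>annih\<close>, \<open>wt_op\<close> and \<open>create\<close> play the roles of \<open>E\<^sub>i\<close>, \<open>K\<^sub>j\<close> and \<open>F\<^sub>j\<close> in the Drinfeld double of a Nichols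
  algebra of diagonal type.  A function on words is determined by the values at the empty word of its
  iterated \<open>annih\<close>, so a module is modelled faithfully by functions on words as long as only the vacuum
  is killed by all \<open>annih\<close>.\<close>

definition annih :: "'i \<Rightarrow> ('i list \<Rightarrow> complex) \<Rightarrow> 'i list \<Rightarrow> complex" where
  "annih i g = (\<lambda>v. g (i # v))"

definition weight :: "('i \<Rightarrow> 'i \<Rightarrow> complex) \<Rightarrow> 'i \<Rightarrow> 'i list \<Rightarrow> complex" where
  "weight q j v = (\<Prod>i\<leftarrow>v. q j i * q i j)"

definition wt_op :: "('i \<Rightarrow> 'i \<Rightarrow> complex) \<Rightarrow> 'i \<Rightarrow> ('i list \<Rightarrow> complex) \<Rightarrow> 'i list \<Rightarrow> complex" where
  "wt_op q j g = weight q j * g"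

text \<open>The recursion is the relation \<open>E\<^sub>i F\<^sub>j = \<delta>\<^sub>i\<^sub>j (1 - \<xi>\<^sub>j K\<^sub>j) + q\<^sub>j\<^sub>i F\<^sub>j E\<^sub>i\<close> (see \<open>annih_create\<close>), where \<open>\<xi>\<close> is the highest weight.
  For \<open>\<xi> = 0\<close> it is left multiplication by a letter in the quantum shuffle algebra, which generates the
  Nichols algebra with braiding matrix \<open>q\<close>; for general \<open>\<xi>\<close> the words in the \<open>create\<close> operators span the
  simple module of highest weight \<open>\<xi>\<close>.\<close>

fun create :: "('i \<Rightarrow> 'i \<Rightarrow> complex) \<Rightarrow> ('i \<Rightarrow> complex) \<Rightarrow> 'i \<Rightarrow> ('i list \<Rightarrow> complex) \<Rightarrow> 'i list \<Rightarrow> complex" where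
  "create q \<xi> j g [] = 0"
| "create q \<xi> j g (i # v) =
     (if i = j then (1 - \<xi> j * weight q j v) * g v else 0) + q j i * create q \<xi> j (\<lambda>u. g (i # u)) v"

abbreviation hw_word :: "('i \<Rightarrow> 'i \<Rightarrow> complex) \<Rightarrow> ('i \<Rightarrow> complex) \<Rightarrow> 'i list \<Rightarrow> 'i list \<Rightarrow> complex" where
  "hw_word q \<xi> w \<equiv> foldr (create q \<xi>) w empty_word"

lemma linear_annih: "linear_op (annih i)"
  by (auto simp: linear_op_def annih_def fun_eq_iff pointwise)

lemma linear_wt: "linear_op (wt_op q j)"
  by (auto simp: linear_op_def wt_op_def fun_eq_iff pointwise algebra_simps)

lemma linear_create: "linear_op (create q \<xi> j)"
proof -
  have "create q \<xi> j (g + h) v = create q \<xi> j g v + create q \<xi> j h v" for g h :: "'a list \<Rightarrow> complex" and v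
  proof (induction v arbitrary: g h)
    case (Cons a v)
    have "(\<lambda>u. (g + h) (a # u)) = (\<lambda>u. g (a # u)) + (\<lambda>u. h (a # u))" by (simp add: fun_eq_iff pointwise)
    then show ?case using Cons[of "\<lambda>u. g (a # u)" "\<lambda>u. h (a # u)"] by (simp add: pointwise algebra_simps)
  qed simp
  moreover have "create q \<xi> j (scl c g) v = c * create q \<xi> j g v" for c and g :: "'a list \<Rightarrow> complex" and v
  proof (induction v arbitrary: g)
    case (Cons a v)
    have "(\<lambda>u. (scl c g) (a # u)) = scl c (\<lambda>u. g (a # u))" by (simp add: fun_eq_iff pointwise)
    then show ?case using Cons[of "\<lambda>u. g (a # u)"] by (simp add: pointwise algebra_simps)
  qed simp
  ultimately show ?thesis by (simp add: linear_op_def fun_eq_iff pointwise)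
qed

lemma annih_create:
  "annih i (create q \<xi> j g) =
     (if i = j then g - scl (\<xi> j) (wt_op q j g) else 0) + scl (q j i) (create q \<xi> j (annih i g))"
  by (auto simp: annih_def wt_op_def fun_eq_iff pointwise algebra_simps)

lemma annih_wt: "annih i (wt_op q j g) = scl (q j i * q i j) (wt_op q j (annih i g))"
  by (auto simp: annih_def wt_op_def weight_def fun_eq_iff pointwise)

lemma annih_empty: "annih i empty_word = 0"
  by (auto simp: annih_def empty_word_def fun_eq_iff pointwise)

lemma wt_empty: "wt_op q j empty_word = empty_word"
  by (auto simp: wt_op_def weight_def empty_word_def fun_eq_iff pointwise)

lemmas lin_annih [simp] = linear_opD[OF linear_annih]
lemmas lin_wt [simp] = linear_opD[OF linear_wt]
lemmas lin_create [simp] = linear_opD[OF linear_create]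

lemma wt_commute: "wt_op q j (wt_op q i g) = wt_op q i (wt_op q j g)"
  by (simp add: wt_op_def algebra_simps)

lemma wt_create: "wt_op q j (create q \<xi> i g) = scl (q j i * q i j) (create q \<xi> i (wt_op q j g))"
proof
  fix v show "wt_op q j (create q \<xi> i g) v = (scl (q j i * q i j) (create q \<xi> i (wt_op q j g))) v"
  proof (induction v arbitrary: g)
    case (Cons a v)
    have "wt_op q j (create q \<xi> i g) (a # v) = annih a (wt_op q j (create q \<xi> i g)) v" by (simp add: annih_def)
    also have "\<dots> = (q j a * q a j) * (wt_op q j (if a = i then g - scl (\<xi> i) (wt_op q i g) else 0) v + q i a * wt_op q j (create q \<xi> i (annih a g)) v)"
      by (simp only: annih_wt annih_create pointwise lin_wt)
    also have "\<dots> = annih a (scl (q j i * q i j) (create q \<xi> i (wt_op q j g))) v"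
      unfolding Cons.IH by (auto simp: annih_create annih_wt pointwise algebra_simps wt_commute[of q i j])
    finally show ?case by (simp add: annih_def)
  qed (simp add: wt_op_def pointwise)
qed

text \<open>Suppose that operators \<open>E\<close>, \<open>F\<close>, \<open>K\<close> on some space satisfy, up to factors \<open>c\<close>, the commutation relations
  of \<open>annih\<close>, \<open>create\<close> and \<open>wt_op\<close>, and that \<open>vac\<close> is a vacuum for them.  Moving the \<open>E\<close> to the right
  through the \<open>F\<close> uses only these relations, so it produces the same numbers as in the model, and
  these numbers are the values of \<open>hw_word\<close>.  This is how a second set of operators on one and the same
  module is recognised as a highest weight module with other parameters.\<close>

lemma realization:
  fixes E F K :: "'i \<Rightarrow> ('j list \<Rightarrow> complex) \<Rightarrow> 'j list \<Rightarrow> complex"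
  assumes linE: "\<And>i. linear_op (E i)" and linF: "\<And>i. linear_op (F i)" 
    and clE: "\<And>i g. g \<in> L \<Longrightarrow> E i g \<in> L" and clF: "\<And>i g. g \<in> L \<Longrightarrow> F i g \<in> L"
    and EF: "\<And>i j g. g \<in> L \<Longrightarrow> E i (F j g) =
       (if i = j then scl (c j) (g - scl (\<xi> j) (K j g)) else 0) + scl (q j i) (F j (E i g))"
    and EK: "\<And>i j g. g \<in> L \<Longrightarrow> E i (K j g) = scl (q j i * q i j) (K j (E i g))"
    and linK: "\<And>i. linear_op (K i)" 
    and vac: "vac \<in> L" "\<And>i. E i vac = 0" "\<And>i. K i vac = vac"
    and len: "length v = length w"
  shows "fold E v (foldr F w vac) = scl ((\<Prod>j\<leftarrow>w. c j) * hw_word q \<xi> w v) vac"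
proof -
  have lin: "linear_op (fold E v)" for v
  proof (induction v)
    case Nil then show ?case by (simp add: linear_op_def)
  next
    case (Cons a v)
    then show ?case using linE[of a] by (simp add: linear_op_def)
  qed
  have fK: "g \<in> L \<Longrightarrow> fold E v (K j g) = scl (weight q j v) (K j (fold E v g))" for g j v
  proof (induction v arbitrary: g)
    case (Cons a v)
    then show ?case using linear_opD(2)[OF lin, of v] by (simp add: EK clE weight_def fun_eq_iff pointwise)
  qed (simp add: weight_def fun_eq_iff pointwise)
  have step: "fold E v (F j g) = scl (c j * create q \<xi> j G v) vac"
    if "g \<in> L" "\<forall>u. length u = n \<longrightarrow> fold E u g = scl (G u) vac" "length v = Suc n" for g j G v n
    using that
  proof (induction n arbitrary: g G v)
    case 0
    then obtain i where v: "v = [i]" by (auto simp: length_Suc_conv)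
    from 0 have g: "g = scl (G []) vac" by simp
    then have "E i g = 0" by (subst g) (simp add: linear_opD(2)[OF linE] vac)
    moreover have "K j g = g" by (subst (1 2) g) (simp add: linear_opD(2)[OF linK] vac)
    ultimately have "E i (F j g) = (if i = j then scl (c j) (g - scl (\<xi> j) g) else 0)"
      using EF[OF 0(1), of i j] linear_opD(3)[OF linF, of j] by simp
    also have "\<dots> = scl (c j * create q \<xi> j G v) vac"
      unfolding v by (subst (1 2) g) (auto simp: fun_eq_iff pointwise weight_def algebra_simps)
    finally show ?case unfolding v by simp
  next
    case (Suc n)
    then obtain i v' where v: "v = i # v'" "length v' = Suc n" by (auto simp: length_Suc_conv)
    have IH: "fold E v' (F j (E i g)) = scl (c j * create q \<xi> j (\<lambda>u. G (i # u)) v') vac"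
      by (rule Suc.IH) (use Suc.prems v clE in \<open>auto dest: spec[of _ "i # _"]\<close>)
    have g: "fold E v' g = scl (G v') vac" using Suc.prems v by simp
    have gK: "fold E v' (K j g) = scl (weight q j v' * G v') vac"
      unfolding fK[OF Suc.prems(1)] g linear_opD(2)[OF linK] vac(3) by simp
    have "fold E v (F j g) = fold E v' ((if i = j then scl (c j) (g - scl (\<xi> j) (K j g)) else 0) + scl (q j i) (F j (E i g)))"
      unfolding v by (simp add: EF Suc.prems)
    also have "\<dots> = (if i = j then scl (c j) (fold E v' g - scl (\<xi> j) (fold E v' (K j g))) else 0) + scl (q j i) (fold E v' (F j (E i g)))"
      by (simp add: linear_opD[OF lin])
    also have "\<dots> = scl (c j * create q \<xi> j G v) vac"
      unfolding IH g gK v by (auto simp: fun_eq_iff pointwise algebra_simps)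
    finally show ?case .
  qed
  have FL: "foldr F w vac \<in> L" for w by (induction w) (auto simp: vac clF)
  show ?thesis using len
  proof (induction w arbitrary: v)
    case Nil then show ?case by (simp add: empty_word_def fun_eq_iff pointwise)
  next
    case (Cons j w)
    have "fold E v (F j (foldr F w vac)) = scl (c j * create q \<xi> j (\<lambda>u. (\<Prod>j\<leftarrow>w. c j) * hw_word q \<xi> w u) v) vac"
      by (rule step[OF FL]) (use Cons in auto)
    moreover have "create q \<xi> j (\<lambda>u. (\<Prod>j\<leftarrow>w. c j) * hw_word q \<xi> w u) v = (\<Prod>j\<leftarrow>w. c j) * create q \<xi> j (hw_word q \<xi> w) v"
      using fun_cong[OF lin_create(2)[of q \<xi> j "\<Prod>j\<leftarrow>w. c j" "hw_word q \<xi> w"], of v] by (simp add: scl_def)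
    ultimately show ?case by (simp add: algebra_simps)
  qed
qed

inductive_set hw_span :: "('i \<Rightarrow> 'i \<Rightarrow> complex) \<Rightarrow> ('i \<Rightarrow> complex) \<Rightarrow> ('i list \<Rightarrow> complex) set" for q \<xi> where
  empty: "empty_word \<in> hw_span q \<xi>"
| comb: "g \<in> hw_span q \<xi> \<Longrightarrow> h \<in> hw_span q \<xi> \<Longrightarrow> g + scl c h \<in> hw_span q \<xi>"
| create: "g \<in> hw_span q \<xi> \<Longrightarrow> create q \<xi> j g \<in> hw_span q \<xi>"

lemma hw_span_zero: "0 \<in> hw_span q \<xi>"
proof -
  have "empty_word + scl (-1) empty_word \<in> hw_span q \<xi>" by (intro hw_span.intros)
  then show ?thesis by simp
qed

lemma hw_span_scale: "h \<in> hw_span q \<xi> \<Longrightarrow> scl c h \<in> hw_span q \<xi>"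
  using hw_span.comb[OF hw_span_zero, of h q \<xi> c] by simp

lemma hw_span_add: "g \<in> hw_span q \<xi> \<Longrightarrow> h \<in> hw_span q \<xi> \<Longrightarrow> g + h \<in> hw_span q \<xi>"
  using hw_span.comb[of g q \<xi> h 1] by simp

lemma hw_span_diff: "g \<in> hw_span q \<xi> \<Longrightarrow> h \<in> hw_span q \<xi> \<Longrightarrow> g - h \<in> hw_span q \<xi>"
  using hw_span.comb[of g q \<xi> h "-1"] by simp

lemma hw_span_wt: "g \<in> hw_span q \<xi> \<Longrightarrow> wt_op q j g \<in> hw_span q \<xi>"
  by (induction rule: hw_span.induct) (auto simp: wt_empty wt_create intro: hw_span.intros hw_span_scale)

lemma hw_span_annih: "g \<in> hw_span q \<xi> \<Longrightarrow> annih j g \<in> hw_span q \<xi>"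
  by (induction rule: hw_span.induct)
    (auto simp: annih_empty annih_create hw_span_zero intro!: hw_span.intros hw_span_scale hw_span_diff hw_span_add hw_span_wt)

lemma hw_span_word:
  assumes "g \<in> hw_span q \<xi>" "g v \<noteq> 0"
  shows "\<exists>w. hw_word q \<xi> w v \<noteq> 0"
proof -
  have "\<exists>ps. g = (\<Sum>(c, w)\<leftarrow>ps. scl c (hw_word q \<xi> w))"
    using assms(1)
  proof induction
    case empty
    have "empty_word = (\<Sum>(c, w)\<leftarrow>[(1,[])]. scl c (hw_word q \<xi> w))" by (simp add: fun_eq_iff pointwise)
    then show ?case by blast
  next
    case (comb g h c)
    then obtain ps qs where "g = (\<Sum>(c, w)\<leftarrow>ps. scl c (hw_word q \<xi> w))" "h = (\<Sum>(c, w)\<leftarrow>qs. scl c (hw_word q \<xi> w))" by blast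
    moreover have "scl c (\<Sum>(c, w)\<leftarrow>qs. scl c (hw_word q \<xi> w)) = (\<Sum>(c, w)\<leftarrow>map (\<lambda>(d, w). (c * d, w)) qs. scl c (hw_word q \<xi> w))"
      by (induction qs) (auto simp: fun_eq_iff pointwise algebra_simps)
    ultimately have "g + scl c h = (\<Sum>(c, w)\<leftarrow>ps @ map (\<lambda>(d, w). (c * d, w)) qs. scl c (hw_word q \<xi> w))" by simp
    then show ?case by blast
  next
    case (create g j)
    then obtain ps where "g = (\<Sum>(c, w)\<leftarrow>ps. scl c (hw_word q \<xi> w))" by blast
    moreover have "create q \<xi> j (\<Sum>(c, w)\<leftarrow>ps. scl c (hw_word q \<xi> w)) = (\<Sum>(c, w)\<leftarrow>map (\<lambda>(d, w). (d, j # w)) ps. scl c (hw_word q \<xi> w))"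
      by (induction ps) auto
    ultimately show ?case by metis
  qed
  then obtain ps where "g = (\<Sum>(c, w)\<leftarrow>ps. scl c (hw_word q \<xi> w))" by blast
  then have "(\<Sum>(c, w)\<leftarrow>ps. scl c (hw_word q \<xi> w)) v \<noteq> 0" using assms by simp
  then show ?thesis
  proof (induction ps)
    case (Cons p ps)
    obtain c w where p: "p = (c, w)" by (cases p)
    show ?case
    proof (cases "hw_word q \<xi> w v = 0")
      case True
      then show ?thesis using Cons p by (simp add: pointwise)
    qed blast
  qed (simp add: pointwise)
qed

section \<open>Reflections of highest weight modules\<close>

text \<open>Vertices all have \<open>q\<^sub>i\<^sub>i = -1\<close>, and two vertices are joined when \<open>q\<^sub>i\<^sub>j q\<^sub>j\<^sub>i = -1\<close>: this is the generalized Dynkin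
  diagram of a braiding with entries \<open>1\<close> and \<open>-1\<close>.\<close>

definition sign_matrix :: "('i \<Rightarrow> 'i \<Rightarrow> complex) \<Rightarrow> bool" where
  "sign_matrix q \<longleftrightarrow> (\<forall>i j. q i j = 1 \<or> q i j = -1) \<and> (\<forall>i. q i i = -1)"

definition adjacent :: "('i \<Rightarrow> 'i \<Rightarrow> complex) \<Rightarrow> 'i \<Rightarrow> 'i \<Rightarrow> bool" where
  "adjacent q i j \<longleftrightarrow> q i j * q j i = -1"

text \<open>At a word starting with \<open>a\<close>, the claim is a claim about \<open>annih a\<close>; commuting \<open>annih a\<close> past both factors
  leaves terms that cancel because \<open>q p p = -1\<close>.  The same induction gives \<open>create_commute\<close>.\<close>

lemma create_square:
  assumes "q p p = -1"
  shows "create q \<xi> p (create q \<xi> p g) = 0"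
proof
  fix v show "create q \<xi> p (create q \<xi> p g) v = 0 v"
  proof (induction v arbitrary: g)
    case (Cons a v)
    have "create q \<xi> p (create q \<xi> p g) (a # v) = annih a (create q \<xi> p (create q \<xi> p g)) v" by (simp add: annih_def)
    also have "\<dots> = 0" using Cons assms by (simp add: annih_create wt_create pointwise)
    finally show ?case by (simp add: pointwise)
  qed (simp add: pointwise)
qed

lemma create_commute:
  assumes "sign_matrix q" "\<not> adjacent q p b" "p \<noteq> b"
  shows "create q \<xi> p (create q \<xi> b g) = scl (q p b) (create q \<xi> b (create q \<xi> p g))"
proof
  have q: "q p b = 1 \<and> q b p = 1 \<or> q p b = -1 \<and> q b p = -1"
    using assms unfolding sign_matrix_def adjacent_def by (metis mult_1 mult_minus1 mult.commute minus_minus)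
  have q2: "q i j * q i j = 1" for i j using assms(1) unfolding sign_matrix_def by (metis mult_1 mult_minus1 minus_minus)
  fix v show "create q \<xi> p (create q \<xi> b g) v = scl (q p b) (create q \<xi> b (create q \<xi> p g)) v"
  proof (induction v arbitrary: g)
    case (Cons a v)
    have "create q \<xi> p (create q \<xi> b g) (a # v) = annih a (create q \<xi> p (create q \<xi> b g)) v" by (simp add: annih_def)
    also have "\<dots> = annih a (scl (q p b) (create q \<xi> b (create q \<xi> p g))) v"
      using Cons q assms(3) by (auto simp: annih_create wt_create pointwise algebra_simps)
    finally show ?case by (simp add: annih_def)
  qed (simp add: pointwise)
qed

lemma annih_square:
  assumes "sign_matrix q" "g \<in> hw_span q \<xi>"
  shows "annih p (annih p g) = 0"
  using assms(2)
proof induction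
  case (create g j)
  have "q p p = -1" "q j p = 1 \<or> q j p = -1" using assms(1) unfolding sign_matrix_def by auto
  then show ?case using create by (auto simp: annih_create annih_wt)
qed (auto simp: annih_empty)

lemma annih_commute:
  assumes "sign_matrix q" "\<not> adjacent q p b" "p \<noteq> b" "g \<in> hw_span q \<xi>"
  shows "annih p (annih b g) = scl (q p b) (annih b (annih p g))"
  using assms(4)
proof induction
  case (create g j)
  have q: "q p b = 1 \<and> q b p = 1 \<or> q p b = -1 \<and> q b p = -1"
    using assms unfolding sign_matrix_def adjacent_def by (metis mult_1 mult_minus1 mult.commute minus_minus)
  then show ?case using create assms(3) by (auto simp: annih_create annih_wt algebra_simps)
qed (auto simp: annih_empty algebra_simps)

text \<open>Reflection at the vertex \<open>p\<close>.  The roles of creation and annihilation at \<open>p\<close> are exchanged, and for a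
  neighbour \<open>j\<close> of \<open>p\<close> the operators are replaced by their braided commutators with those at \<open>p\<close>.  These new
  operators again satisfy the relations of a highest weight module: the new braiding matrix is
  \<open>refl_matrix\<close>, the new highest weight is \<open>refl_hw\<close>, the new vacuum is \<open>create q \<xi> p empty_word\<close>, and
  \<open>refl_const\<close> collects the scalars by which the relations differ from the normalised ones.\<close>

definition refl_matrix :: "('i \<Rightarrow> 'i \<Rightarrow> complex) \<Rightarrow> 'i \<Rightarrow> 'i \<Rightarrow> 'i \<Rightarrow> complex" where
  "refl_matrix q p j i = (if i = p \<or> j = p then q j i else
     q j i * (if adjacent q p i then q j p else 1) * (if adjacent q p j then q p i else 1) *
     (if adjacent q p i \<and> adjacent q p j then -1 else 1))"

definition refl_hw :: "('i \<Rightarrow> 'i \<Rightarrow> complex) \<Rightarrow> ('i \<Rightarrow> complex) \<Rightarrow> 'i \<Rightarrow> 'i \<Rightarrow> complex" where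
  "refl_hw q \<xi> p j = (if j = p then 1 / \<xi> p else if adjacent q p j then - \<xi> p * \<xi> j else \<xi> j)"

definition refl_create where
  "refl_create q \<xi> p j g = (if j = p then annih p (wt_op q p g)
     else if adjacent q p j then create q \<xi> p (create q \<xi> j g) - scl (q p j) (create q \<xi> j (create q \<xi> p g))
     else create q \<xi> j g)"

definition refl_annih where
  "refl_annih q \<xi> p j g = (if j = p then create q \<xi> p g
     else if adjacent q p j then annih p (annih j g) - scl (q p j) (annih j (annih p g))
     else annih j g)"

definition refl_wt where
  "refl_wt q p j g = (if j = p then wt_op q p g
     else if adjacent q p j then - wt_op q p (wt_op q j g) else wt_op q j g)"

definition refl_const where
  "refl_const q \<xi> p j = (if j = p then - \<xi> p else if adjacent q p j then - 2 * q p j else 1)"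

lemma linear_refl_create: "linear_op (refl_create q \<xi> p j)"
  by (auto simp: linear_op_def refl_create_def algebra_simps)

lemma linear_refl_annih: "linear_op (refl_annih q \<xi> p j)"
  by (auto simp: linear_op_def refl_annih_def algebra_simps)

lemma linear_refl_wt: "linear_op (refl_wt q p j)"
  by (auto simp: linear_op_def refl_wt_def algebra_simps)

lemma wt_wt:
  assumes "sign_matrix q"
  shows "wt_op q j (wt_op q j g) = g"
proof
  fix v
  have "weight q j v * weight q j v = 1"
  proof (induction v)
    case (Cons a v)
    have "q j a = 1 \<or> q j a = -1" "q a j = 1 \<or> q a j = -1" using assms unfolding sign_matrix_def by auto
    then show ?case using Cons by (auto simp: weight_def)
  qed (simp add: weight_def)
  then show "wt_op q j (wt_op q j g) v = g v"
    by (simp add: wt_op_def pointwise mult.assoc[symmetric])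
qed

lemma adjacentE:
  assumes "sign_matrix q" 
  obtains "adjacent q p a" "q p a = 1" "q a p = -1"
  | "adjacent q p a" "q p a = -1" "q a p = 1"
  | "\<not> adjacent q p a" "q p a = 1" "q a p = 1"
  | "\<not> adjacent q p a" "q p a = -1" "q a p = -1"
  using assms unfolding sign_matrix_def adjacent_def
  by (metis mult_1 mult_minus1 minus_minus mult.right_neutral mult_minus1_right one_neq_neg_one)

text \<open>A case distinction on the position of \<open>i\<close> and \<open>j\<close> relative to \<open>p\<close>; in each case both sides reduce to the
  same normal form by the commutation rules, the relations \<open>create_square\<close> and \<open>annih_square\<close> at \<open>p\<close>, and the
  fact that nonadjacent operators commute up to a sign.\<close>

lemma refl_commutation:
  assumes q: "sign_matrix q" and g: "g \<in> hw_span q \<xi>" and xi: "\<xi> p \<noteq> 0"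
  shows "refl_annih q \<xi> p i (refl_create q \<xi> p j g) =
    (if i = j then scl (refl_const q \<xi> p j) (g - scl (refl_hw q \<xi> p j) (refl_wt q p j g)) else 0)
    + scl (refl_matrix q p j i) (refl_create q \<xi> p j (refl_annih q \<xi> p i g))"
proof -
  have pp: "q p p = -1" "q i i = -1" "q j j = -1" using q unfolding sign_matrix_def by auto
  have sq: "create q \<xi> p (create q \<xi> p h) = 0" for h using create_square pp by metis
  have sqa: "annih p (annih p g) = 0" using annih_square q g by metis
  \<comment> \<open>The simplifier collects \<open>h + h\<close> into a numeral multiple in the ring of functions.\<close>
  have two: "2 * h = scl 2 h" for h :: "'a list \<Rightarrow> complex" by (simp add: fun_eq_iff pointwise)
  note s = two refl_annih_def refl_create_def refl_const_def refl_hw_def refl_wt_def refl_matrix_def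
     annih_create annih_wt wt_create wt_wt[OF q] sq sqa pp
  consider "i = p" "j = p" | "i = p" "j \<noteq> p" | "i \<noteq> p" "j = p" | "i \<noteq> p" "j \<noteq> p" by blast
  then show ?thesis
  proof cases
    case 1
    then show ?thesis using xi by (simp add: s algebra_simps)
  next
    case 2
    note jp = 2
    show ?thesis
    proof (cases "adjacent q p j")
      case True
      show ?thesis by (cases rule: adjacentE[OF q, of p j]) (use True jp in \<open>simp_all add: s\<close>)
    next
      case False
      have "create q \<xi> p (create q \<xi> j g) = scl (q p j) (create q \<xi> j (create q \<xi> p g))"
        by (rule create_commute[OF q False]) (use jp in simp)
      then show ?thesis by (cases rule: adjacentE[OF q, of p j]) (use False jp in \<open>simp_all add: s\<close>)
    qed
  next
    case 3
    note ip = 3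
    show ?thesis
    proof (cases "adjacent q p i")
      case True
      have "annih p (annih p (annih i g)) = 0" using annih_square q hw_span_annih[OF g] by metis
      then show ?thesis by (cases rule: adjacentE[OF q, of p i]) (use True ip in \<open>simp_all add: s\<close>)
    next
      case False
      have "annih p (annih i g) = scl (q p i) (annih i (annih p g))"
        by (rule annih_commute[OF q False _ g]) (use ip in simp)
      then show ?thesis by (cases rule: adjacentE[OF q, of p i]) (use False ip in \<open>simp_all add: s\<close>)
    qed
  next
    case 4
    have ij: "q i j = 1 \<or> q i j = -1" "q j i = 1 \<or> q j i = -1" using q unfolding sign_matrix_def by auto
    show ?thesis
    proof (cases "i = j")
      case True
      show ?thesis unfolding True[symmetric] using 4
        by (cases rule: adjacentE[OF q, of p i])
          (simp_all add: s wt_commute[of q i p], (rule ext, simp add: pointwise algebra_simps)+)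
    next
      case False
      show ?thesis using ij 4 False
        by (cases rule: adjacentE[OF q, of p i]; cases rule: adjacentE[OF q, of p j])
          (rule ext, auto simp add: s pointwise algebra_simps)+
    qed
  qed
qed

lemma sign_refl_matrix:
  assumes "sign_matrix q"
  shows "sign_matrix (refl_matrix q p)"
proof -
  have q: "q i j = 1 \<or> q i j = -1" for i j using assms unfolding sign_matrix_def by auto
  have d: "q i i = -1" for i using assms unfolding sign_matrix_def by auto
  have "refl_matrix q p i j = 1 \<or> refl_matrix q p i j = -1" for i j
    using q[of i j] q[of p j] q[of i p] by (auto simp: refl_matrix_def)
  moreover have "refl_matrix q p i i = -1" for i
    using d by (cases rule: adjacentE[OF assms, of p i]) (auto simp: refl_matrix_def)
  ultimately show ?thesis unfolding sign_matrix_def by blast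
qed

lemma adjacent_refl_matrix:
  assumes "sign_matrix q"
  shows "adjacent (refl_matrix q p) i j \<longleftrightarrow> adjacent q i j"
proof -
  have "refl_matrix q p i j * refl_matrix q p j i = q i j * q j i"
    by (cases rule: adjacentE[OF assms, of p i]; cases rule: adjacentE[OF assms, of p j])
       (auto simp: refl_matrix_def)
  then show ?thesis unfolding adjacent_def by simp
qed

lemma refl_annih_wt:
  assumes q: "sign_matrix q"
  shows "refl_annih q \<xi> p i (refl_wt q p j g) =
    scl (refl_matrix q p j i * refl_matrix q p i j) (refl_wt q p j (refl_annih q \<xi> p i g))"
proof -
  have pp: "q p p = -1" "q i i = -1" "q j j = -1" using q unfolding sign_matrix_def by auto
  have ij: "q i j = 1 \<or> q i j = -1" "q j i = 1 \<or> q j i = -1" using q unfolding sign_matrix_def by auto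
  note s = refl_annih_def refl_wt_def refl_matrix_def annih_wt wt_create pp
  show ?thesis
  proof (cases "i = p")
    case True
    show ?thesis unfolding True
      by (cases rule: adjacentE[OF q, of p j]; cases "j = p") (simp_all add: s)
  next
    case False
    show ?thesis
    proof (cases "j = p")
      case True
      show ?thesis unfolding True using False
        by (cases rule: adjacentE[OF q, of p i]) (simp_all add: s)
    next
      case jp: False
      show ?thesis using ij False jp
        by (cases rule: adjacentE[OF q, of p i]; cases rule: adjacentE[OF q, of p j])
          (auto simp: s)
    qed
  qed
qed

lemma refl_vacuum:
  assumes q: "sign_matrix q"
  shows "refl_annih q \<xi> p i (create q \<xi> p empty_word) = 0"
    and "refl_wt q p i (create q \<xi> p empty_word) = create q \<xi> p empty_word"
proof -
  have pp: "q p p = -1" using q unfolding sign_matrix_def by auto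
  note s = refl_annih_def refl_wt_def annih_create annih_wt wt_create pp annih_empty wt_empty create_square
  show "refl_annih q \<xi> p i (create q \<xi> p empty_word) = 0"
    by (cases rule: adjacentE[OF q, of p i]; cases "i = p") (simp_all add: s)
  show "refl_wt q p i (create q \<xi> p empty_word) = create q \<xi> p empty_word"
    by (cases rule: adjacentE[OF q, of p i]; cases "i = p") (simp_all add: s)
qed

text \<open>Any integer weight on the letters induces a grading of the functions on words that the operators
  respect.  It serves to track letters, lengths and heights.\<close>

definition graded :: "('i \<Rightarrow> int) \<Rightarrow> int \<Rightarrow> ('i list \<Rightarrow> complex) \<Rightarrow> bool" where
  "graded d n g \<longleftrightarrow> (\<forall>v. g v \<noteq> 0 \<longrightarrow> (\<Sum>i\<leftarrow>v. d i) = n)"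

lemma graded_empty: "graded d 0 empty_word" by (auto simp: graded_def empty_word_def)

lemma graded_wt: "graded d n g \<Longrightarrow> graded d n (wt_op q j g)"
  by (auto simp: graded_def wt_op_def pointwise)

lemma graded_annih: "graded d n g \<Longrightarrow> graded d (n - d i) (annih i g)"
  by (fastforce simp: graded_def annih_def)

lemma graded_create: "graded d n g \<Longrightarrow> graded d (n + d j) (create q \<xi> j g)"
proof -
  have "(\<Sum>i\<leftarrow>v. d i) = n + d j" if "create q \<xi> j g v \<noteq> 0" "graded d n g" for v n g
    using that
  proof (induction v arbitrary: n g)
    case (Cons a v)
    show ?case
    proof (cases "a = j \<and> g v \<noteq> 0")
      case True
      then show ?thesis using Cons.prems(2) by (auto simp: graded_def)
    next
      case False
      then have "create q \<xi> j (annih a g) v \<noteq> 0" using Cons.prems(1) by (auto simp: annih_def split: if_splits)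
      from Cons.IH[OF this graded_annih[OF Cons.prems(2)]] show ?thesis by simp
    qed
  qed simp
  then show "graded d n g \<Longrightarrow> graded d (n + d j) (create q \<xi> j g)" unfolding graded_def by blast
qed

lemma graded_diff: "graded d n g \<Longrightarrow> graded d n h \<Longrightarrow> graded d n (g - scl c h)"
  unfolding graded_def by (metis (no_types, lifting) diff_self minus_apply mult_zero_right scl_apply)

lemma graded_word: "graded d (\<Sum>i\<leftarrow>w. d i) (hw_word q \<xi> w)"
proof (induction w)
  case (Cons j w)
  from graded_create[OF this, of j q \<xi>] show ?case by (simp add: algebra_simps)
qed (simp add: graded_empty)

text \<open>The gradings that count single letters.\<close>

lemma hw_word_letters:
  assumes "hw_word q \<xi> w v \<noteq> 0"
  shows "set w = set v" "length w = length v"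
proof -
  have s: "(\<Sum>i\<leftarrow>w. d i) = (\<Sum>i\<leftarrow>v. d i)" for d :: "_ \<Rightarrow> int" using graded_word[of d w q \<xi>] assms unfolding graded_def by metis
  have c: "(\<Sum>i\<leftarrow>w. if i = x then 1 else 0) = int (count_list w x)" for w :: "'a list" and x
    by (induction w) auto
  have "count_list w x = count_list v x" for x using s[of "\<lambda>i. if i = x then 1 else 0"] unfolding c by simp
  then show "set w = set v" by (metis count_list_0_iff subsetI subset_antisym)
  show "length w = length v" using s[of "\<lambda>_. 1"] by (simp add: sum_list_triv)
qed

text \<open>The letters of the reflected module, expressed in the old ones: \<open>p\<close> lowers where it used to raise, and a
  neighbour of \<open>p\<close> also carries a letter \<open>p\<close>.\<close>

definition refl_height :: "('i \<Rightarrow> 'i \<Rightarrow> complex) \<Rightarrow> 'i \<Rightarrow> ('i \<Rightarrow> int) \<Rightarrow> 'i \<Rightarrow> int" where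
  "refl_height q p d j = (if j = p then - d p else if adjacent q p j then d j + d p else d j)"

lemma graded_refl_create:
  assumes "graded d n g"
  shows "graded d (n + refl_height q p d j) (refl_create q \<xi> p j g)"
proof -
  have "graded d (n + (d j + d p)) (create q \<xi> p (create q \<xi> j g) - scl (q p j) (create q \<xi> j (create q \<xi> p g)))"
    using graded_create[OF graded_create[OF assms], of j p q \<xi>] graded_create[OF graded_create[OF assms], of p j q \<xi>]
    by (intro graded_diff) (auto simp: algebra_simps)
  then show ?thesis using graded_annih[OF graded_wt[OF assms]] graded_create[OF assms]
    by (auto simp: refl_height_def refl_create_def)
qed

text \<open>The module of highest weight \<open>\<xi>\<close>, seen through the reflected operators, is the module of the reflected
  parameters.  So a nonzero word there yields a nonzero word here; its height is shifted by \<open>d p\<close>, the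
  height of the new vacuum.  This vacuum is nonzero because \<open>\<xi> p \<noteq> 1\<close>, and \<open>\<xi> p\<close> can be inverted.\<close>

lemma reflect_word:
  assumes q: "sign_matrix q" and xi: "\<xi> p \<noteq> 0" "\<xi> p \<noteq> 1" and "p \<in> I"
    and w': "set w' \<subseteq> I" "hw_word (refl_matrix q p) (refl_hw q \<xi> p) w' \<noteq> 0"
  shows "\<exists>w. set w \<subseteq> I \<and> hw_word q \<xi> w \<noteq> 0 \<and>
     (\<Sum>i\<leftarrow>w. d i) = (\<Sum>i\<leftarrow>w'. refl_height q p d i) + d p"
proof -
  define vac where "vac = create q \<xi> p empty_word"
  define g where "g = foldr (refl_create q \<xi> p) w' vac"
  have vacL: "vac \<in> hw_span q \<xi>" unfolding vac_def by (intro hw_span.intros)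
  have cl: "h \<in> hw_span q \<xi> \<Longrightarrow> refl_create q \<xi> p i h \<in> hw_span q \<xi>"
    "h \<in> hw_span q \<xi> \<Longrightarrow> refl_annih q \<xi> p i h \<in> hw_span q \<xi>" for h i
    by (auto simp: refl_create_def refl_annih_def intro!: hw_span_wt hw_span_annih hw_span_diff hw_span_scale hw_span.create)
  from w'(2) obtain v' where v': "hw_word (refl_matrix q p) (refl_hw q \<xi> p) w' v' \<noteq> 0"
    by (auto simp: fun_eq_iff pointwise)
  have len: "length v' = length w'" using hw_word_letters[OF v'] by simp
  have r: "fold (refl_annih q \<xi> p) v' g =
      scl ((\<Prod>j\<leftarrow>w'. refl_const q \<xi> p j) * hw_word (refl_matrix q p) (refl_hw q \<xi> p) w' v') vac"
    unfolding g_def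
    by (rule realization[where L = "hw_span q \<xi>" and K = "refl_wt q p"])
      (use vacL cl xi q len in \<open>auto simp: linear_refl_annih linear_refl_create linear_refl_wt refl_commutation
          refl_annih_wt vac_def refl_vacuum\<close>)
  have "vac [p] \<noteq> 0" using xi unfolding vac_def by (simp add: empty_word_def weight_def)
  moreover have "refl_const q \<xi> p j \<noteq> 0" for j
    using xi q unfolding refl_const_def sign_matrix_def
    by (metis neg_equal_0_iff_equal no_zero_divisors one_neq_zero zero_neq_numeral)
  then have "(\<Prod>j\<leftarrow>w'. refl_const q \<xi> p j) \<noteq> 0" by (auto simp: prod_list_zero_iff)
  ultimately have "fold (refl_annih q \<xi> p) v' g [p] \<noteq> 0" unfolding r using v' by (simp add: pointwise)
  moreover have "fold (refl_annih q \<xi> p) v' 0 = 0"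
    by (induction v') (auto simp: linear_opD[OF linear_refl_annih])
  ultimately have "g \<noteq> 0" by (metis zero_fun_apply)
  then obtain v where v: "g v \<noteq> 0" by (auto simp: fun_eq_iff pointwise)
  have "g \<in> hw_span q \<xi>" unfolding g_def by (induction w') (auto simp: vacL cl)
  from hw_span_word[OF this v] obtain w where w: "hw_word q \<xi> w v \<noteq> 0" by blast
  have gr: "graded d ((\<Sum>i\<leftarrow>w'. refl_height q p d i) + d p) g" for d
    unfolding g_def
  proof (induction w')
    case Nil
    then show ?case using graded_create[OF graded_empty, of d p q \<xi>] by (simp add: vac_def)
  next
    case (Cons j w')
    from graded_refl_create[OF this, of q p j \<xi>] show ?case by (simp add: algebra_simps)
  qed
  have sum_v: "(\<Sum>i\<leftarrow>v. d i) = (\<Sum>i\<leftarrow>w'. refl_height q p d i) + d p" for d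
    using gr v unfolding graded_def by blast
  \<comment> \<open>The grading that counts the letters outside \<open>I\<close> shows that none of them occurs.\<close>
  have "(\<Sum>i\<leftarrow>v. if i \<in> I then 0 else 1) = (0::int)"
  proof -
    have "refl_height q p (\<lambda>i. if i \<in> I then 0 else 1) i = 0" if "i \<in> I" for i
      using that assms(4) by (auto simp: refl_height_def)
    then have "(\<Sum>i\<leftarrow>w'. refl_height q p (\<lambda>i. if i \<in> I then 0 else 1) i) = 0"
      using w'(1) by (induction w') auto
    then show ?thesis using sum_v[of "\<lambda>i. if i \<in> I then 0 else 1"] assms(4) by simp
  qed
  then have "set v \<subseteq> I"
  proof (induction v)
    case (Cons a v)
    have "(\<Sum>i\<leftarrow>v. if i \<in> I then 0 else 1) \<ge> (0::int)" by (rule sum_list_nonneg) auto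
    then show ?case using Cons by (auto split: if_splits)
  qed simp
  moreover have "(\<Sum>i\<leftarrow>w. d i) = (\<Sum>i\<leftarrow>v. d i)"
    using graded_word[of d w q \<xi>] w unfolding graded_def by metis
  ultimately show ?thesis using hw_word_letters(1)[OF w] sum_v w by (metis zero_fun_apply)
qed

section \<open>Cyclic diagrams\<close>

text \<open>In the Nichols algebra of diagonal type, embedded in the quantum shuffle algebra, \<open>nichols_word q w v\<close> is
  the coefficient of \<open>v\<close> in the product of the letters of \<open>w\<close>.\<close>

abbreviation nichols_word :: "('i \<Rightarrow> 'i \<Rightarrow> complex) \<Rightarrow> 'i list \<Rightarrow> 'i list \<Rightarrow> complex" where
  "nichols_word q \<equiv> hw_word q (\<lambda>_. 0)"

text \<open>The terms of \<open>create\<close> that carry the factor \<open>\<xi>\<close>; up to a braiding factor this is right multiplication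
  by the letter \<open>j\<close>.\<close>

definition rmult :: "('i \<Rightarrow> 'i \<Rightarrow> complex) \<Rightarrow> 'i \<Rightarrow> ('i list \<Rightarrow> complex) \<Rightarrow> 'i list \<Rightarrow> complex" where
  "rmult q j g = create q (\<lambda>_. 0) j g - create q (\<lambda>_. 1) j g"

lemma annih_rmult:
  "annih i (rmult q j g) = (if i = j then wt_op q j g else 0) + scl (q j i) (rmult q j (annih i g))"
  by (auto simp: rmult_def annih_create algebra_simps)

lemma linear_rmult: "linear_op (rmult q j)"
  by (simp add: linear_op_def rmult_def algebra_simps)

lemma create_rmult: "create q \<xi> j g = create q (\<lambda>_. 0) j g - scl (\<xi> j) (rmult q j g)"
proof
  fix v show "create q \<xi> j g v = (create q (\<lambda>_. 0) j g - scl (\<xi> j) (rmult q j g)) v"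
  proof (induction v arbitrary: g)
    case (Cons a v)
    have "create q \<xi> j g (a # v) = annih a (create q \<xi> j g) v" by (simp add: annih_def)
    also have "\<dots> = annih a (create q (\<lambda>_. 0) j g - scl (\<xi> j) (rmult q j g)) v"
      unfolding annih_create annih_rmult pointwise lin_annih by (simp add: Cons[of "annih a g"] pointwise algebra_simps)
    finally show ?case by (simp add: annih_def)
  qed (simp add: pointwise rmult_def)
qed

lemma rmult_create: "rmult q j (create q (\<lambda>_. 0) i g) = scl (q j i) (create q (\<lambda>_. 0) i (rmult q j g))"
proof
  fix v show "rmult q j (create q (\<lambda>_. 0) i g) v = scl (q j i) (create q (\<lambda>_. 0) i (rmult q j g)) v"
  proof (induction v arbitrary: g)
    case (Cons a v)
    have "rmult q j (create q (\<lambda>_. 0) i g) (a # v) = annih a (rmult q j (create q (\<lambda>_. 0) i g)) v" by (simp add: annih_def)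
    also have "\<dots> = annih a (scl (q j i) (create q (\<lambda>_. 0) i (rmult q j g))) v"
      using Cons[of "annih a g"]
      by (auto simp: annih_create annih_rmult wt_create pointwise linear_opD[OF linear_rmult] algebra_simps)
    finally show ?case by (simp add: annih_def)
  qed (simp add: pointwise rmult_def)
qed

lemma rmult_empty: "rmult q j empty_word = create q (\<lambda>_. 0) j empty_word"
proof
  fix v show "rmult q j empty_word v = create q (\<lambda>_. 0) j empty_word v"
  proof (cases v)
    case (Cons a u)
    have "rmult q j empty_word (a # u) = annih a (rmult q j empty_word) u" by (simp add: annih_def)
    also have "\<dots> = annih a (create q (\<lambda>_. 0) j empty_word) u"
      by (simp add: annih_create annih_rmult annih_empty wt_empty linear_opD[OF linear_rmult])
    finally show ?thesis by (simp add: annih_def Cons)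
  qed (simp add: pointwise rmult_def)
qed

lemma hw_span_rmult: "g \<in> hw_span q (\<lambda>_. 0) \<Longrightarrow> rmult q j g \<in> hw_span q (\<lambda>_. 0)"
proof (induction rule: hw_span.induct)
  case empty
  then show ?case by (simp add: rmult_empty hw_span.intros)
next
  case (comb g h c)
  then show ?case by (simp add: linear_opD[OF linear_rmult] hw_span.comb)
next
  case (create g i)
  then show ?case by (simp add: rmult_create hw_span_scale hw_span.create)
qed

text \<open>As vector spaces, all highest weight modules lie inside the Nichols algebra, since \<open>create q \<xi> j\<close> is left
  multiplication minus \<open>\<xi>\<^sub>j\<close> times \<open>rmult\<close> and the Nichols algebra is stable under both.  Hence one infinite-dimensional
  module proves that the Nichols algebra is infinite-dimensional.\<close>

lemma hw_span_subset: "g \<in> hw_span q \<xi> \<Longrightarrow> g \<in> hw_span q (\<lambda>_. 0)"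
proof (induction rule: hw_span.induct)
  case (create g j)
  then show ?case by (subst create_rmult) (intro hw_span_diff hw_span_scale hw_span_rmult hw_span.create)
qed (auto intro: hw_span.intros)

text \<open>Write \<open>\<bar>\<xi>\<^sub>j\<bar> = 2\<^bsup>d j\<^esup>\<close>.  Reflection at a vertex \<open>p\<close> with \<open>d p > 0\<close> negates \<open>d p\<close>, adds \<open>d p\<close> to the neighbours, and
  preserves adjacency.  The stated conditions on \<open>d\<close>, which read the cycle from \<open>p\<close> onwards, then hold
  again with the next vertex in place of \<open>p\<close>, so the reflections can go round the cycle for ever.  Each
  of them adds at least \<open>1\<close> to the height of the word that is transported back.\<close>

lemma cycle_words:
  fixes q :: "nat \<Rightarrow> nat \<Rightarrow> complex" and d :: "nat \<Rightarrow> int"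
  assumes m: "m \<ge> 3"
    and q: "sign_matrix q" and adj: "\<And>k. adjacent q (k mod m) (Suc k mod m)"
    and xi: "\<And>j. j < m \<Longrightarrow> norm (\<xi> j) = 2 powi d j"
    and d0: "d (k mod m) > 0" and d1: "\<And>i. 1 \<le> i \<Longrightarrow> i \<le> m - 2 \<Longrightarrow> d ((k + i) mod m) \<ge> 0"
    and d2: "d ((k + (m - 1)) mod m) + d (k mod m) \<ge> 0"
  shows "\<exists>w. set w \<subseteq> {..<m} \<and> hw_word q \<xi> w \<noteq> 0 \<and> (\<Sum>i\<leftarrow>w. d i) \<ge> int N"
  using assms(2-)
proof (induction N arbitrary: q \<xi> d k)
  case 0
  have "hw_word q \<xi> [] [] \<noteq> 0" by (simp add: empty_word_def)
  then have "hw_word q \<xi> [] \<noteq> 0" by (metis zero_fun_apply)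
  then show ?case by (intro exI[of _ "[]"]) auto
next
  case (Suc N)
  \<comment> \<open>The pivot of the reflection.\<close>
  define p where "p = k mod m"
  have p: "p < m" using m unfolding p_def by simp
  have adj_sym: "adjacent q j i" if "adjacent q i j" for i j using that unfolding adjacent_def by (simp add: mult.commute)
  have neq: "(k + i) mod m \<noteq> p" if "0 < i" "i < m" for i
  proof
    assume "(k + i) mod m = p"
    then have "m dvd i" unfolding p_def using mod_eq_dvd_iff_nat[of k "k + i" m] by simp
    then show False using that by (auto dest: dvd_imp_le)
  qed
  have a1: "adjacent q p ((k + 1) mod m)" using Suc.prems(2)[of k] unfolding p_def by simp
  have a2: "adjacent q p ((k + (m - 1)) mod m)"
  proof -
    have "Suc (k + (m - 1)) mod m = p" using m unfolding p_def by simp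
    then show ?thesis using Suc.prems(2)[of "k + (m - 1)"] adj_sym by metis
  qed
  let ?d = "refl_height q p d"
  have d0: "d p > 0" and d2: "d ((k + (m - 1)) mod m) + d p \<ge> 0" using Suc.prems(4,6) by (auto simp: p_def)
  have h1: "?d ((k + 1) mod m) = d ((k + 1) mod m) + d p"
    using a1 neq[of 1] m by (auto simp: refl_height_def)
  have hm: "?d ((k + (m - 1)) mod m) = d ((k + (m - 1)) mod m) + d p"
    using a2 neq[of "m - 1"] m by (auto simp: refl_height_def)
  have hp: "?d p = - d p" by (simp add: refl_height_def)
  have norm_p: "norm (\<xi> p) = 2 powi d p" by (rule Suc.prems(3)[OF p])
  have "2 powi d p > (1::real)" using d0 by (simp add: one_less_power_int)
  then have xp: "\<xi> p \<noteq> 0" "\<xi> p \<noteq> 1" using norm_p by auto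
  \<comment> \<open>The induction hypothesis is applied to the reflected data, with the following vertex as pivot.\<close>
  have "\<exists>w. set w \<subseteq> {..<m} \<and> hw_word (refl_matrix q p) (refl_hw q \<xi> p) w \<noteq> 0 \<and> (\<Sum>i\<leftarrow>w. ?d i) \<ge> int N"
  proof (rule Suc.IH[of _ _ _ "Suc k"])
    show "sign_matrix (refl_matrix q p)" by (rule sign_refl_matrix) fact
    show "adjacent (refl_matrix q p) (j mod m) (Suc j mod m)" for j
      unfolding adjacent_refl_matrix[OF Suc.prems(1)] by fact
    show "norm (refl_hw q \<xi> p j) = 2 powi ?d j" if "j < m" for j
      using Suc.prems(3)[OF that] norm_p
      by (auto simp: refl_hw_def refl_height_def norm_divide norm_mult power_int_add power_int_minus divide_simps)
    have "d ((k + 1) mod m) \<ge> 0" using Suc.prems(5)[of 1] m by simp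
    then show "?d (Suc k mod m) > 0" using h1 d0 by simp
    show "?d ((Suc k + i) mod m) \<ge> 0" if "1 \<le> i" "i \<le> m - 2" for i
    proof (cases "i = m - 2")
      case True
      then have "Suc k + i = k + (m - 1)" using m by simp
      then show ?thesis unfolding \<open>Suc k + i = k + (m - 1)\<close> hm using d2 by simp
    next
      case False
      then have "d ((k + Suc i) mod m) \<ge> 0" "(k + Suc i) mod m \<noteq> p"
        using Suc.prems(5)[of "Suc i"] neq[of "Suc i"] that by auto
      then show ?thesis using d0 by (auto simp: refl_height_def)
    qed
    have "(Suc k + (m - 1)) mod m = p" using m unfolding p_def by simp
    then show "?d ((Suc k + (m - 1)) mod m) + ?d (Suc k mod m) \<ge> 0"
      using hp h1 \<open>d ((k + 1) mod m) \<ge> 0\<close> by simp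
  qed
  then obtain w' where w': "set w' \<subseteq> {..<m}" "hw_word (refl_matrix q p) (refl_hw q \<xi> p) w' \<noteq> 0"
    "(\<Sum>i\<leftarrow>w'. ?d i) \<ge> int N" by blast
  from reflect_word[OF Suc.prems(1) xp _ w'(1,2), of d] p w'(3) d0 show ?case by fastforce
qed

text \<open>Take the highest weight \<open>\<xi> = 2\<close>, of height \<open>1\<close> everywhere; then height is length.\<close>

theorem nichols_cycle_infinite:
  fixes q :: "nat \<Rightarrow> nat \<Rightarrow> complex"
  assumes m: "m \<ge> 3" and q: "sign_matrix q" and adj: "\<And>k. adjacent q (k mod m) (Suc k mod m)"
  shows "\<exists>w v. set w \<subseteq> {..<m} \<and> set v \<subseteq> {..<m} \<and> length w \<ge> N \<and> length v = length w \<and> nichols_word q w v \<noteq> 0"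
proof -
  have "\<exists>w. set w \<subseteq> {..<m} \<and> hw_word q (\<lambda>_. 2) w \<noteq> 0 \<and> (\<Sum>i\<leftarrow>w. 1) \<ge> int N"
    by (rule cycle_words[where k = 0]) (use m q adj in auto)
  then obtain w v where w: "set w \<subseteq> {..<m}" "length w \<ge> N" "hw_word q (\<lambda>_. 2) w v \<noteq> 0"
    by (auto simp: sum_list_triv fun_eq_iff pointwise)
  have "hw_word q (\<lambda>_. 2) w \<in> hw_span q (\<lambda>_. 2)"
    by (induction w) (auto intro: hw_span.intros)
  then obtain u where u: "nichols_word q u v \<noteq> 0"
    using hw_span_word hw_span_subset w(3) by metis
  show ?thesis using w u hw_word_letters[OF w(3)] hw_word_letters[OF u] by (intro exI[of _ u] exI[of _ v]) auto
qed

section \<open>Inversions and reduced expressions\<close>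

text \<open>The factor by which the lift of a permutation to the braid group acts in diagonal type: one matrix entry
  for every inversion of the list \<open>ps\<close> that enumerates the permutation.\<close>

fun inv_prod :: "('a \<Rightarrow> 'a \<Rightarrow> 'c::comm_monoid_mult) \<Rightarrow> (nat \<Rightarrow> 'a) \<Rightarrow> nat list \<Rightarrow> 'c" where
  "inv_prod q v [] = 1"
| "inv_prod q v (p # ps) = (\<Prod>r\<in>{r \<in> set ps. r < p}. q (v p) (v r)) * inv_prod q v ps"

abbreviation swp :: "nat \<Rightarrow> nat \<Rightarrow> nat" where "swp i \<equiv> Transposition.transpose i (Suc i)"

lemma swp_less:
  assumes "r \<noteq> p" "\<not> (r = i \<and> p = Suc i)" "\<not> (r = Suc i \<and> p = i)"
  shows "swp i r < swp i p \<longleftrightarrow> r < p"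
  using assms by (auto simp: Transposition.transpose_def)

lemma inj_swp: "inj_on (swp i) A"
  by (rule inj_onI) (metis transpose_involutory)

lemma swp_image_less:
  assumes "\<And>r. r \<in> S \<Longrightarrow> swp i r < swp i p \<longleftrightarrow> r < p"
  shows "{r \<in> swp i ` S. r < swp i p} = swp i ` {r \<in> S. r < p}"
  using assms by auto

lemma inv_prod_head:
  assumes "p \<notin> set ps" "\<not> (i \<in> insert p (set ps) \<and> Suc i \<in> insert p (set ps))"
  shows "(\<Prod>r\<in>{r \<in> set (map (swp i) ps). r < swp i p}. q (v (swp i p)) (v r)) =
    (\<Prod>r\<in>{r \<in> set ps. r < p}. q ((v \<circ> swp i) p) ((v \<circ> swp i) r))"
proof -
  have "{r \<in> set (map (swp i) ps). r < swp i p} = swp i ` {r \<in> set ps. r < p}"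
    unfolding set_map by (rule swp_image_less, rule swp_less) (use assms in auto)
  then show ?thesis by (simp add: prod.reindex[OF inj_swp])
qed

lemma inv_prod_swap_other:
  assumes "distinct ps" "\<not> (i \<in> set ps \<and> Suc i \<in> set ps)"
  shows "inv_prod q v (map (swp i) ps) = inv_prod q (v \<circ> swp i) ps"
  using assms
proof (induction ps)
  case (Cons p ps)
  then show ?case using inv_prod_head[of p ps i q v] by (auto simp: comp_def)
qed simp

text \<open>Exchanging the values \<open>i\<close> and \<open>i + 1\<close>, where \<open>i\<close> comes first, creates one inversion, between these two values,
  and changes the others only by renaming.\<close>

lemma inv_prod_swap:
  assumes "distinct ps" "ps = as @ i # bs" "Suc i \<in> set bs"
  shows "inv_prod q v (map (swp i) ps) = q (v (Suc i)) (v i) * inv_prod q (v \<circ> swp i) ps"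
  using assms
proof (induction as arbitrary: ps)
  case Nil
  have ib: "i \<notin> set bs" using Nil by auto
  have e: "{r \<in> set (map (swp i) bs). r < swp i i} = insert i {r \<in> set bs. r < i}"
  proof (rule Set.set_eqI, rule iffI)
    fix r assume "r \<in> {r \<in> set (map (swp i) bs). r < swp i i}"
    then obtain b where "b \<in> set bs" "r = swp i b" "swp i b < Suc i" by auto
    then show "r \<in> insert i {r \<in> set bs. r < i}" using ib by (auto simp: Transposition.transpose_def split: if_splits)
  next
    fix r assume "r \<in> insert i {r \<in> set bs. r < i}"
    then consider "r = i" | "r \<in> set bs" "r < i" by auto
    then show "r \<in> {r \<in> set (map (swp i) bs). r < swp i i}"
    proof cases
      case 1
      have "swp i (Suc i) \<in> swp i ` set bs" by (rule imageI) (rule Nil(3))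
      then show ?thesis using 1 by simp
    next
      case 2
      have "swp i r \<in> swp i ` set bs" by (rule imageI) (rule 2)
      moreover have "swp i r = r" using 2 by (simp add: Transposition.transpose_def)
      ultimately show ?thesis using 2 by simp
    qed
  qed
  have "(\<Prod>r\<in>{r \<in> set (map (swp i) bs). r < swp i i}. q (v (swp i i)) (v r)) =
      q (v (Suc i)) (v i) * (\<Prod>r\<in>{r \<in> set bs. r < i}. q (v (Suc i)) (v r))"
    unfolding e by simp
  also have "(\<Prod>r\<in>{r \<in> set bs. r < i}. q (v (Suc i)) (v r)) =
      (\<Prod>r\<in>{r \<in> set bs. r < i}. q ((v \<circ> swp i) i) ((v \<circ> swp i) r))"
    by (rule prod.cong) (auto simp: Transposition.transpose_def)
  finally show ?case using Nil ib inv_prod_swap_other[of bs i q v] by (simp add: mult_ac comp_def)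
next
  case (Cons p as)
  let ?ps = "as @ i # bs"
  have ps: "ps = p # ?ps" "p \<notin> set ?ps" "distinct ?ps" using Cons.prems by auto
  then have p: "p \<noteq> i" "p \<noteq> Suc i" using Cons.prems(3) by auto
  have "{r \<in> set (map (swp i) ?ps). r < swp i p} = swp i ` {r \<in> set ?ps. r < p}"
    unfolding set_map by (rule swp_image_less, rule swp_less) (use p ps(2) in auto)
  then have e: "(\<Prod>r\<in>{r \<in> set (map (swp i) ?ps). r < swp i p}. q (v (swp i p)) (v r)) =
    (\<Prod>r\<in>{r \<in> set ?ps. r < p}. q ((v \<circ> swp i) p) ((v \<circ> swp i) r))"
    by (simp only: prod.reindex[OF inj_swp] comp_def)
  have "inv_prod q v (map (swp i) (p # ?ps)) = q (v (Suc i)) (v i) * inv_prod q (v \<circ> swp i) (p # ?ps)"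
    unfolding list.map(2)[of _ p] inv_prod.simps e Cons.IH[OF ps(3) refl Cons.prems(3)]
    by (rule mult.left_commute)
  then show ?case unfolding ps(1) .
qed

definition plist :: "nat \<Rightarrow> (nat \<Rightarrow> nat) \<Rightarrow> nat list" where
  "plist n \<pi> = map \<pi> [0..<n]"

lemma plist_permutes:
  assumes "\<pi> permutes {..<n}"
  shows "distinct (plist n \<pi>)" "set (plist n \<pi>) = {..<n}"
  using assms permutes_image[OF assms] permutes_inj[OF assms]
  by (auto simp: plist_def distinct_map atLeast0LessThan inj_on_def inj_def)

lemma plist_swp: "plist n (swp i \<circ> \<pi>) = map (swp i) (plist n \<pi>)"
  by (simp add: plist_def)

lemma swp_permutes: "Suc i < n \<Longrightarrow> swp i permutes {..<n}"
  by (rule permutes_swap_id) auto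

lemma plist_cases:
  assumes "\<pi> permutes {..<n}" "Suc i < n"
  obtains as bs where "plist n \<pi> = as @ i # bs" "Suc i \<in> set bs"
  | as bs where "plist n \<pi> = as @ Suc i # bs" "i \<in> set bs"
proof -
  have "i \<in> set (plist n \<pi>)" "Suc i \<in> set (plist n \<pi>)" using plist_permutes[OF assms(1)] assms(2) by auto
  then obtain as bs where 1: "plist n \<pi> = as @ i # bs" by (meson split_list)
  show ?thesis
  proof (cases "Suc i \<in> set bs")
    case False
    then have "Suc i \<in> set as" using \<open>Suc i \<in> set (plist n \<pi>)\<close> 1 by auto
    then obtain cs ds where "as = cs @ Suc i # ds" by (meson split_list)
    then show ?thesis using 1 that(2)[of cs "ds @ i # bs"] by simp
  qed (use 1 that in blast)
qed

text \<open>Two to the number of inversions: with the constant matrix \<open>2\<close>, the lemmas on \<open>inv_prod\<close> count inversions.\<close>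

abbreviation inv_pow2 :: "nat \<Rightarrow> (nat \<Rightarrow> nat) \<Rightarrow> nat" where
  "inv_pow2 n \<pi> \<equiv> inv_prod (\<lambda>_ _. 2) id (plist n \<pi>)"

lemma inv_prod_const: "inv_prod (\<lambda>_ _. c) v ps = inv_prod (\<lambda>_ _. c) v' ps"
  by (induction ps) simp_all

lemma inv_pow2_up:
  assumes "\<pi> permutes {..<n}" "plist n \<pi> = as @ i # bs" "Suc i \<in> set bs"
  shows "inv_pow2 n (swp i \<circ> \<pi>) = 2 * inv_pow2 n \<pi>"
  unfolding plist_swp inv_prod_swap[OF plist_permutes(1)[OF assms(1)] assms(2,3)]
  by (rule arg_cong[OF inv_prod_const])

lemma inv_pow2_down:
  assumes "\<pi> permutes {..<n}" "plist n \<pi> = as @ Suc i # bs" "i \<in> set bs" "Suc i < n"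
  shows "inv_pow2 n \<pi> = 2 * inv_pow2 n (swp i \<circ> \<pi>)"
proof -
  have "plist n (swp i \<circ> \<pi>) = map (swp i) as @ i # map (swp i) bs" unfolding plist_swp assms(2) by simp
  moreover have "Suc i \<in> set (map (swp i) bs)" using assms(3) by (metis image_eqI list.set_map transpose_apply_first)
  ultimately have "inv_pow2 n (swp i \<circ> (swp i \<circ> \<pi>)) = 2 * inv_pow2 n (swp i \<circ> \<pi>)"
    by (rule inv_pow2_up[OF permutes_compose[OF assms(1) swp_permutes[OF assms(4)]]])
  moreover have "swp i \<circ> (swp i \<circ> \<pi>) = \<pi>" by (rule ext) simp
  ultimately show ?thesis by (simp only:)
qed

lemma simple_prod_Nil: "simple_prod [] = id"
  by (simp add: simple_prod_def)

lemma simple_prod_Cons: "simple_prod (i # is) = swp i \<circ> simple_prod is"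
  by (simp add: simple_prod_def)

lemma simple_prod_permutes: "set is \<subseteq> {i. Suc i < n} \<Longrightarrow> simple_prod is permutes {..<n}"
proof (induction "is")
  case (Cons i "is")
  then show ?case unfolding simple_prod_Cons by (intro permutes_compose[OF _ swp_permutes]) auto
qed (simp only: simple_prod_Nil permutes_id)

lemma inv_prod_id: "inv_prod q v (plist n id) = 1"
proof -
  have "inv_prod q v [a..<n] = 1" for a
  proof (induction "n - a" arbitrary: a)
    case (Suc x)
    have "(\<Prod>r\<in>{r \<in> set [Suc a..<n]. r < a}. q (v a) (v r)) = 1" by (rule prod.neutral) auto
    moreover have "[a..<n] = a # [Suc a..<n]" using Suc.hyps(2) by (intro upt_conv_Cons) simp
    moreover have "inv_prod q v [Suc a..<n] = 1" using Suc.hyps(2) by (intro Suc.hyps(1)) simp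
    ultimately show ?case by (simp only: inv_prod.simps mult_1)
  qed simp
  then show ?thesis by (simp add: plist_def)
qed

lemma inv_pow2_id: "inv_pow2 n id = 1"
  by (rule inv_prod_id)

lemma inv_pow2_le: "set is \<subseteq> {i. Suc i < n} \<Longrightarrow> inv_pow2 n (simple_prod is) \<le> 2 ^ length is"
proof (induction "is")
  case Nil
  show ?case unfolding simple_prod_Nil inv_pow2_id by simp
next
  case (Cons i "is")
  have p: "simple_prod is permutes {..<n}" "Suc i < n" using Cons.prems by (auto intro: simple_prod_permutes)
  have "inv_pow2 n (swp i \<circ> simple_prod is) \<le> 2 * inv_pow2 n (simple_prod is)"
  proof (cases rule: plist_cases[OF p])
    case (1 as bs) then show ?thesis by (intro eq_refl inv_pow2_up[OF p(1)])
  next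
    case (2 as bs) then show ?thesis using inv_pow2_down[OF p(1) 2 p(2)] by linarith
  qed
  also have "2 * inv_pow2 n (simple_prod is) \<le> 2 * 2 ^ length is"
    by (rule mult_le_mono2, rule Cons.IH) (use Cons.prems in simp)
  finally show ?case unfolding simple_prod_Cons length_Cons power_Suc .
qed

text \<open>Undo descents one by one: as long as some \<open>i + 1\<close> is listed before \<open>i\<close>, a simple transposition removes one
  inversion.  The length of the expression is the number of inversions, which by \<open>inv_pow2_le\<close> is the
  minimum.\<close>

lemma expr_exists:
  assumes "\<pi> permutes {..<n}"
  shows "\<exists>is. set is \<subseteq> {i. Suc i < n} \<and> simple_prod is = \<pi> \<and> inv_pow2 n \<pi> = 2 ^ length is"
  using assms
proof (induction "inv_pow2 n \<pi>" arbitrary: \<pi> rule: less_induct)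
  case less
  show ?case
  proof (cases "\<exists>i as bs. Suc i < n \<and> plist n \<pi> = as @ Suc i # bs \<and> i \<in> set bs")
    case True
    then obtain i as bs where i: "Suc i < n" "plist n \<pi> = as @ Suc i # bs" "i \<in> set bs" by blast
    have "inv_pow2 n \<pi> \<ge> 1"
    proof -
      have "inv_prod (\<lambda>_ _. 2::nat) id ps \<ge> 1" for ps by (induction ps) auto
      then show ?thesis .
    qed
    moreover have d: "inv_pow2 n \<pi> = 2 * inv_pow2 n (swp i \<circ> \<pi>)" by (rule inv_pow2_down[OF less.prems i(2,3,1)])
    ultimately have "inv_pow2 n (swp i \<circ> \<pi>) < inv_pow2 n \<pi>" by simp
    from less.hyps[OF this permutes_compose[OF less.prems swp_permutes[OF i(1)]]]
    obtain "is" where is_i: "set is \<subseteq> {i. Suc i < n}" "simple_prod is = swp i \<circ> \<pi>" "inv_pow2 n (swp i \<circ> \<pi>) = 2 ^ length is" by blast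
    have "simple_prod (i # is) = \<pi>" unfolding simple_prod_Cons is_i(2) by (rule ext) simp
    then show ?thesis using is_i d i(1) by (intro exI[of _ "i # is"]) auto
  next
    case False
    \<comment> \<open>Without descents the inverse permutation lists \<open>0, \<dots>, n - 1\<close> in increasing order.\<close>
    let ?s = "Hilbert_Choice.inv \<pi>"
    have s: "?s permutes {..<n}" by (rule permutes_inv) fact
    have "?s i < ?s (Suc i)" if i: "Suc i < n" for i
    proof (cases rule: plist_cases[OF less.prems i])
      case (1 as bs)
      from 1(2) obtain cs ds where "bs = cs @ Suc i # ds" by (meson split_list)
      with 1 have e: "plist n \<pi> = (as @ i # cs) @ Suc i # ds" by simp
      have l: "length (plist n \<pi>) = n" by (simp add: plist_def)
      have "\<pi> (length as) = i"
      proof -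
        have "plist n \<pi> ! length as = i" unfolding 1(1) by simp
        moreover have "length as < n" using l unfolding 1(1) by simp
        ultimately show ?thesis by (simp add: plist_def)
      qed
      moreover have "\<pi> (length (as @ i # cs)) = Suc i"
      proof -
        have "plist n \<pi> ! length (as @ i # cs) = Suc i" unfolding e nth_append_length by simp
        moreover have "length (as @ i # cs) < n" using l unfolding e by simp
        ultimately show ?thesis by (simp add: plist_def)
      qed
      ultimately have "?s i = length as" "?s (Suc i) = length (as @ i # cs)"
        using permutes_inj[OF less.prems] by (metis inv_f_f)+
      then show ?thesis by simp
    next
      case (2 as bs) then show ?thesis using False i by blast
    qed
    then have "sorted (map ?s [0..<n])" by (auto simp: sorted_iff_nth_Suc less_imp_le)
    moreover have "set (map ?s [0..<n]) = set [0..<n]" "distinct (map ?s [0..<n])"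
      using plist_permutes[OF s] by (auto simp: plist_def)
    ultimately have "map ?s [0..<n] = [0..<n]" by (intro sorted_distinct_set_unique) auto
    then have e: "map ?s [0..<n] ! k = [0..<n] ! k" for k by (rule arg_cong)
    have sk: "?s k = k" for k
    proof (cases "k < n")
      case True then show ?thesis using e[of k] by simp
    next
      case False then show ?thesis using s by (simp add: permutes_def)
    qed
    have "\<pi> k = k" for k using permutes_inverses(1)[OF less.prems, of k] sk[of k] by simp
    then have "\<pi> = id" by (simp add: fun_eq_iff)
    then show ?thesis by (intro exI[of _ "[]"]) (simp only: simple_prod_Nil inv_pow2_id, simp)
  qed
qed

lemma reduced_inv_pow2:
  assumes "reduced_expr n is \<pi>"
  shows "inv_pow2 n \<pi> = 2 ^ length is"
proof -
  have i: "set is \<subseteq> {i. Suc i < n}" "simple_prod is = \<pi>" using assms unfolding reduced_expr_def by auto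
  obtain js where j: "set js \<subseteq> {i. Suc i < n}" "simple_prod js = \<pi>" "inv_pow2 n \<pi> = 2 ^ length js"
    using expr_exists[OF simple_prod_permutes[OF i(1)]] i(2) by auto
  have "length is \<le> length js" using assms j unfolding reduced_expr_def by auto
  then have "(2::nat) ^ length is \<le> 2 ^ length js" by simp
  then show ?thesis using inv_pow2_le[OF i(1)] i(2) j(3) by simp
qed

lemma reduced_exists:
  assumes "\<pi> permutes {..<n}"
  shows "reduced_expr n (SOME is. reduced_expr n is \<pi>) \<pi>"
proof -
  define P where "P is \<longleftrightarrow> set is \<subseteq> {i. Suc i < n} \<and> simple_prod is = \<pi>" for "is"
  obtain "is" where "P is" using expr_exists[OF assms] unfolding P_def by blast
  then have "P (ARG_MIN length is. P is)" "\<forall>js. P js \<longrightarrow> length (ARG_MIN length is. P is) \<le> length js"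
    by (auto intro: arg_min_natI arg_min_nat_le)
  then have "reduced_expr n (ARG_MIN length is. P is) \<pi>" unfolding P_def reduced_expr_def by auto
  then show ?thesis by (rule someI)
qed

text \<open>The scalar collected by applying diagonal braidings along a list of simple transpositions.\<close>

fun braid_weight :: "('a \<Rightarrow> 'a \<Rightarrow> 'c::comm_monoid_mult) \<Rightarrow> nat list \<Rightarrow> (nat \<Rightarrow> 'a) \<Rightarrow> 'c" where
  "braid_weight q [] v = 1"
| "braid_weight q (i # is) v = q (v (Suc i)) (v i) * braid_weight q is (v \<circ> swp i)"

text \<open>In a reduced expression each transposition creates an inversion, otherwise the count of inversions would
  fall behind the length; so \<open>inv_prod_swap\<close> applies at each step.\<close>

lemma braid_weight_reduced:
  "reduced_expr n is \<pi> \<Longrightarrow> braid_weight q is v = inv_prod q v (plist n \<pi>)"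
proof (induction "is" arbitrary: \<pi> v)
  case Nil
  then have "\<pi> = id" unfolding reduced_expr_def simple_prod_Nil by blast
  then show ?case by (simp only: inv_prod_id braid_weight.simps)
next
  case (Cons i "is")
  define \<rho> where "\<rho> = simple_prod is"
  have i: "set is \<subseteq> {i. Suc i < n}" "Suc i < n" "\<pi> = swp i \<circ> \<rho>"
    using Cons.prems unfolding reduced_expr_def simple_prod_Cons \<rho>_def list.set by blast+
  have red: "reduced_expr n is \<rho>"
    unfolding reduced_expr_def
  proof (intro conjI allI impI)
    fix js assume js: "set js \<subseteq> {i. Suc i < n} \<and> simple_prod js = \<rho>"
    then have "length (i # is) \<le> length (i # js)"
      using Cons.prems i unfolding reduced_expr_def by (metis (no_types, lifting) insert_subset list.simps(15) mem_Collect_eq simple_prod_Cons)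
    then show "length is \<le> length js" by simp
  qed (use i \<rho>_def in auto)
  have \<rho>: "\<rho> permutes {..<n}" unfolding \<rho>_def by (rule simple_prod_permutes) (rule i)
  show ?case
  proof (cases rule: plist_cases[OF \<rho> i(2)])
    case (1 as bs)
    show ?thesis
      unfolding i(3) plist_swp braid_weight.simps Cons.IH[OF red] inv_prod_swap[OF plist_permutes(1)[OF \<rho>] 1] ..
  next
    case (2 as bs)
    have "inv_pow2 n \<rho> = 2 * inv_pow2 n \<pi>" using inv_pow2_down[OF \<rho> 2 i(2)] i(3) by simp
    moreover have "inv_pow2 n \<rho> = 2 ^ length is" "inv_pow2 n \<pi> = 2 ^ length (i # is)"
      using reduced_inv_pow2[OF red] reduced_inv_pow2[OF Cons.prems] by auto
    ultimately show ?thesis by simp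
  qed
qed

section \<open>Quantum symmetrizers of diagonal type\<close>

lemma sorted_list_of_set_insert_least:
  assumes "finite A" "\<forall>a\<in>A. b < (a::nat)"
  shows "sorted_list_of_set (insert b A) = b # sorted_list_of_set A"
proof -
  have "b \<notin> A" using assms by auto
  then have "sorted_list_of_set (insert b A) = insort b (sorted_list_of_set A)"
    using assms(1) by (simp add: sorted_list_of_set_insert)
  also have "\<dots> = b # sorted_list_of_set A"
    using assms by (intro insort_is_Cons) (auto simp: less_imp_le)
  finally show ?thesis .
qed

text \<open>Deleting a letter \<open>j\<close> at any of its positions, with the factors for moving it to the front.  The word is
  indexed by a finite set of positions in order to allow deletions without renumbering.\<close>

lemma create_sorted:
  fixes v :: "nat \<Rightarrow> 'i"
  assumes "finite A"
  shows "create q (\<lambda>_. 0) j g (map v (sorted_list_of_set A)) =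
    (\<Sum>p\<in>{p \<in> A. v p = j}. (\<Prod>r\<in>{r \<in> A. r < p}. q j (v r)) * g (map v (sorted_list_of_set (A - {p}))))"
  using assms
proof (induction A arbitrary: g rule: finite_linorder_min_induct)
  case empty
  then show ?case by simp
next
  case (insert b A)
  have b: "b \<notin> A" using insert by auto
  have srt: "sorted_list_of_set (insert b A - {p}) = b # sorted_list_of_set (A - {p})" if "p \<in> A" for p
  proof -
    have "insert b A - {p} = insert b (A - {p})" using that b by auto
    then show ?thesis using sorted_list_of_set_insert_least[of "A - {p}" b] insert.hyps by (simp del: sorted_list_of_set_insert_remove)
  qed
  have pr: "(\<Prod>r\<in>{r \<in> insert b A. r < p}. q j (v r)) = q j (v b) * (\<Prod>r\<in>{r \<in> A. r < p}. q j (v r))" if "p \<in> A" for p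
  proof -
    have "{r \<in> insert b A. r < p} = insert b {r \<in> A. r < p}" using that insert by auto
    then show ?thesis using insert b by simp
  qed
  have "create q (\<lambda>_. 0) j g (map v (sorted_list_of_set (insert b A))) =
     (if v b = j then g (map v (sorted_list_of_set A)) else 0) +
     q j (v b) * (\<Sum>p\<in>{p \<in> A. v p = j}. (\<Prod>r\<in>{r \<in> A. r < p}. q j (v r)) * g (v b # map v (sorted_list_of_set (A - {p}))))"
    unfolding sorted_list_of_set_insert_least[OF insert.hyps(1,2)] list.map create.simps insert.IH by simp
  also have "q j (v b) * (\<Sum>p\<in>{p \<in> A. v p = j}. (\<Prod>r\<in>{r \<in> A. r < p}. q j (v r)) * g (v b # map v (sorted_list_of_set (A - {p})))) =
     (\<Sum>p\<in>{p \<in> A. v p = j}. (\<Prod>r\<in>{r \<in> insert b A. r < p}. q j (v r)) * g (map v (sorted_list_of_set (insert b A - {p}))))"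
    unfolding sum_distrib_left
  proof (rule sum.cong[OF refl])
    fix p assume "p \<in> {p \<in> A. v p = j}"
    then have p: "p \<in> A" by simp
    show "q j (v b) * ((\<Prod>r\<in>{r \<in> A. r < p}. q j (v r)) * g (v b # map v (sorted_list_of_set (A - {p})))) =
      (\<Prod>r\<in>{r \<in> insert b A. r < p}. q j (v r)) * g (map v (sorted_list_of_set (insert b A - {p})))"
      unfolding pr[OF p] srt[OF p] by simp
  qed
  also have "(if v b = j then g (map v (sorted_list_of_set A)) else 0) + \<dots> =
     (\<Sum>p\<in>{p \<in> insert b A. v p = j}. (\<Prod>r\<in>{r \<in> insert b A. r < p}. q j (v r)) * g (map v (sorted_list_of_set (insert b A - {p}))))"
  proof (cases "v b = j")
    case True
    have "{p \<in> insert b A. v p = j} = insert b {p \<in> A. v p = j}" using True by auto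
    moreover have "(\<Prod>r\<in>{r \<in> insert b A. r < b}. q j (v r)) = 1" by (rule prod.neutral) (use insert in auto)
    moreover have "insert b A - {b} = A" using b by auto
    moreover have nb: "finite {p \<in> A. v p = j}" "b \<notin> {p \<in> A. v p = j}" using b insert.hyps by auto
    ultimately show ?thesis using True by (simp only: sum.insert[OF nb] if_True mult_1_left refl)
  next
    case False
    then have "{p \<in> insert b A. v p = j} = {p \<in> A. v p = j}" by auto
    then show ?thesis using False by simp
  qed
  finally show ?case .
qed

text \<open>By induction on \<open>w\<close>: the first entry \<open>p\<close> of the permutation must satisfy \<open>v p = j\<close> for the first letter \<open>j\<close>, its
  inversions give the factor in \<open>create_sorted\<close>, and the rest permutes the remaining positions.\<close>

lemma sum_permutations_of_set:
  fixes v :: "nat \<Rightarrow> 'i"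
  assumes "finite A"
  shows "(\<Sum>ps\<in>permutations_of_set A. inv_prod q v ps * (if map v ps = w then 1 else 0)) =
     nichols_word q w (map v (sorted_list_of_set A))"
  using assms
proof (induction w arbitrary: A)
  case Nil
  show ?case
  proof (cases "A = {}")
    case True
    then show ?thesis by (simp add: empty_word_def)
  next
    case False
    then have "ps \<noteq> []" if "ps \<in> permutations_of_set A" for ps
      using permutations_of_setD(1)[OF that] by auto
    then have "(\<Sum>ps\<in>permutations_of_set A. inv_prod q v ps * (if map v ps = [] then 1 else 0)) = 0"
      by (intro sum.neutral) auto
    moreover have "sorted_list_of_set A \<noteq> []" using False Nil by simp
    ultimately show ?thesis by (simp add: empty_word_def)
  qed
next
  case (Cons j w)
  show ?case
  proof (cases "A = {}")
    case True
    then show ?thesis by simp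
  next
    case False
    have "(\<Sum>ps\<in>permutations_of_set A. inv_prod q v ps * (if map v ps = j # w then 1 else 0)) =
      (\<Sum>p\<in>A. \<Sum>ps\<in>(#) p ` permutations_of_set (A - {p}). inv_prod q v ps * (if map v ps = j # w then 1 else 0))"
      unfolding permutations_of_set_nonempty[OF False]
      by (rule sum.UNION_disjoint) (use Cons.prems in auto)
    also have "\<dots> = (\<Sum>p\<in>A. if v p = j then (\<Prod>r\<in>{r \<in> A. r < p}. q j (v r)) *
        nichols_word q w (map v (sorted_list_of_set (A - {p}))) else 0)"
    proof (rule sum.cong[OF refl])
      fix p assume p: "p \<in> A"
      have "(\<Sum>ps\<in>(#) p ` permutations_of_set (A - {p}). inv_prod q v ps * (if map v ps = j # w then 1 else 0)) =
        (\<Sum>ps\<in>permutations_of_set (A - {p}). inv_prod q v (p # ps) * (if map v (p # ps) = j # w then 1 else 0))"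
        by (subst sum.reindex) auto
      also have "\<dots> = (\<Sum>ps\<in>permutations_of_set (A - {p}). (if v p = j then (\<Prod>r\<in>{r \<in> A. r < p}. q j (v r)) else 0) *
         (inv_prod q v ps * (if map v ps = w then 1 else 0)))"
      proof (rule sum.cong[OF refl])
        fix ps assume "ps \<in> permutations_of_set (A - {p})"
        then have "set ps = A - {p}" by (rule permutations_of_setD)
        then have "{r \<in> set ps. r < p} = {r \<in> A. r < p}" by auto
        then show "inv_prod q v (p # ps) * (if map v (p # ps) = j # w then 1 else 0) =
          (if v p = j then (\<Prod>r\<in>{r \<in> A. r < p}. q j (v r)) else 0) * (inv_prod q v ps * (if map v ps = w then 1 else 0))"
          by simp
      qed
      also have "\<dots> = (if v p = j then (\<Prod>r\<in>{r \<in> A. r < p}. q j (v r)) *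
        nichols_word q w (map v (sorted_list_of_set (A - {p}))) else 0)"
        unfolding sum_distrib_left[symmetric] using Cons.IH[of "A - {p}"] Cons.prems by simp
      finally show "(\<Sum>ps\<in>(#) p ` permutations_of_set (A - {p}). inv_prod q v ps * (if map v ps = j # w then 1 else 0)) = \<dots>" .
    qed
    also have "\<dots> = (\<Sum>p\<in>{p \<in> A. v p = j}. (\<Prod>r\<in>{r \<in> A. r < p}. q j (v r)) *
        nichols_word q w (map v (sorted_list_of_set (A - {p}))))"
      using Cons.prems by (simp add: sum.inter_filter)
    also have "\<dots> = nichols_word q (j # w) (map v (sorted_list_of_set A))"
      using create_sorted[OF Cons.prems, of q j "nichols_word q w" v] by simp
    finally show ?thesis .
  qed
qed

lemma plist_bij: "bij_betw (plist n) {\<pi>. \<pi> permutes {..<n}} (permutations_of_set {..<n})"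
proof -
  have inj: "inj_on (plist n) {\<pi>. \<pi> permutes {..<n}}"
  proof (rule inj_onI)
    fix \<pi> \<rho> assume "\<pi> \<in> {\<pi>. \<pi> permutes {..<n}}" "\<rho> \<in> {\<pi>. \<pi> permutes {..<n}}" and e: "plist n \<pi> = plist n \<rho>"
    then have p: "\<pi> permutes {..<n}" "\<rho> permutes {..<n}" by auto
    show "\<pi> = \<rho>"
    proof
      fix k show "\<pi> k = \<rho> k"
      proof (cases "k < n")
        case True
        then have "plist n \<pi> ! k = \<pi> k" "plist n \<rho> ! k = \<rho> k" by (simp_all add: plist_def)
        then show ?thesis using e by simp
      next
        case False
        then show ?thesis using p by (simp add: permutes_def)
      qed
    qed
  qed
  moreover have "plist n ` {\<pi>. \<pi> permutes {..<n}} = permutations_of_set {..<n}"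
  proof (rule card_subset_eq)
    show "plist n ` {\<pi>. \<pi> permutes {..<n}} \<subseteq> permutations_of_set {..<n}"
      using plist_permutes by (auto intro!: permutations_of_setI)
    show "card (plist n ` {\<pi>. \<pi> permutes {..<n}}) = card (permutations_of_set {..<n})"
      by (simp add: card_image[OF inj] card_permutations[of "{..<n}" n])
  qed simp
  ultimately show ?thesis unfolding bij_betw_def by blast
qed

text \<open>The matrix of the quantum symmetrizer in the basis of words is the matrix of products of letters in the
  quantum shuffle algebra.\<close>

lemma symmetrizer_nichols_word:
  fixes v :: "nat \<Rightarrow> 'i"
  shows "(\<Sum>\<pi> | \<pi> permutes {..<n}. inv_prod q v (plist n \<pi>) * (if map v (plist n \<pi>) = w then 1 else 0)) =
     nichols_word q w (map v [0..<n])"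
proof -
  have "(\<Sum>\<pi> | \<pi> permutes {..<n}. inv_prod q v (plist n \<pi>) * (if map v (plist n \<pi>) = w then 1 else 0)) =
    (\<Sum>ps\<in>permutations_of_set {..<n}. inv_prod q v ps * (if map v ps = w then 1 else 0))"
    by (rule sum.reindex_bij_betw[OF plist_bij])
  also have "\<dots> = nichols_word q w (map v (sorted_list_of_set {..<n}))" by (rule sum_permutations_of_set) simp
  finally show ?thesis by (simp add: lessThan_atLeast0)
qed

lemma symmetrizer_vanishes:
  fixes v :: "nat \<Rightarrow> 'i"
  assumes "\<And>w. nichols_word q w (map v [0..<n]) = 0"
  shows "(\<Sum>\<pi> | \<pi> permutes {..<n}. inv_prod q v (plist n \<pi>) * F (map v (plist n \<pi>))) = 0"
proof -
  let ?P = "{\<pi>. \<pi> permutes {..<n}}"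
  let ?W = "(\<lambda>\<pi>. map v (plist n \<pi>)) ` ?P"
  have fin: "finite ?P" by (simp add: finite_permutations)
  have "(\<Sum>\<pi>\<in>?P. inv_prod q v (plist n \<pi>) * F (map v (plist n \<pi>))) =
    (\<Sum>\<pi>\<in>?P. \<Sum>w\<in>?W. F w * (inv_prod q v (plist n \<pi>) * (if map v (plist n \<pi>) = w then 1 else 0)))"
  proof (rule sum.cong[OF refl])
    fix \<pi> assume p: "\<pi> \<in> ?P"
    let ?f = "\<lambda>w. F w * (inv_prod q v (plist n \<pi>) * (if map v (plist n \<pi>) = w then 1 else 0))"
    have "(\<Sum>w\<in>?W. ?f w) = (\<Sum>w\<in>?W. if w = map v (plist n \<pi>) then F w * inv_prod q v (plist n \<pi>) else 0)"
      by (rule sum.cong) auto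
    also have "\<dots> = F (map v (plist n \<pi>)) * inv_prod q v (plist n \<pi>)" using fin p by (subst sum.delta) auto
    finally show "inv_prod q v (plist n \<pi>) * F (map v (plist n \<pi>)) = (\<Sum>w\<in>?W. ?f w)" by simp
  qed
  also have "\<dots> = (\<Sum>w\<in>?W. F w * (\<Sum>\<pi>\<in>?P. inv_prod q v (plist n \<pi>) * (if map v (plist n \<pi>) = w then 1 else 0)))"
    by (subst sum.swap) (simp only: sum_distrib_left)
  also have "\<dots> = 0" unfolding symmetrizer_nichols_word assms by simp
  finally show ?thesis .
qed

text \<open>Without edges the letters commute up to sign, so two equal letters can be brought together, and there
  their product is zero.\<close>

lemma nichols_word_repeated:
  assumes q: "sign_matrix q" "\<And>i j. \<not> adjacent q i j" and w: "\<not> distinct w"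
  shows "nichols_word q w = 0"
proof -
  have z: "create q (\<lambda>_. 0) a (nichols_word q w) = 0" if "a \<in> set w" for a w
    using that
  proof (induction w)
    case (Cons b w)
    show ?case
    proof (cases "a = b")
      case True
      have "q b b = -1" using q(1) unfolding sign_matrix_def by auto
      then show ?thesis using True create_square[of q b] by simp
    next
      case False
      then have "a \<in> set w" using Cons.prems by auto
      from Cons.IH[OF this] show ?thesis using create_commute[OF q(1,2) False] by simp
    qed
  qed simp
  show ?thesis using w
  proof (induction w)
    case (Cons a w)
    then show ?case using z[of a w] by (cases "a \<in> set w") auto
  qed simp
qed

text \<open>The value is \<open>n!\<close>, as in a symmetric algebra.\<close>

lemma nichols_word_all_ones:
  assumes "q a a = 1"
  shows "nichols_word q (replicate n a) (replicate n a) \<noteq> 0"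
proof -
  have s: "create q (\<lambda>_. 0) a g (replicate (Suc m) a) = of_nat (Suc m) * g (replicate m a)" for g m
  proof (induction m arbitrary: g)
    case (Suc m)
    show ?case using Suc[of "\<lambda>u. g (a # u)"] assms by (simp add: algebra_simps)
  qed simp
  show ?thesis
  proof (induction n)
    case (Suc n)
    have "nichols_word q (replicate (Suc n) a) (replicate (Suc n) a) =
        of_nat (Suc n) * nichols_word q (replicate n a) (replicate n a)"
      using s[of "nichols_word q (replicate n a)" n] by simp
    then show ?case using Suc by (metis mult_eq_0_iff of_nat_eq_0_iff nat.distinct(1))
  qed (simp add: empty_word_def)
qed

section \<open>Complex vector spaces with carriers\<close>

lemma CC_vectorspaceI:
  assumes "\<zero>\<^bsub>V\<^esub> \<in> carrier V"
    and add: "\<And>v w. v \<in> carrier V \<Longrightarrow> w \<in> carrier V \<Longrightarrow> v \<oplus>\<^bsub>V\<^esub> w \<in> carrier V"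
    and smult: "\<And>c v. v \<in> carrier V \<Longrightarrow> c \<odot>\<^bsub>V\<^esub> v \<in> carrier V"
    and "\<And>v w. v \<in> carrier V \<Longrightarrow> w \<in> carrier V \<Longrightarrow> v \<oplus>\<^bsub>V\<^esub> w = w \<oplus>\<^bsub>V\<^esub> v"
    and "\<And>u v w. u \<in> carrier V \<Longrightarrow> v \<in> carrier V \<Longrightarrow> w \<in> carrier V \<Longrightarrow> (u \<oplus>\<^bsub>V\<^esub> v) \<oplus>\<^bsub>V\<^esub> w = u \<oplus>\<^bsub>V\<^esub> (v \<oplus>\<^bsub>V\<^esub> w)"
    and "\<And>v. v \<in> carrier V \<Longrightarrow> v \<oplus>\<^bsub>V\<^esub> \<zero>\<^bsub>V\<^esub> = v"
    and "\<And>a b v. v \<in> carrier V \<Longrightarrow> (a * b) \<odot>\<^bsub>V\<^esub> v = a \<odot>\<^bsub>V\<^esub> (b \<odot>\<^bsub>V\<^esub> v)"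
    and one: "\<And>v. v \<in> carrier V \<Longrightarrow> 1 \<odot>\<^bsub>V\<^esub> v = v"
    and dist: "\<And>a b v. v \<in> carrier V \<Longrightarrow> (a + b) \<odot>\<^bsub>V\<^esub> v = a \<odot>\<^bsub>V\<^esub> v \<oplus>\<^bsub>V\<^esub> b \<odot>\<^bsub>V\<^esub> v"
    and "\<And>a v w. v \<in> carrier V \<Longrightarrow> w \<in> carrier V \<Longrightarrow> a \<odot>\<^bsub>V\<^esub> (v \<oplus>\<^bsub>V\<^esub> w) = a \<odot>\<^bsub>V\<^esub> v \<oplus>\<^bsub>V\<^esub> a \<odot>\<^bsub>V\<^esub> w"
    and zero: "\<And>v. v \<in> carrier V \<Longrightarrow> 0 \<odot>\<^bsub>V\<^esub> v = \<zero>\<^bsub>V\<^esub>"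
  shows "vectorspace CC (V :: (complex, 'v, 'c) module_scheme)"
proof (rule vs_criteria[OF class_field])
  show "\<forall>v\<in>carrier V. \<exists>neg_v\<in>carrier V. v \<oplus>\<^bsub>V\<^esub> neg_v = \<zero>\<^bsub>V\<^esub>"
  proof
    fix v assume v: "v \<in> carrier V"
    have "v \<oplus>\<^bsub>V\<^esub> (-1) \<odot>\<^bsub>V\<^esub> v = \<zero>\<^bsub>V\<^esub>"
      using dist[OF v, of 1 "-1"] zero[OF v] one[OF v] by simp
    then show "\<exists>neg_v\<in>carrier V. v \<oplus>\<^bsub>V\<^esub> neg_v = \<zero>\<^bsub>V\<^esub>" using smult[OF v] by blast
  qed
qed (use assms in auto)

lemma CC_vectorspaceD:
  assumes "vectorspace CC (V :: (complex, 'v, 'c) module_scheme)"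
  shows vs_module: "Module.module CC V" and vs_abelian: "abelian_group V"
    and vs_zero: "\<zero>\<^bsub>V\<^esub> \<in> carrier V"
    and vs_add: "\<And>v w. v \<in> carrier V \<Longrightarrow> w \<in> carrier V \<Longrightarrow> v \<oplus>\<^bsub>V\<^esub> w \<in> carrier V"
    and vs_smult: "\<And>c v. v \<in> carrier V \<Longrightarrow> c \<odot>\<^bsub>V\<^esub> v \<in> carrier V"
    and vs_comm: "\<And>v w. v \<in> carrier V \<Longrightarrow> w \<in> carrier V \<Longrightarrow> v \<oplus>\<^bsub>V\<^esub> w = w \<oplus>\<^bsub>V\<^esub> v"
    and vs_assoc: "\<And>u v w. u \<in> carrier V \<Longrightarrow> v \<in> carrier V \<Longrightarrow> w \<in> carrier V \<Longrightarrow> (u \<oplus>\<^bsub>V\<^esub> v) \<oplus>\<^bsub>V\<^esub> w = u \<oplus>\<^bsub>V\<^esub> (v \<oplus>\<^bsub>V\<^esub> w)"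
    and vs_add_zero: "\<And>v. v \<in> carrier V \<Longrightarrow> v \<oplus>\<^bsub>V\<^esub> \<zero>\<^bsub>V\<^esub> = v"
    and vs_compat: "\<And>a b v. v \<in> carrier V \<Longrightarrow> (a * b) \<odot>\<^bsub>V\<^esub> v = a \<odot>\<^bsub>V\<^esub> (b \<odot>\<^bsub>V\<^esub> v)"
    and vs_one: "\<And>v. v \<in> carrier V \<Longrightarrow> 1 \<odot>\<^bsub>V\<^esub> v = v"
    and vs_ldist: "\<And>a b v. v \<in> carrier V \<Longrightarrow> (a + b) \<odot>\<^bsub>V\<^esub> v = a \<odot>\<^bsub>V\<^esub> v \<oplus>\<^bsub>V\<^esub> b \<odot>\<^bsub>V\<^esub> v"
    and vs_rdist: "\<And>a v w. v \<in> carrier V \<Longrightarrow> w \<in> carrier V \<Longrightarrow> a \<odot>\<^bsub>V\<^esub> (v \<oplus>\<^bsub>V\<^esub> w) = a \<odot>\<^bsub>V\<^esub> v \<oplus>\<^bsub>V\<^esub> a \<odot>\<^bsub>V\<^esub> w"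
    and vs_zero_smult: "\<And>v. v \<in> carrier V \<Longrightarrow> 0 \<odot>\<^bsub>V\<^esub> v = \<zero>\<^bsub>V\<^esub>"
    and vs_smult_zero: "\<And>a. a \<odot>\<^bsub>V\<^esub> \<zero>\<^bsub>V\<^esub> = \<zero>\<^bsub>V\<^esub>"
    and vs_minus: "\<And>v w. v \<in> carrier V \<Longrightarrow> w \<in> carrier V \<Longrightarrow> v \<ominus>\<^bsub>V\<^esub> w = v \<oplus>\<^bsub>V\<^esub> (-1) \<odot>\<^bsub>V\<^esub> w"
    and vs_neg: "\<And>v. v \<in> carrier V \<Longrightarrow> (-1) \<odot>\<^bsub>V\<^esub> v \<oplus>\<^bsub>V\<^esub> v = \<zero>\<^bsub>V\<^esub>"
proof -
  interpret v: vectorspace CC V by fact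
  show "Module.module CC V" by (rule v.module_axioms)
  show "abelian_group V" by (rule v.abelian_group_axioms)
  show "\<zero>\<^bsub>V\<^esub> \<in> carrier V" by simp
  show "\<And>v w. v \<in> carrier V \<Longrightarrow> w \<in> carrier V \<Longrightarrow> v \<oplus>\<^bsub>V\<^esub> w \<in> carrier V" by simp
  show sm: "\<And>c v. v \<in> carrier V \<Longrightarrow> c \<odot>\<^bsub>V\<^esub> v \<in> carrier V" using v.smult_closed by simp
  show comm: "\<And>v w. v \<in> carrier V \<Longrightarrow> w \<in> carrier V \<Longrightarrow> v \<oplus>\<^bsub>V\<^esub> w = w \<oplus>\<^bsub>V\<^esub> v" by (rule v.M.a_comm)
  show "\<And>u v w. u \<in> carrier V \<Longrightarrow> v \<in> carrier V \<Longrightarrow> w \<in> carrier V \<Longrightarrow> (u \<oplus>\<^bsub>V\<^esub> v) \<oplus>\<^bsub>V\<^esub> w = u \<oplus>\<^bsub>V\<^esub> (v \<oplus>\<^bsub>V\<^esub> w)" by (rule v.M.a_assoc)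
  show "\<And>v. v \<in> carrier V \<Longrightarrow> v \<oplus>\<^bsub>V\<^esub> \<zero>\<^bsub>V\<^esub> = v" by simp
  show "\<And>a b v. v \<in> carrier V \<Longrightarrow> (a * b) \<odot>\<^bsub>V\<^esub> v = a \<odot>\<^bsub>V\<^esub> (b \<odot>\<^bsub>V\<^esub> v)" using v.smult_assoc1 by simp
  show one: "\<And>v. v \<in> carrier V \<Longrightarrow> 1 \<odot>\<^bsub>V\<^esub> v = v" using v.smult_one by simp
  show ld: "\<And>a b v. v \<in> carrier V \<Longrightarrow> (a + b) \<odot>\<^bsub>V\<^esub> v = a \<odot>\<^bsub>V\<^esub> v \<oplus>\<^bsub>V\<^esub> b \<odot>\<^bsub>V\<^esub> v" using v.smult_l_distr by simp
  show "\<And>a v w. v \<in> carrier V \<Longrightarrow> w \<in> carrier V \<Longrightarrow> a \<odot>\<^bsub>V\<^esub> (v \<oplus>\<^bsub>V\<^esub> w) = a \<odot>\<^bsub>V\<^esub> v \<oplus>\<^bsub>V\<^esub> a \<odot>\<^bsub>V\<^esub> w" using v.smult_r_distr by simp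
  show z: "\<And>v. v \<in> carrier V \<Longrightarrow> 0 \<odot>\<^bsub>V\<^esub> v = \<zero>\<^bsub>V\<^esub>" using v.lmult_0 by simp
  show "\<And>a. a \<odot>\<^bsub>V\<^esub> \<zero>\<^bsub>V\<^esub> = \<zero>\<^bsub>V\<^esub>" using v.rmult_0 by simp
  show n: "\<And>v. v \<in> carrier V \<Longrightarrow> (-1) \<odot>\<^bsub>V\<^esub> v \<oplus>\<^bsub>V\<^esub> v = \<zero>\<^bsub>V\<^esub>"
    using ld[of _ "-1" 1] one z by simp
  show "\<And>v w. v \<in> carrier V \<Longrightarrow> w \<in> carrier V \<Longrightarrow> v \<ominus>\<^bsub>V\<^esub> w = v \<oplus>\<^bsub>V\<^esub> (-1) \<odot>\<^bsub>V\<^esub> w"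
    using n sm v.M.minus_equality unfolding a_minus_def by metis
qed

lemma submoduleI_CC:
  assumes "vectorspace CC (V :: (complex, 'v, 'c) module_scheme)" "N \<subseteq> carrier V" "\<zero>\<^bsub>V\<^esub> \<in> N"
    "\<And>v w. v \<in> N \<Longrightarrow> w \<in> N \<Longrightarrow> v \<oplus>\<^bsub>V\<^esub> w \<in> N" "\<And>c v. v \<in> N \<Longrightarrow> c \<odot>\<^bsub>V\<^esub> v \<in> N"
  shows "submodule CC N V"
  using assms vs_module[OF assms(1)] unfolding submodule_def by auto

lemma submoduleD_CC:
  assumes "submodule CC N (V :: (complex, 'v, 'c) module_scheme)"
  shows "N \<subseteq> carrier V" "\<zero>\<^bsub>V\<^esub> \<in> N"
    "\<And>v w. v \<in> N \<Longrightarrow> w \<in> N \<Longrightarrow> v \<oplus>\<^bsub>V\<^esub> w \<in> N" "\<And>c v. v \<in> N \<Longrightarrow> c \<odot>\<^bsub>V\<^esub> v \<in> N"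
  using assms unfolding submodule_def by auto

lemma lin_span_props:
  assumes "vectorspace CC (V :: (complex, 'v, 'c) module_scheme)" "S \<subseteq> carrier V"
  shows lin_span_submodule: "submodule CC (lin_span V S) V"
    and lin_span_superset: "S \<subseteq> lin_span V S"
    and lin_span_least: "\<And>N. S \<subseteq> N \<Longrightarrow> submodule CC N V \<Longrightarrow> lin_span V S \<subseteq> N"
proof -
  interpret v: vectorspace CC V by fact
  show "submodule CC (lin_span V S) V" using v.span_is_submodule[OF assms(2)] .
  show "S \<subseteq> lin_span V S" using v.in_own_span[OF assms(2)] .
  show "\<And>N. S \<subseteq> N \<Longrightarrow> submodule CC N V \<Longrightarrow> lin_span V S \<subseteq> N" using v.span_is_subset .
qed

lemma fin_dim_iff:
  assumes "vectorspace CC (V :: (complex, 'v, 'c) module_scheme)"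
  shows "vectorspace.fin_dim CC V \<longleftrightarrow> (\<exists>S. finite S \<and> S \<subseteq> carrier V \<and> lin_span V S = carrier V)"
proof -
  interpret v: vectorspace CC V by fact
  show ?thesis unfolding v.fin_dim_def by simp
qed

abbreviation coset :: "(complex, 'v, 'c) module_scheme \<Rightarrow> 'v set \<Rightarrow> 'v \<Rightarrow> 'v set" where
  "coset V N x \<equiv> N +>\<^bsub>V\<^esub> x"

lemma coset_iff: "z \<in> coset V N x \<longleftrightarrow> (\<exists>n\<in>N. z = n \<oplus>\<^bsub>V\<^esub> x)"
  by (auto simp: a_r_coset_def')

context
  fixes V :: "(complex, 'v, 'c) module_scheme" and N
  assumes V: "vectorspace CC V" and N: "submodule CC N V"
begin

lemma coset_self: "x \<in> carrier V \<Longrightarrow> x \<in> coset V N x"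
proof -
  assume x: "x \<in> carrier V"
  have "x = \<zero>\<^bsub>V\<^esub> \<oplus>\<^bsub>V\<^esub> x" using vs_comm[OF V vs_zero[OF V] x] vs_add_zero[OF V x] by simp
  then show ?thesis unfolding coset_iff using submoduleD_CC(2)[OF N] by blast
qed

lemma coset_shift:
  assumes n: "n \<in> N" and x: "x \<in> carrier V"
  shows "coset V N (n \<oplus>\<^bsub>V\<^esub> x) = coset V N x"
proof -
  have nc: "n \<in> carrier V" using n submoduleD_CC(1)[OF N] by auto
  show ?thesis
  proof (rule Set.set_eqI)
    fix z
    show "z \<in> coset V N (n \<oplus>\<^bsub>V\<^esub> x) \<longleftrightarrow> z \<in> coset V N x"
    proof
      assume "z \<in> coset V N (n \<oplus>\<^bsub>V\<^esub> x)"
      then obtain m where m: "m \<in> N" "z = m \<oplus>\<^bsub>V\<^esub> (n \<oplus>\<^bsub>V\<^esub> x)" unfolding coset_iff by auto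
      have "m \<in> carrier V" using m submoduleD_CC(1)[OF N] by auto
      then have "z = (m \<oplus>\<^bsub>V\<^esub> n) \<oplus>\<^bsub>V\<^esub> x" unfolding m(2) by (rule vs_assoc[OF V _ nc x, symmetric])
      then show "z \<in> coset V N x" unfolding coset_iff using submoduleD_CC(3)[OF N m(1) n] by auto
    next
      assume "z \<in> coset V N x"
      then obtain m where m: "m \<in> N" "z = m \<oplus>\<^bsub>V\<^esub> x" unfolding coset_iff by auto
      let ?k = "m \<oplus>\<^bsub>V\<^esub> (-1) \<odot>\<^bsub>V\<^esub> n"
      have mc: "m \<in> carrier V" "(-1) \<odot>\<^bsub>V\<^esub> n \<in> carrier V" using m submoduleD_CC(1)[OF N] vs_smult[OF V nc] by auto
      have "?k \<oplus>\<^bsub>V\<^esub> (n \<oplus>\<^bsub>V\<^esub> x) = m \<oplus>\<^bsub>V\<^esub> (((-1) \<odot>\<^bsub>V\<^esub> n \<oplus>\<^bsub>V\<^esub> n) \<oplus>\<^bsub>V\<^esub> x)"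
        unfolding vs_assoc[OF V mc(1,2) vs_add[OF V nc x]] vs_assoc[OF V mc(2) nc x] ..
      also have "\<dots> = m \<oplus>\<^bsub>V\<^esub> (x \<oplus>\<^bsub>V\<^esub> \<zero>\<^bsub>V\<^esub>)" unfolding vs_neg[OF V nc] vs_comm[OF V vs_zero[OF V] x] ..
      also have "\<dots> = z" unfolding vs_add_zero[OF V x] m(2) ..
      finally have "z = ?k \<oplus>\<^bsub>V\<^esub> (n \<oplus>\<^bsub>V\<^esub> x)" ..
      moreover have "?k \<in> N" by (intro submoduleD_CC(3)[OF N] submoduleD_CC(4)[OF N] m n)
      ultimately show "z \<in> coset V N (n \<oplus>\<^bsub>V\<^esub> x)" unfolding coset_iff by blast
    qed
  qed
qed

lemma coset_eqD: "coset V N x = coset V N y \<Longrightarrow> x \<in> carrier V \<Longrightarrow> \<exists>n\<in>N. x = n \<oplus>\<^bsub>V\<^esub> y"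
proof -
  assume e: "coset V N x = coset V N y" and x: "x \<in> carrier V"
  from coset_self[OF x] show ?thesis unfolding e coset_iff .
qed

lemma coset_zero: "n \<in> N \<Longrightarrow> coset V N n = N"
proof -
  assume n: "n \<in> N"
  have z: "coset V N \<zero>\<^bsub>V\<^esub> = N"
  proof (rule Set.set_eqI)
    fix z
    have "m \<oplus>\<^bsub>V\<^esub> \<zero>\<^bsub>V\<^esub> = m" if "m \<in> N" for m
      by (rule vs_add_zero[OF V]) (rule subsetD[OF submoduleD_CC(1)[OF N] that])
    then show "z \<in> coset V N \<zero>\<^bsub>V\<^esub> \<longleftrightarrow> z \<in> N" unfolding coset_iff by force
  qed
  have "n \<in> carrier V" using n submoduleD_CC(1)[OF N] by auto
  from vs_add_zero[OF V this] show ?thesis using coset_shift[OF n vs_zero[OF V]] z by simp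
qed

text \<open>Operations on a quotient are formed as unions over a coset; they are what they should be when the operation
  does not depend on the representative.\<close>

lemma coset_Union:
  assumes x: "x \<in> carrier V" and T: "\<And>n. n \<in> N \<Longrightarrow> f (n \<oplus>\<^bsub>V\<^esub> x) = f x"
  shows "(\<Union>z\<in>coset V N x. f z) = f x"
proof -
  have "f z = f x" if z: "z \<in> coset V N x" for z
  proof -
    from z obtain n where "n \<in> N" "z = n \<oplus>\<^bsub>V\<^esub> x" unfolding coset_iff by blast
    then show ?thesis using T by simp
  qed
  then show ?thesis using coset_self[OF x] by blast
qed

lemma quot_carrier: "carrier (quot_module V N) = coset V N ` carrier V"
  by (auto simp: quot_module_def A_RCOSETS_def RCOSETS_def a_r_coset_def)

lemma quot_zero: "\<zero>\<^bsub>quot_module V N\<^esub> = N"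
  by (simp add: quot_module_def)

lemma quot_smult:
  assumes "x \<in> carrier V"
  shows "c \<odot>\<^bsub>quot_module V N\<^esub> coset V N x = coset V N (c \<odot>\<^bsub>V\<^esub> x)"
proof -
  have "(\<Union>z\<in>coset V N x. coset V N (c \<odot>\<^bsub>V\<^esub> z)) = coset V N (c \<odot>\<^bsub>V\<^esub> x)"
  proof (rule coset_Union[OF assms])
    fix n assume n: "n \<in> N"
    have "c \<odot>\<^bsub>V\<^esub> (n \<oplus>\<^bsub>V\<^esub> x) = c \<odot>\<^bsub>V\<^esub> n \<oplus>\<^bsub>V\<^esub> c \<odot>\<^bsub>V\<^esub> x"
      using n submoduleD_CC(1)[OF N] assms vs_rdist[OF V] by auto
    then show "coset V N (c \<odot>\<^bsub>V\<^esub> (n \<oplus>\<^bsub>V\<^esub> x)) = coset V N (c \<odot>\<^bsub>V\<^esub> x)"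
      using coset_shift[OF submoduleD_CC(4)[OF N n] vs_smult[OF V assms]] by simp
  qed
  then show ?thesis by (simp add: quot_module_def)
qed

lemma quot_add:
  assumes x: "x \<in> carrier V" and y: "y \<in> carrier V"
  shows "coset V N x \<oplus>\<^bsub>quot_module V N\<^esub> coset V N y = coset V N (x \<oplus>\<^bsub>V\<^esub> y)"
proof -
  have "coset V N x <+>\<^bsub>V\<^esub> coset V N y = coset V N (x \<oplus>\<^bsub>V\<^esub> y)"
  proof (rule Set.set_eqI)
    fix z
    have four: "(m \<oplus>\<^bsub>V\<^esub> x) \<oplus>\<^bsub>V\<^esub> (k \<oplus>\<^bsub>V\<^esub> y) = (m \<oplus>\<^bsub>V\<^esub> k) \<oplus>\<^bsub>V\<^esub> (x \<oplus>\<^bsub>V\<^esub> y)" if "m \<in> N" "k \<in> N" for m k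
    proof -
      interpret abelian_group V by (rule vs_abelian[OF V])
      have "m \<in> carrier V" "k \<in> carrier V" using that submoduleD_CC(1)[OF N] by auto
      then show ?thesis using x y by (simp add: a_ac)
    qed
    show "z \<in> coset V N x <+>\<^bsub>V\<^esub> coset V N y \<longleftrightarrow> z \<in> coset V N (x \<oplus>\<^bsub>V\<^esub> y)"
    proof
      assume "z \<in> coset V N x <+>\<^bsub>V\<^esub> coset V N y"
      then obtain m k where mk: "m \<in> N" "k \<in> N" "z = (m \<oplus>\<^bsub>V\<^esub> x) \<oplus>\<^bsub>V\<^esub> (k \<oplus>\<^bsub>V\<^esub> y)"
        unfolding set_add_def' a_r_coset_def' by auto
      then show "z \<in> coset V N (x \<oplus>\<^bsub>V\<^esub> y)" unfolding coset_iff four[OF mk(1,2)] using submoduleD_CC(3)[OF N] by blast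
    next
      assume "z \<in> coset V N (x \<oplus>\<^bsub>V\<^esub> y)"
      then obtain m where m: "m \<in> N" "z = m \<oplus>\<^bsub>V\<^esub> (x \<oplus>\<^bsub>V\<^esub> y)" unfolding coset_iff by auto
      then have "m \<in> carrier V" using submoduleD_CC(1)[OF N] by auto
      then have "z = (m \<oplus>\<^bsub>V\<^esub> x) \<oplus>\<^bsub>V\<^esub> y" unfolding m(2) by (rule vs_assoc[OF V _ x y, symmetric])
      moreover have "m \<oplus>\<^bsub>V\<^esub> x \<in> coset V N x" using m unfolding coset_iff by blast
      ultimately show "z \<in> coset V N x <+>\<^bsub>V\<^esub> coset V N y" using coset_self[OF y] unfolding set_add_def' by blast
    qed
  qed
  then show ?thesis by (simp add: quot_module_def)
qed

lemma quot_rep: "v \<in> carrier (quot_module V N) \<Longrightarrow> \<exists>x\<in>carrier V. v = coset V N x"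
  unfolding quot_carrier by blast

lemma quot_vectorspace: "vectorspace CC (quot_module V N)"
proof (rule CC_vectorspaceI)
  let ?Q = "quot_module V N"
  have z: "\<zero>\<^bsub>?Q\<^esub> = coset V N \<zero>\<^bsub>V\<^esub>"
    unfolding quot_zero by (rule coset_zero[symmetric]) (rule submoduleD_CC(2)[OF N])
  have c: "coset V N x \<in> carrier ?Q" if "x \<in> carrier V" for x unfolding quot_carrier using that by blast
  show "\<zero>\<^bsub>?Q\<^esub> \<in> carrier ?Q" unfolding z by (rule c) (rule vs_zero[OF V])
  fix a b :: complex and u v w
  assume "v \<in> carrier ?Q"
  then obtain y where y: "y \<in> carrier V" "v = coset V N y" using quot_rep by blast
  note cl = vs_add[OF V] vs_smult[OF V]
  show "a \<odot>\<^bsub>?Q\<^esub> v \<in> carrier ?Q" unfolding y(2) quot_smult[OF y(1)] by (intro c cl y)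
  show "v \<oplus>\<^bsub>?Q\<^esub> \<zero>\<^bsub>?Q\<^esub> = v" unfolding y(2) z quot_add[OF y(1) vs_zero[OF V]] vs_add_zero[OF V y(1)] ..
  show "(a * b) \<odot>\<^bsub>?Q\<^esub> v = a \<odot>\<^bsub>?Q\<^esub> (b \<odot>\<^bsub>?Q\<^esub> v)"
    unfolding y(2) quot_smult[OF y(1)] quot_smult[OF vs_smult[OF V y(1)]] vs_compat[OF V y(1)] ..
  show "1 \<odot>\<^bsub>?Q\<^esub> v = v" unfolding y(2) quot_smult[OF y(1)] vs_one[OF V y(1)] ..
  show "(a + b) \<odot>\<^bsub>?Q\<^esub> v = a \<odot>\<^bsub>?Q\<^esub> v \<oplus>\<^bsub>?Q\<^esub> b \<odot>\<^bsub>?Q\<^esub> v"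
    unfolding y(2) quot_smult[OF y(1)] quot_add[OF vs_smult[OF V y(1)] vs_smult[OF V y(1)]] vs_ldist[OF V y(1)] ..
  show "0 \<odot>\<^bsub>?Q\<^esub> v = \<zero>\<^bsub>?Q\<^esub>" unfolding y(2) quot_smult[OF y(1)] vs_zero_smult[OF V y(1)] z ..
  assume "w \<in> carrier ?Q"
  then obtain t where t: "t \<in> carrier V" "w = coset V N t" using quot_rep by blast
  show "v \<oplus>\<^bsub>?Q\<^esub> w \<in> carrier ?Q" unfolding y(2) t(2) quot_add[OF y(1) t(1)] by (intro c cl y t)
  show "v \<oplus>\<^bsub>?Q\<^esub> w = w \<oplus>\<^bsub>?Q\<^esub> v"
    unfolding y(2) t(2) quot_add[OF y(1) t(1)] quot_add[OF t(1) y(1)] vs_comm[OF V y(1) t(1)] ..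
  show "a \<odot>\<^bsub>?Q\<^esub> (v \<oplus>\<^bsub>?Q\<^esub> w) = a \<odot>\<^bsub>?Q\<^esub> v \<oplus>\<^bsub>?Q\<^esub> a \<odot>\<^bsub>?Q\<^esub> w"
    unfolding y(2) t(2) quot_add[OF y(1) t(1)] quot_smult[OF y(1)] quot_smult[OF t(1)]
      quot_smult[OF vs_add[OF V y(1) t(1)]] quot_add[OF vs_smult[OF V y(1)] vs_smult[OF V t(1)]] vs_rdist[OF V y(1) t(1)] ..
  assume "u \<in> carrier ?Q"
  then obtain x where x: "x \<in> carrier V" "u = coset V N x" using quot_rep by blast
  show "u \<oplus>\<^bsub>?Q\<^esub> v \<oplus>\<^bsub>?Q\<^esub> w = u \<oplus>\<^bsub>?Q\<^esub> (v \<oplus>\<^bsub>?Q\<^esub> w)"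
    unfolding x(2) y(2) t(2) quot_add[OF y(1) t(1)] quot_add[OF x(1) y(1)] quot_add[OF vs_add[OF V x(1) y(1)] t(1)]
      quot_add[OF x(1) vs_add[OF V y(1) t(1)]] vs_assoc[OF V x(1) y(1) t(1)] ..
qed

end

lemma prod_vectorspace:
  assumes "\<And>i. i \<in> I \<Longrightarrow> vectorspace CC (V i :: (complex, 'v, 'c) module_scheme)"
  shows "vectorspace CC (prod_module I V)"
proof (rule CC_vectorspaceI)
  note s = prod_module_def PiE_iff
  have eqI: "f = g" if "f \<in> extensional I" "g \<in> extensional I" "\<And>i. i \<in> I \<Longrightarrow> f i = g i" for f g :: "'a \<Rightarrow> 'v"
    using that by (rule extensionalityI)
  show "\<zero>\<^bsub>prod_module I V\<^esub> \<in> carrier (prod_module I V)" by (auto simp: s vs_zero[OF assms])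
  show "v \<oplus>\<^bsub>prod_module I V\<^esub> w \<in> carrier (prod_module I V)" if "v \<in> carrier (prod_module I V)" "w \<in> carrier (prod_module I V)" for v w
    using that by (auto simp: s vs_add[OF assms])
  show "c \<odot>\<^bsub>prod_module I V\<^esub> v \<in> carrier (prod_module I V)" if "v \<in> carrier (prod_module I V)" for c v
    using that by (auto simp: s vs_smult[OF assms])
  show "v \<oplus>\<^bsub>prod_module I V\<^esub> w = w \<oplus>\<^bsub>prod_module I V\<^esub> v" if "v \<in> carrier (prod_module I V)" "w \<in> carrier (prod_module I V)" for v w
    by (rule eqI) (use that in \<open>auto simp: s vs_comm[OF assms]\<close>)
  show "u \<oplus>\<^bsub>prod_module I V\<^esub> v \<oplus>\<^bsub>prod_module I V\<^esub> w = u \<oplus>\<^bsub>prod_module I V\<^esub> (v \<oplus>\<^bsub>prod_module I V\<^esub> w)"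
    if "u \<in> carrier (prod_module I V)" "v \<in> carrier (prod_module I V)" "w \<in> carrier (prod_module I V)" for u v w
    by (rule eqI) (use that in \<open>auto simp: s vs_assoc[OF assms]\<close>)
  show "v \<oplus>\<^bsub>prod_module I V\<^esub> \<zero>\<^bsub>prod_module I V\<^esub> = v" if "v \<in> carrier (prod_module I V)" for v
    by (rule eqI) (use that in \<open>auto simp: s vs_add_zero[OF assms]\<close>)
  show "(a * b) \<odot>\<^bsub>prod_module I V\<^esub> v = a \<odot>\<^bsub>prod_module I V\<^esub> (b \<odot>\<^bsub>prod_module I V\<^esub> v)" if "v \<in> carrier (prod_module I V)" for a b v
    by (rule eqI) (use that in \<open>auto simp: s vs_compat[OF assms]\<close>)
  show "1 \<odot>\<^bsub>prod_module I V\<^esub> v = v" if "v \<in> carrier (prod_module I V)" for v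
    by (rule eqI) (use that in \<open>auto simp: s vs_one[OF assms]\<close>)
  show "(a + b) \<odot>\<^bsub>prod_module I V\<^esub> v = a \<odot>\<^bsub>prod_module I V\<^esub> v \<oplus>\<^bsub>prod_module I V\<^esub> b \<odot>\<^bsub>prod_module I V\<^esub> v" if "v \<in> carrier (prod_module I V)" for a b v
    by (rule eqI) (use that in \<open>auto simp: s vs_ldist[OF assms]\<close>)
  show "a \<odot>\<^bsub>prod_module I V\<^esub> (v \<oplus>\<^bsub>prod_module I V\<^esub> w) = a \<odot>\<^bsub>prod_module I V\<^esub> v \<oplus>\<^bsub>prod_module I V\<^esub> a \<odot>\<^bsub>prod_module I V\<^esub> w"
    if "v \<in> carrier (prod_module I V)" "w \<in> carrier (prod_module I V)" for a v w
    by (rule eqI) (use that in \<open>auto simp: s vs_rdist[OF assms]\<close>)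
  show "0 \<odot>\<^bsub>prod_module I V\<^esub> v = \<zero>\<^bsub>prod_module I V\<^esub>" if "v \<in> carrier (prod_module I V)" for v
    by (rule eqI) (use that in \<open>auto simp: s vs_zero_smult[OF assms]\<close>)
qed

lemma prod_module_simps:
  "carrier (prod_module I V) = (\<Pi>\<^sub>E i\<in>I. carrier (V i))"
  "\<zero>\<^bsub>prod_module I V\<^esub> = (\<lambda>i\<in>I. \<zero>\<^bsub>V i\<^esub>)"
  "f \<oplus>\<^bsub>prod_module I V\<^esub> g = (\<lambda>i\<in>I. f i \<oplus>\<^bsub>V i\<^esub> g i)"
  "c \<odot>\<^bsub>prod_module I V\<^esub> f = (\<lambda>i\<in>I. c \<odot>\<^bsub>V i\<^esub> f i)"
  by (auto simp: prod_module_def)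

section \<open>Free algebras and coordinates of words\<close>

lemma free_algebra_simps:
  "f \<in> carrier (free_algebra X) \<longleftrightarrow> finite {w. f w \<noteq> 0} \<and> {w. f w \<noteq> 0} \<subseteq> lists X"
  "\<zero>\<^bsub>free_algebra X\<^esub> = (\<lambda>w. 0)" "f \<oplus>\<^bsub>free_algebra X\<^esub> g = (\<lambda>w. f w + g w)"
  "c \<odot>\<^bsub>free_algebra X\<^esub> f = (\<lambda>w. c * f w)"
  by (auto simp: free_algebra_def)

lemma free_carrier_add:
  assumes "f \<in> carrier (free_algebra X)" "g \<in> carrier (free_algebra X)"
  shows "(\<lambda>w. f w + g w) \<in> carrier (free_algebra X)"
proof -
  have "{w. f w + g w \<noteq> 0} \<subseteq> {w. f w \<noteq> 0} \<union> {w. g w \<noteq> 0}" by auto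
  then show ?thesis using assms unfolding free_algebra_simps by (meson finite_UnI finite_subset le_sup_iff order_trans)
qed

lemma free_carrier_smult:
  assumes "f \<in> carrier (free_algebra X)"
  shows "(\<lambda>w. c * f w) \<in> carrier (free_algebra X)"
proof -
  have "{w. c * f w \<noteq> 0} \<subseteq> {w. f w \<noteq> 0}" by auto
  then show ?thesis using assms unfolding free_algebra_simps by (meson finite_subset order_trans)
qed

lemma free_vectorspace: "vectorspace CC (free_algebra X)"
  by (rule CC_vectorspaceI)
    (simp_all only: free_algebra_simps(2-4) free_carrier_add free_carrier_smult,
     simp_all add: free_algebra_simps(1) algebra_simps)

lemma word_carrier: "w \<in> lists X \<Longrightarrow> word w \<in> carrier (free_algebra X)"
  by (auto simp: free_algebra_simps(1) word_def)

lemma free_submoduleD: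
  assumes "submodule CC N (free_algebra X)"
  shows "N \<subseteq> carrier (free_algebra X)" "(\<lambda>_. 0) \<in> N" "\<And>f g. f \<in> N \<Longrightarrow> g \<in> N \<Longrightarrow> (\<lambda>t. f t + g t) \<in> N"
    "\<And>c f. f \<in> N \<Longrightarrow> (\<lambda>t. c * f t) \<in> N"
  using submoduleD_CC[OF assms] by (simp_all only: free_algebra_simps(2-4))

lemma free_submodule_sum:
  assumes "submodule CC N (free_algebra X)" "finite J" "\<And>a. a \<in> J \<Longrightarrow> f a \<in> N"
  shows "(\<lambda>t. \<Sum>a\<in>J. c a * f a t) \<in> N"
  using assms(2,3)
proof (induction J)
  case empty then show ?case using free_submoduleD(2)[OF assms(1)] by simp
next
  case (insert a J)
  have "(\<lambda>t. c a * f a t + (\<Sum>a\<in>J. c a * f a t)) \<in> N"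
    by (intro free_submoduleD(3)[OF assms(1)] free_submoduleD(4)[OF assms(1)]) (use insert in auto)
  then show ?case using insert by simp
qed

lemma free_carrier_submodule: "submodule CC (carrier (free_algebra X)) (free_algebra X)"
  by (rule submoduleI_CC[OF free_vectorspace])
    (auto simp only: free_algebra_simps(2-4) free_carrier_add free_carrier_smult, simp add: free_algebra_simps)

text \<open>Coordinates of words: \<open>\<phi> a\<close> are functionals on the letters, and the tensor product of the functionals named by
  \<open>vs\<close> is evaluated at a word, and by \<open>evalw\<close> at an element of the free algebra.\<close>

fun pairing :: "('a \<Rightarrow> 'm \<Rightarrow> complex) \<Rightarrow> 'a list \<Rightarrow> 'm list \<Rightarrow> complex" where
  "pairing \<phi> [] [] = 1"
| "pairing \<phi> (a # vs) (y # u) = \<phi> a y * pairing \<phi> vs u"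
| "pairing \<phi> _ _ = 0"

lemma pairing_append:
  "length p = length p' \<Longrightarrow> pairing \<phi> (p @ s) (p' @ s') = pairing \<phi> p p' * pairing \<phi> s s'"
  by (induction p p' rule: list_induct2) auto

lemma pairing_length: "length vs \<noteq> length u \<Longrightarrow> pairing \<phi> vs u = 0"
  by (induction \<phi> vs u rule: pairing.induct) auto

definition evalw :: "('a \<Rightarrow> 'm \<Rightarrow> complex) \<Rightarrow> 'a list \<Rightarrow> ('m list \<Rightarrow> complex) \<Rightarrow> complex" where
  "evalw \<phi> vs f = (\<Sum>u | f u \<noteq> 0. f u * pairing \<phi> vs u)"

lemma evalw_superset:
  assumes "finite S" "{u. f u \<noteq> 0} \<subseteq> S"
  shows "evalw \<phi> vs f = (\<Sum>u\<in>S. f u * pairing \<phi> vs u)"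
  unfolding evalw_def by (rule sum.mono_neutral_left) (use assms in auto)

lemma evalw_sum:
  assumes "finite J" "\<And>a. a \<in> J \<Longrightarrow> finite {u. f a u \<noteq> 0}"
  shows "evalw \<phi> vs (\<lambda>u. \<Sum>a\<in>J. c a * f a u) = (\<Sum>a\<in>J. c a * evalw \<phi> vs (f a))"
proof -
  let ?S = "\<Union>a\<in>J. {u. f a u \<noteq> 0}"
  have S: "finite ?S" using assms by auto
  have "{u. (\<Sum>a\<in>J. c a * f a u) \<noteq> 0} \<subseteq> ?S"
  proof
    fix u assume "u \<in> {u. (\<Sum>a\<in>J. c a * f a u) \<noteq> 0}"
    then obtain a where "a \<in> J" "c a * f a u \<noteq> 0" using sum.neutral[of J "\<lambda>a. c a * f a u"] by blast
    then show "u \<in> ?S" by auto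
  qed
  then have "evalw \<phi> vs (\<lambda>u. \<Sum>a\<in>J. c a * f a u) = (\<Sum>u\<in>?S. (\<Sum>a\<in>J. c a * f a u) * pairing \<phi> vs u)"
    by (rule evalw_superset[OF S])
  also have "\<dots> = (\<Sum>a\<in>J. c a * (\<Sum>u\<in>?S. f a u * pairing \<phi> vs u))"
    unfolding sum_distrib_right sum_distrib_left by (subst sum.swap) (simp only: mult.assoc)
  also have "\<dots> = (\<Sum>a\<in>J. c a * evalw \<phi> vs (f a))"
  proof (rule sum.cong[OF refl])
    fix a assume "a \<in> J"
    then have "{u. f a u \<noteq> 0} \<subseteq> ?S" by auto
    from evalw_superset[OF S this, of \<phi> vs]
    show "c a * (\<Sum>u\<in>?S. f a u * pairing \<phi> vs u) = c a * evalw \<phi> vs (f a)" by (simp only:)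
  qed
  finally show ?thesis .
qed

lemma evalw_add:
  assumes "finite {u. f u \<noteq> 0}" "finite {u. g u \<noteq> 0}"
  shows "evalw \<phi> vs (\<lambda>u. f u + g u) = evalw \<phi> vs f + evalw \<phi> vs g"
  using evalw_sum[of "{True, False}" "\<lambda>b. if b then f else g" \<phi> vs "\<lambda>_. 1"] assms by simp

lemma evalw_smult:
  assumes "finite {u. f u \<noteq> 0}"
  shows "evalw \<phi> vs (\<lambda>u. c * f u) = c * evalw \<phi> vs f"
  using evalw_sum[of "{()}" "\<lambda>_. f" \<phi> vs "\<lambda>_. c"] assms by simp

lemma evalw_word: "evalw \<phi> vs (word w) = pairing \<phi> vs w"
proof -
  have "{u. word w u \<noteq> 0} = {w}" by (auto simp: word_def)
  then show ?thesis by (simp add: evalw_def word_def)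
qed

lemma evalw_lin_ext:
  assumes "finite {w. f w \<noteq> 0}" "\<And>w. f w \<noteq> 0 \<Longrightarrow> finite {u. \<psi> w u \<noteq> 0}"
  shows "evalw \<phi> vs (lin_ext \<psi> f) = (\<Sum>w | f w \<noteq> 0. f w * evalw \<phi> vs (\<psi> w))"
  unfolding lin_ext_def by (rule evalw_sum) (use assms in auto)

lemma free_expand:
  assumes "f \<in> carrier (free_algebra X)"
  shows "f t = (\<Sum>w | f w \<noteq> 0. f w * word w t)"
proof -
  have "finite {w. f w \<noteq> 0}" using assms by (simp add: free_algebra_simps)
  then have "(\<Sum>w | f w \<noteq> 0. f w * word w t) = (\<Sum>w | f w \<noteq> 0. if w = t then f w else 0)"
    by (intro sum.cong) (auto simp: word_def)
  also have "\<dots> = f t" using \<open>finite {w. f w \<noteq> 0}\<close> by (simp add: sum.delta)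
  finally show ?thesis by simp
qed

section \<open>Tensor relations in coordinates\<close>

text \<open>A finite family of functionals together with vectors such that \<open>y = \<Sum> \<phi> a y \<cdot> x a\<close> for all \<open>y\<close>.  The vectors may be
  linearly dependent: in an induced module the natural functionals, indexed by all elements of the group,
  are redundant, and with such frames no transversal has to be chosen.\<close>

locale coord_space =
  fixes M :: "(complex, 'm, 'c) module_scheme" and I :: "'a set" and \<phi> :: "'a \<Rightarrow> 'm \<Rightarrow> complex" and x :: "'a \<Rightarrow> 'm"
  assumes finI: "finite I" and M_vs: "vectorspace CC M"
    and \<phi>_add: "\<And>a y z. a \<in> I \<Longrightarrow> y \<in> carrier M \<Longrightarrow> z \<in> carrier M \<Longrightarrow> \<phi> a (y \<oplus>\<^bsub>M\<^esub> z) = \<phi> a y + \<phi> a z"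
    and \<phi>_smult: "\<And>a c y. a \<in> I \<Longrightarrow> y \<in> carrier M \<Longrightarrow> \<phi> a (c \<odot>\<^bsub>M\<^esub> y) = c * \<phi> a y"
    and x_closed: "\<And>a. a \<in> I \<Longrightarrow> x a \<in> carrier M"
    and expand: "\<And>y. y \<in> carrier M \<Longrightarrow> finsum M (\<lambda>a. \<phi> a y \<odot>\<^bsub>M\<^esub> x a) I = y"
begin

abbreviation "FA \<equiv> free_algebra (carrier M)"
abbreviation "TR \<equiv> tensor_relations M"

lemma gens:
  shows gens_subset: "{(\<lambda>t. word (u @ [x \<oplus>\<^bsub>M\<^esub> y] @ v) t - word (u @ [x] @ v) t - word (u @ [y] @ v) t) | u v x y.
        u \<in> lists (carrier M) \<and> v \<in> lists (carrier M) \<and> x \<in> carrier M \<and> y \<in> carrier M} \<union>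
     {(\<lambda>t. word (u @ [c \<odot>\<^bsub>M\<^esub> x] @ v) t - c * word (u @ [x] @ v) t) | u v c x.
        u \<in> lists (carrier M) \<and> v \<in> lists (carrier M) \<and> x \<in> carrier M} \<subseteq> carrier FA" (is "?A \<union> ?B \<subseteq> _")
proof -
  have c: "(\<lambda>t. word a t - d * word b t) \<in> carrier FA" if "a \<in> lists (carrier M)" "b \<in> lists (carrier M)" for a b d
    using free_carrier_add[OF word_carrier[OF that(1)] free_carrier_smult[OF word_carrier[OF that(2)], of "-d"]] by simp
  have "?B \<subseteq> carrier FA"
  proof
    fix f assume "f \<in> ?B"
    then obtain u v d y where f: "f = (\<lambda>t. word (u @ [d \<odot>\<^bsub>M\<^esub> y] @ v) t - d * word (u @ [y] @ v) t)"
      and l: "u \<in> lists (carrier M)" "v \<in> lists (carrier M)" "y \<in> carrier M" by blast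
    have "u @ [d \<odot>\<^bsub>M\<^esub> y] @ v \<in> lists (carrier M)" "u @ [y] @ v \<in> lists (carrier M)"
      using l vs_smult[OF M_vs] by auto
    then show "f \<in> carrier FA" unfolding f by (rule c)
  qed
  moreover have "(\<lambda>t. word (u @ [x \<oplus>\<^bsub>M\<^esub> y] @ v) t - word (u @ [x] @ v) t - word (u @ [y] @ v) t) \<in> carrier FA"
    if "u \<in> lists (carrier M)" "v \<in> lists (carrier M)" "x \<in> carrier M" "y \<in> carrier M" for u v x y
  proof -
    have "u @ [x \<oplus>\<^bsub>M\<^esub> y] @ v \<in> lists (carrier M)" "u @ [x] @ v \<in> lists (carrier M)" "u @ [y] @ v \<in> lists (carrier M)"
      using that vs_add[OF M_vs] by auto
    from free_carrier_add[OF c[OF this(1,2), of 1] free_carrier_smult[OF word_carrier[OF this(3)], of "-1"]]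
    show ?thesis by simp
  qed
  then have "?A \<subseteq> carrier FA" by blast
  ultimately show ?thesis by blast
qed

lemma TR_submodule: "submodule CC TR FA"
  unfolding tensor_relations_def by (rule lin_span_submodule[OF free_vectorspace gens_subset])

lemma TR_add_gen:
  assumes "u \<in> lists (carrier M)" "v \<in> lists (carrier M)" "y \<in> carrier M" "z \<in> carrier M"
  shows "(\<lambda>t. word (u @ [y \<oplus>\<^bsub>M\<^esub> z] @ v) t - word (u @ [y] @ v) t - word (u @ [z] @ v) t) \<in> TR"
  unfolding tensor_relations_def by (rule subsetD[OF lin_span_superset[OF free_vectorspace gens_subset]]) (use assms in blast)

lemma TR_smult_gen:
  assumes "u \<in> lists (carrier M)" "v \<in> lists (carrier M)" "y \<in> carrier M"
  shows "(\<lambda>t. word (u @ [c \<odot>\<^bsub>M\<^esub> y] @ v) t - c * word (u @ [y] @ v) t) \<in> TR"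
  unfolding tensor_relations_def by (rule subsetD[OF lin_span_superset[OF free_vectorspace gens_subset]]) (use assms in blast)

lemmas TR_closed = free_submoduleD[OF TR_submodule]

lemma pairing_additive:
  assumes "set vs \<subseteq> I" "y \<in> carrier M" "z \<in> carrier M"
  shows "pairing \<phi> vs (p @ [y \<oplus>\<^bsub>M\<^esub> z] @ s) = pairing \<phi> vs (p @ [y] @ s) + pairing \<phi> vs (p @ [z] @ s)"
  using assms
proof (induction p arbitrary: vs)
  case Nil
  then show ?case by (cases vs) (auto simp: \<phi>_add algebra_simps)
next
  case (Cons a p)
  then show ?case by (cases vs) (auto simp: algebra_simps)
qed

lemma pairing_homogeneous:
  assumes "set vs \<subseteq> I" "y \<in> carrier M"
  shows "pairing \<phi> vs (p @ [c \<odot>\<^bsub>M\<^esub> y] @ s) = c * pairing \<phi> vs (p @ [y] @ s)"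
  using assms
proof (induction p arbitrary: vs)
  case Nil
  then show ?case by (cases vs) (auto simp: \<phi>_smult)
next
  case (Cons a p)
  then show ?case by (cases vs) auto
qed

lemma finite_word: "finite {t. word w t \<noteq> 0}" by (simp add: word_def)

lemma evalw_diff_words:
  "evalw \<phi> vs (\<lambda>t. word a t - c * word b t) = pairing \<phi> vs a - c * pairing \<phi> vs b"
  "evalw \<phi> vs (\<lambda>t. word a t - word b t - word d t) = pairing \<phi> vs a - pairing \<phi> vs b - pairing \<phi> vs d"
proof -
  have s: "evalw \<phi> vs (\<lambda>t. word a t + c * word b t) = pairing \<phi> vs a + c * pairing \<phi> vs b" for c
  proof -
    have "finite {u. (if k then word a else word b) u \<noteq> 0}" for k by (cases k) (simp_all add: finite_word)
    from evalw_sum[of "{True, False}" "\<lambda>k. if k then word a else word b" \<phi> vs "\<lambda>k. if k then 1 else c", OF _ this]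
    show ?thesis by (simp add: evalw_word)
  qed
  show "evalw \<phi> vs (\<lambda>t. word a t - c * word b t) = pairing \<phi> vs a - c * pairing \<phi> vs b" using s[of "-c"] by simp
  have "evalw \<phi> vs (\<lambda>t. \<Sum>k\<in>{0,1,2::nat}. (if k = 0 then 1 else -1) * (if k = 0 then word a else if k = 1 then word b else word d) t) =
    (\<Sum>k\<in>{0,1,2::nat}. (if k = 0 then 1 else -1) * evalw \<phi> vs (if k = 0 then word a else if k = 1 then word b else word d))"
    by (rule evalw_sum) (auto simp: finite_word)
  then show "evalw \<phi> vs (\<lambda>t. word a t - word b t - word d t) = pairing \<phi> vs a - pairing \<phi> vs b - pairing \<phi> vs d"
    by (simp add: evalw_word algebra_simps)
qed

lemma evalw_TR:
  assumes "f \<in> TR" "set vs \<subseteq> I"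
  shows "evalw \<phi> vs f = 0"
proof -
  let ?N = "{f \<in> carrier FA. evalw \<phi> vs f = 0}"
  have fin: "finite {u. f u \<noteq> 0}" if "f \<in> carrier FA" for f using that by (simp add: free_algebra_simps)
  have N: "submodule CC ?N FA"
  proof (rule submoduleI_CC[OF free_vectorspace])
    show "\<zero>\<^bsub>FA\<^esub> \<in> ?N" using vs_zero[OF free_vectorspace[of "carrier M"]] by (simp add: free_algebra_simps evalw_def)
    show "f \<oplus>\<^bsub>FA\<^esub> g \<in> ?N" if "f \<in> ?N" "g \<in> ?N" for f g
      using that fin free_carrier_add[of f _ g] evalw_add[of f g \<phi> vs] by (simp add: free_algebra_simps(3))
    show "c \<odot>\<^bsub>FA\<^esub> f \<in> ?N" if "f \<in> ?N" for c f
      using that fin free_carrier_smult[of f _ c] evalw_smult[of f \<phi> vs c] by (simp add: free_algebra_simps(4))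
  qed auto
  have "TR \<subseteq> ?N"
    unfolding tensor_relations_def
  proof (rule lin_span_least[OF free_vectorspace gens_subset _ N], rule subsetI)
    fix f assume f: "f \<in> {(\<lambda>t. word (u @ [x \<oplus>\<^bsub>M\<^esub> y] @ v) t - word (u @ [x] @ v) t - word (u @ [y] @ v) t) | u v x y.
        u \<in> lists (carrier M) \<and> v \<in> lists (carrier M) \<and> x \<in> carrier M \<and> y \<in> carrier M} \<union>
     {(\<lambda>t. word (u @ [c \<odot>\<^bsub>M\<^esub> x] @ v) t - c * word (u @ [x] @ v) t) | u v c x.
        u \<in> lists (carrier M) \<and> v \<in> lists (carrier M) \<and> x \<in> carrier M}" (is "f \<in> ?A \<union> ?B")
    then have "evalw \<phi> vs f = 0"
    proof
      assume "f \<in> ?A"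
      then obtain u v y z where "y \<in> carrier M" "z \<in> carrier M"
        "f = (\<lambda>t. word (u @ [y \<oplus>\<^bsub>M\<^esub> z] @ v) t - word (u @ [y] @ v) t - word (u @ [z] @ v) t)" by blast
      then show ?thesis using pairing_additive[OF assms(2), of y z u v] by (simp only: evalw_diff_words) simp
    next
      assume "f \<in> ?B"
      then obtain u v c y where "y \<in> carrier M" "f = (\<lambda>t. word (u @ [c \<odot>\<^bsub>M\<^esub> y] @ v) t - c * word (u @ [y] @ v) t)" by blast
      then show ?thesis using pairing_homogeneous[OF assms(2), of y u c v] by (simp only: evalw_diff_words) simp
    qed
    then show "f \<in> ?N" using subsetD[OF gens_subset f] by simp
  qed
  then show ?thesis using assms(1) by blast
qed

fun expand_word :: "'m list \<Rightarrow> 'm list \<Rightarrow> 'm list \<Rightarrow> complex" where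
  "expand_word [] p = word p"
| "expand_word (y # u) p = (\<lambda>t. \<Sum>a\<in>I. \<phi> a y * expand_word u (p @ [x a]) t)"

lemma TR_letter_sum:
  assumes "finite J" "J \<subseteq> I" "p \<in> lists (carrier M)" "u \<in> lists (carrier M)"
  shows "(\<lambda>t. word (p @ [finsum M (\<lambda>a. c a \<odot>\<^bsub>M\<^esub> x a) J] @ u) t - (\<Sum>a\<in>J. c a * word (p @ [x a] @ u) t)) \<in> TR"
  using assms(1,2)
proof (induction J)
  interpret m: abelian_group M by (rule vs_abelian[OF M_vs])
  case empty
  have "\<zero>\<^bsub>M\<^esub> = 0 \<odot>\<^bsub>M\<^esub> \<zero>\<^bsub>M\<^esub>" using vs_smult_zero[OF M_vs] by simp
  with TR_smult_gen[OF assms(3,4) vs_zero[OF M_vs], of 0] show ?case by simp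
next
  interpret m: abelian_group M by (rule vs_abelian[OF M_vs])
  case (insert a J)
  let ?s = "finsum M (\<lambda>a. c a \<odot>\<^bsub>M\<^esub> x a) J"
  have cl: "c b \<odot>\<^bsub>M\<^esub> x b \<in> carrier M" if "b \<in> I" for b by (intro vs_smult[OF M_vs] x_closed that)
  have s: "?s \<in> carrier M" by (rule m.finsum_closed) (use cl insert in auto)
  have a: "c a \<odot>\<^bsub>M\<^esub> x a \<in> carrier M" "x a \<in> carrier M" using cl x_closed insert by auto
  have f: "finsum M (\<lambda>a. c a \<odot>\<^bsub>M\<^esub> x a) (insert a J) = c a \<odot>\<^bsub>M\<^esub> x a \<oplus>\<^bsub>M\<^esub> ?s"
    by (rule m.finsum_insert) (use insert cl in auto)
  have "J \<subseteq> I" using insert by auto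
  from TR_closed(3)[OF TR_closed(3)[OF TR_add_gen[OF assms(3,4) a(1) s] TR_smult_gen[OF assms(3,4) a(2), of "c a"]] insert.IH[OF this]]
  show ?case unfolding f using insert by (simp add: algebra_simps)
qed

lemma expand_word_TR:
  assumes "u \<in> lists (carrier M)" "p \<in> lists (carrier M)"
  shows "(\<lambda>t. word (p @ u) t - expand_word u p t) \<in> TR"
  using assms
proof (induction u arbitrary: p rule: list.induct)
  case Nil
  then show ?case using TR_closed(2) by simp
next
  case (Cons y u)
  have y: "y \<in> carrier M" "u \<in> lists (carrier M)" using Cons.prems by auto
  have 1: "(\<lambda>t. word (p @ [y] @ u) t - (\<Sum>a\<in>I. \<phi> a y * word (p @ [x a] @ u) t)) \<in> TR"
    using TR_letter_sum[OF finI subset_refl Cons.prems(2) y(2), of "\<lambda>a. \<phi> a y"] unfolding expand[OF y(1)] .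
  have 2: "(\<lambda>t. \<Sum>a\<in>I. \<phi> a y * (word ((p @ [x a]) @ u) t - expand_word u (p @ [x a]) t)) \<in> TR"
    by (rule free_submodule_sum[OF TR_submodule finI], rule Cons.IH[OF y(2)]) (use Cons.prems x_closed in auto)
  show ?case using TR_closed(3)[OF 1 2] by (simp add: right_diff_distrib sum_subtractf)
qed

definition words_of :: "nat \<Rightarrow> 'a list set" where "words_of n = {vs. set vs \<subseteq> I \<and> length vs = n}"

lemma finite_words_of: "finite (words_of n)"
  unfolding words_of_def using finite_lists_length_eq[OF finI] by simp

lemma expand_word_sum: "expand_word u p t = (\<Sum>vs\<in>words_of (length u). pairing \<phi> vs u * word (p @ map x vs) t)"
proof (induction u arbitrary: p)
  case Nil
  have "words_of 0 = {[]}" by (auto simp: words_of_def)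
  then show ?case by simp
next
  case (Cons y u)
  have w: "words_of (length (y # u)) = (\<lambda>(a, vs). a # vs) ` (I \<times> words_of (length u))"
    by (auto simp: words_of_def length_Suc_conv image_iff)
  have "(\<Sum>vs\<in>words_of (length (y # u)). pairing \<phi> vs (y # u) * word (p @ map x vs) t) =
    (\<Sum>(a, vs)\<in>I \<times> words_of (length u). pairing \<phi> (a # vs) (y # u) * word (p @ map x (a # vs)) t)"
    unfolding w by (subst sum.reindex) (auto simp: inj_on_def split_beta)
  also have "\<dots> = (\<Sum>a\<in>I. \<Sum>vs\<in>words_of (length u). pairing \<phi> (a # vs) (y # u) * word (p @ map x (a # vs)) t)"
    by (rule sum.cartesian_product[symmetric])
  also have "\<dots> = (\<Sum>a\<in>I. \<phi> a y * expand_word u (p @ [x a]) t)"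
    unfolding Cons.IH sum_distrib_left by (simp add: mult.assoc)
  finally show ?case by simp
qed

text \<open>The converse of \<open>evalw_TR\<close>.  Modulo the relations each letter can be expanded in the frame, so an element of
  degree \<open>n\<close> is congruent to the combination of words in the vectors \<open>x a\<close> whose coefficients are the numbers
  \<open>evalw \<phi> vs f\<close>.\<close>

lemma kernel_TR:
  assumes f: "f \<in> carrier FA" "\<And>u. f u \<noteq> 0 \<Longrightarrow> length u = n"
    and z: "\<And>vs. vs \<in> words_of n \<Longrightarrow> evalw \<phi> vs f = 0"
  shows "f \<in> TR"
proof -
  have fin: "finite {u. f u \<noteq> 0}" "{u. f u \<noteq> 0} \<subseteq> lists (carrier M)" using f(1) by (auto simp: free_algebra_simps)
  have "(\<lambda>t. \<Sum>u | f u \<noteq> 0. f u * (word ([] @ u) t - expand_word u [] t)) \<in> TR"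
    by (rule free_submodule_sum[OF TR_submodule fin(1)], rule expand_word_TR) (use fin(2) in auto)
  moreover have "(\<Sum>u | f u \<noteq> 0. f u * (word ([] @ u) t - expand_word u [] t)) = f t" for t
  proof -
    have "(\<Sum>u | f u \<noteq> 0. f u * expand_word u [] t) = (\<Sum>u | f u \<noteq> 0. \<Sum>vs\<in>words_of n. f u * pairing \<phi> vs u * word (map x vs) t)"
      by (rule sum.cong[OF refl]) (use f(2) in \<open>simp add: expand_word_sum sum_distrib_left mult.assoc\<close>)
    also have "\<dots> = (\<Sum>vs\<in>words_of n. evalw \<phi> vs f * word (map x vs) t)"
      unfolding evalw_def sum_distrib_right by (rule sum.swap)
    also have "\<dots> = 0" using z by simp
    finally show ?thesis using free_expand[OF f(1), of t] by (simp add: right_diff_distrib sum_subtractf)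
  qed
  ultimately show ?thesis by simp
qed

end

section \<open>Nichols algebras with diagonal coordinates\<close>

definition swap_at :: "nat \<Rightarrow> 'a list \<Rightarrow> 'a list" where
  "swap_at i vs = take i vs @ [vs ! Suc i, vs ! i] @ drop (Suc (Suc i)) vs"

lemma split_at:
  assumes "Suc i < length vs"
  shows "vs = take i vs @ [vs ! i, vs ! Suc i] @ drop (Suc (Suc i)) vs"
proof -
  have "drop i vs = vs ! i # vs ! Suc i # drop (Suc (Suc i)) vs" using assms by (simp add: Cons_nth_drop_Suc)
  then show ?thesis using append_take_drop_id[of i vs] by simp
qed

lemma swap_at_map:
  assumes "Suc i < n"
  shows "swap_at i (map v [0..<n]) = map (v \<circ> swp i) [0..<n]"
proof (rule nth_equalityI)
  show "length (swap_at i (map v [0..<n])) = length (map (v \<circ> swp i) [0..<n])"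
    using assms by (simp add: swap_at_def)
  fix k assume "k < length (swap_at i (map v [0..<n]))"
  then have k: "k < n" using assms by (simp add: swap_at_def)
  consider "k < i" | "k = i" | "k = Suc i" | "k > Suc i" by linarith
  then show "swap_at i (map v [0..<n]) ! k = map (v \<circ> swp i) [0..<n] ! k"
  proof cases
    case 4
    then obtain l where "k = Suc (Suc (i + l))" by (auto simp: less_iff_Suc_add)
    then show ?thesis using assms k by (auto simp: swap_at_def nth_append Transposition.transpose_def nth_Cons')
  qed (use assms k in \<open>auto simp: swap_at_def nth_append Transposition.transpose_def nth_Cons'\<close>)
qed

lemma inv_prod_cong:
  assumes "\<And>i j. i \<in> set ps \<Longrightarrow> j \<in> set ps \<Longrightarrow> q (v i) (v j) = q' (v' i) (v' j)"
  shows "inv_prod q v ps = inv_prod q' v' ps"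
  using assms
proof (induction ps)
  case (Cons p ps)
  have "(\<Prod>r\<in>{r \<in> set ps. r < p}. q (v p) (v r)) = (\<Prod>r\<in>{r \<in> set ps. r < p}. q' (v' p) (v' r))"
    by (rule prod.cong) (use Cons.prems in auto)
  moreover have "inv_prod q v ps = inv_prod q' v' ps" by (rule Cons.IH) (use Cons.prems in auto)
  ultimately show ?case by (simp only: inv_prod.simps)
qed simp

text \<open>In these coordinates the braiding is diagonal: \<open>\<phi> a\<close> sees only the component of degree \<open>deg a\<close>, and the degrees of
  the frame act on the functionals by scalars.\<close>

locale diag_frame = coord_space M I \<phi> x
  for G :: "('g, 'b) monoid_scheme" and M :: "('g, 'm, 'c) yd_module_scheme" and I :: "'a set"
    and \<phi> :: "'a \<Rightarrow> 'm \<Rightarrow> complex" and x :: "'a \<Rightarrow> 'm" +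
  fixes q :: "'a \<Rightarrow> 'a \<Rightarrow> complex" and deg :: "'a \<Rightarrow> 'g"
  assumes finG: "finite (carrier G)"
    and act_closed: "\<And>g y. g \<in> carrier G \<Longrightarrow> y \<in> carrier M \<Longrightarrow> rep_act M g y \<in> carrier M"
    and coact_closed: "\<And>g y. g \<in> carrier G \<Longrightarrow> y \<in> carrier M \<Longrightarrow> coact M y g \<in> carrier M"
    and deg: "\<And>a. a \<in> I \<Longrightarrow> deg a \<in> carrier G"
    and \<phi>_coact: "\<And>a y g. a \<in> I \<Longrightarrow> y \<in> carrier M \<Longrightarrow> g \<in> carrier G \<Longrightarrow>
      \<phi> a (coact M y g) = (if g = deg a then \<phi> a y else 0)"
    and \<phi>_act: "\<And>a b y. a \<in> I \<Longrightarrow> b \<in> I \<Longrightarrow> y \<in> carrier M \<Longrightarrow> \<phi> a (rep_act M (deg b) y) = q b a * \<phi> a y"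
begin

text \<open>The coaction selects \<open>g = deg (vs ! Suc i)\<close>, which acts on the coordinate \<open>vs ! i\<close> by the scalar \<open>q\<close>.\<close>

lemma braid_summand:
  assumes "w \<in> lists (carrier M)" "length w = n" "Suc i < n" "set vs \<subseteq> I" "length vs = n"
  shows "(\<Sum>g\<in>carrier G. pairing \<phi> vs (take i w @ [rep_act M g (w ! Suc i), coact M (w ! i) g] @ drop (Suc (Suc i)) w)) =
    q (vs ! Suc i) (vs ! i) * pairing \<phi> (swap_at i vs) w"
proof -
  let ?a = "vs ! i" and ?b = "vs ! Suc i" and ?y = "w ! i" and ?z = "w ! Suc i"
  have ab: "?a \<in> I" "?b \<in> I" using assms by (auto simp: subset_iff)
  have yz: "?y \<in> carrier M" "?z \<in> carrier M" using assms by (auto simp: in_lists_conv_set)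
  let ?P = "pairing \<phi> (take i vs) (take i w)" and ?S = "pairing \<phi> (drop (Suc (Suc i)) vs) (drop (Suc (Suc i)) w)"
  have sp: "pairing \<phi> vs (take i w @ [s, t] @ drop (Suc (Suc i)) w) = ?P * (\<phi> ?a s * \<phi> ?b t * ?S)" for s t
  proof -
    have "vs = take i vs @ [?a, ?b] @ drop (Suc (Suc i)) vs" by (rule split_at) (use assms in simp)
    then have "pairing \<phi> vs (take i w @ [s, t] @ drop (Suc (Suc i)) w) =
        pairing \<phi> (take i vs @ [?a, ?b] @ drop (Suc (Suc i)) vs) (take i w @ [s, t] @ drop (Suc (Suc i)) w)"
      by (rule arg_cong)
    also have "\<dots> = ?P * (\<phi> ?a s * \<phi> ?b t * ?S)" using assms by (simp add: pairing_append)
    finally show ?thesis .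
  qed
  have sw: "pairing \<phi> (swap_at i vs) w = ?P * (\<phi> ?b ?y * \<phi> ?a ?z * ?S)"
  proof -
    have "w = take i w @ [?y, ?z] @ drop (Suc (Suc i)) w" by (rule split_at) (use assms in simp)
    then have "pairing \<phi> (swap_at i vs) w = pairing \<phi> (swap_at i vs) (take i w @ [?y, ?z] @ drop (Suc (Suc i)) w)"
      by (rule arg_cong)
    also have "\<dots> = ?P * (\<phi> ?b ?y * \<phi> ?a ?z * ?S)"
      unfolding swap_at_def using assms by (simp add: pairing_append)
    finally show ?thesis .
  qed
  have "(\<Sum>g\<in>carrier G. pairing \<phi> vs (take i w @ [rep_act M g ?z, coact M ?y g] @ drop (Suc (Suc i)) w)) =
     (\<Sum>g\<in>carrier G. if g = deg ?b then ?P * (\<phi> ?a (rep_act M g ?z) * \<phi> ?b ?y * ?S) else 0)"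
    unfolding sp by (rule sum.cong) (simp_all add: \<phi>_coact ab yz)
  also have "\<dots> = ?P * (\<phi> ?a (rep_act M (deg ?b) ?z) * \<phi> ?b ?y * ?S)"
    using finG deg[OF ab(2)] by (simp add: sum.delta)
  also have "\<dots> = q ?b ?a * pairing \<phi> (swap_at i vs) w"
    unfolding sw \<phi>_act[OF ab yz(2)] by (simp add: mult_ac)
  finally show ?thesis .
qed

definition homog :: "nat \<Rightarrow> ('m list \<Rightarrow> complex) set" where
  "homog n = {f \<in> carrier FA. \<forall>u. f u \<noteq> 0 \<longrightarrow> length u = n}"

lemma homog_sum:
  assumes "finite J" "\<And>a. a \<in> J \<Longrightarrow> f a \<in> homog n"
  shows "(\<lambda>u. \<Sum>a\<in>J. c a * f a u) \<in> homog n"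
proof -
  have "(\<lambda>u. \<Sum>a\<in>J. c a * f a u) \<in> carrier FA"
    by (rule free_submodule_sum[OF free_carrier_submodule assms(1)]) (use assms(2) in \<open>auto simp: homog_def\<close>)
  moreover have "length u = n" if "(\<Sum>a\<in>J. c a * f a u) \<noteq> 0" for u
  proof -
    from that obtain a where "a \<in> J" "c a * f a u \<noteq> 0" using sum.neutral[of J "\<lambda>a. c a * f a u"] by blast
    then show ?thesis using assms(2)[of a] by (auto simp: homog_def)
  qed
  ultimately show ?thesis by (simp add: homog_def)
qed

lemma word_homog: "w \<in> lists (carrier M) \<Longrightarrow> word w \<in> homog (length w)"
  using word_carrier[of w "carrier M"] by (auto simp: homog_def word_def split: if_splits)

lemma homog_finite: "f \<in> homog n \<Longrightarrow> finite {u. f u \<noteq> 0}"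
  by (simp add: homog_def free_algebra_simps)

lemma braid_homog:
  assumes "f \<in> homog n" "Suc i < n"
  shows "braid G M i f \<in> homog n"
    and "set vs \<subseteq> I \<Longrightarrow> length vs = n \<Longrightarrow>
      evalw \<phi> vs (braid G M i f) = q (vs ! Suc i) (vs ! i) * evalw \<phi> (swap_at i vs) f"
proof -
  let ?W = "\<lambda>w g. take i w @ [rep_act M g (w ! Suc i), coact M (w ! i) g] @ drop (Suc (Suc i)) w"
  let ?\<psi> = "\<lambda>w u. \<Sum>g\<in>carrier G. word (?W w g) u"
  have w: "w \<in> lists (carrier M)" "length w = n" if "f w \<noteq> 0" for w
    using assms(1) that by (auto simp: homog_def free_algebra_simps)
  have W: "?W w g \<in> lists (carrier M)" "length (?W w g) = n" if "f w \<noteq> 0" "g \<in> carrier G" for w g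
  proof -
    have "set (take i w) \<subseteq> set w" "set (drop (Suc (Suc i)) w) \<subseteq> set w" by (rule set_take_subset, rule set_drop_subset)
    then show "?W w g \<in> lists (carrier M)"
      using w[OF that(1)] assms(2) act_closed[OF that(2)] coact_closed[OF that(2)] by (auto simp: in_lists_conv_set)
    show "length (?W w g) = n" using w(2)[OF that(1)] assms(2) by simp
  qed
  have psi: "?\<psi> w \<in> homog n" if "f w \<noteq> 0" for w
  proof -
    have "word (?W w g) \<in> homog n" if g: "g \<in> carrier G" for g
      using word_homog[OF W(1)[OF \<open>f w \<noteq> 0\<close> g]] unfolding W(2)[OF \<open>f w \<noteq> 0\<close> g] .
    then have "(\<lambda>u. \<Sum>g\<in>carrier G. 1 * word (?W w g) u) \<in> homog n" by (rule homog_sum[OF finG])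
    then show ?thesis unfolding mult_1 .
  qed
  have fin: "finite {w. f w \<noteq> 0}" by (rule homog_finite) fact
  show "braid G M i f \<in> homog n"
    unfolding braid_def lin_ext_def by (rule homog_sum[OF fin]) (use psi in simp)
  assume vs: "set vs \<subseteq> I" "length vs = n"
  have "evalw \<phi> vs (braid G M i f) = (\<Sum>w | f w \<noteq> 0. f w * evalw \<phi> vs (?\<psi> w))"
    unfolding braid_def by (rule evalw_lin_ext[OF fin], rule homog_finite, rule psi)
  also have "\<dots> = (\<Sum>w | f w \<noteq> 0. f w * (q (vs ! Suc i) (vs ! i) * pairing \<phi> (swap_at i vs) w))"
  proof (rule sum.cong[OF refl])
    fix v assume "v \<in> {w. f w \<noteq> 0}"
    then have fv: "f v \<noteq> 0" by simp
    have "evalw \<phi> vs (?\<psi> v) = (\<Sum>g\<in>carrier G. pairing \<phi> vs (?W v g))"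
      using evalw_sum[where f = "\<lambda>g. word (?W v g)" and J = "carrier G" and c = "\<lambda>_. 1" and \<phi> = \<phi> and vs = vs, OF finG finite_word]
      by (simp only: evalw_word mult_1)
    then show "f v * evalw \<phi> vs (?\<psi> v) = f v * (q (vs ! Suc i) (vs ! i) * pairing \<phi> (swap_at i vs) v)"
      using braid_summand[OF w[OF fv] assms(2) vs] by simp
  qed
  also have "\<dots> = q (vs ! Suc i) (vs ! i) * evalw \<phi> (swap_at i vs) f"
    unfolding evalw_def sum_distrib_left by (rule sum.cong) (simp_all add: mult_ac)
  finally show "evalw \<phi> vs (braid G M i f) = q (vs ! Suc i) (vs ! i) * evalw \<phi> (swap_at i vs) f" .
qed

lemma braids_homog:
  assumes "f \<in> homog n" "set is \<subseteq> {i. Suc i < n}"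
  shows "foldr (braid G M) is f \<in> homog n \<and> (v ` {..<n} \<subseteq> I \<longrightarrow>
    evalw \<phi> (map v [0..<n]) (foldr (braid G M) is f) = braid_weight q is v * evalw \<phi> (map (v \<circ> simple_prod is) [0..<n]) f)"
  using assms(2)
proof (induction "is" arbitrary: v)
  case Nil
  show ?case using assms(1) by (simp add: simple_prod_Nil)
next
  case (Cons i "is")
  have i: "Suc i < n" "set is \<subseteq> {i. Suc i < n}" using Cons.prems by auto
  have h: "foldr (braid G M) is f \<in> homog n" by (rule conjunct1[OF Cons.IH[OF i(2)]])
  have e: "evalw \<phi> (map v [0..<n]) (braid G M i (foldr (braid G M) is f)) =
      braid_weight q (i # is) v * evalw \<phi> (map (v \<circ> simple_prod (i # is)) [0..<n]) f" if v: "v ` {..<n} \<subseteq> I"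
  proof -
    have vs: "set (map v [0..<n]) \<subseteq> I" "length (map v [0..<n]) = n" using v by (auto simp: atLeast0LessThan)
    have nth: "map v [0..<n] ! Suc i = v (Suc i)" "map v [0..<n] ! i = v i" using i by auto
    have "(v \<circ> swp i) ` {..<n} = v ` {..<n}" unfolding image_comp[symmetric] permutes_image[OF swp_permutes[OF i(1)]] ..
    then have sub: "(v \<circ> swp i) ` {..<n} \<subseteq> I" using v by (simp only:)
    have ih: "evalw \<phi> (map (v \<circ> swp i) [0..<n]) (foldr (braid G M) is f) =
      braid_weight q is (v \<circ> swp i) * evalw \<phi> (map (v \<circ> swp i \<circ> simple_prod is) [0..<n]) f"
      by (rule mp[OF conjunct2[OF Cons.IH[OF i(2), of "v \<circ> swp i"]] sub])
    show ?thesis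
      unfolding braid_homog(2)[OF h i(1) vs] nth swap_at_map[OF i(1)] ih braid_weight.simps simple_prod_Cons o_assoc mult.assoc ..
  qed
  have fc: "foldr (braid G M) (i # is) f = braid G M i (foldr (braid G M) is f)" by simp
  show ?case unfolding fc using braid_homog(1)[OF h i(1)] e by (intro conjI impI)
qed

lemma symmetrizer_homog:
  assumes "f \<in> homog n"
  shows "quantum_symmetrizer G M n f \<in> homog n"
    and "v ` {..<n} \<subseteq> I \<Longrightarrow> evalw \<phi> (map v [0..<n]) (quantum_symmetrizer G M n f) =
      (\<Sum>\<pi> | \<pi> permutes {..<n}. inv_prod q v (plist n \<pi>) * evalw \<phi> (map v (plist n \<pi>)) f)"
proof -
  let ?P = "{\<pi>. \<pi> permutes {..<n}}"
  have fin: "finite ?P" by (simp add: finite_permutations)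
  have lift: "braid_lift G M n \<pi> f \<in> homog n \<and> (v ` {..<n} \<subseteq> I \<longrightarrow>
      evalw \<phi> (map v [0..<n]) (braid_lift G M n \<pi> f) = inv_prod q v (plist n \<pi>) * evalw \<phi> (map v (plist n \<pi>)) f)"
    if "\<pi> \<in> ?P" for \<pi> v
  proof -
    let ?is = "SOME is. reduced_expr n is \<pi>"
    have r: "reduced_expr n ?is \<pi>" by (rule reduced_exists) (use that in simp)
    then have r1: "set ?is \<subseteq> {i. Suc i < n}" and r2: "simple_prod ?is = \<pi>" unfolding reduced_expr_def by blast+
    have m: "map (v \<circ> \<pi>) [0..<n] = map v (plist n \<pi>)" by (simp add: plist_def)
    from braids_homog[OF assms r1, of v] show ?thesis
      unfolding braid_lift_def r2 m braid_weight_reduced[OF r] .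
  qed
  have qs: "quantum_symmetrizer G M n f = (\<lambda>u. \<Sum>\<pi>\<in>?P. 1 * braid_lift G M n \<pi> f u)"
    by (simp add: quantum_symmetrizer_def)
  show "quantum_symmetrizer G M n f \<in> homog n" unfolding qs by (rule homog_sum[OF fin], rule conjunct1[OF lift])
  assume v: "v ` {..<n} \<subseteq> I"
  have "evalw \<phi> (map v [0..<n]) (quantum_symmetrizer G M n f) = (\<Sum>\<pi>\<in>?P. 1 * evalw \<phi> (map v [0..<n]) (braid_lift G M n \<pi> f))"
    unfolding qs by (rule evalw_sum[OF fin], rule homog_finite, rule conjunct1[OF lift])
  also have "\<dots> = (\<Sum>\<pi>\<in>?P. inv_prod q v (plist n \<pi>) * evalw \<phi> (map v (plist n \<pi>)) f)"
    by (rule sum.cong[OF refl]) (use lift[of _ v] v in simp)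
  finally show "evalw \<phi> (map v [0..<n]) (quantum_symmetrizer G M n f) =
      (\<Sum>\<pi> | \<pi> permutes {..<n}. inv_prod q v (plist n \<pi>) * evalw \<phi> (map v (plist n \<pi>)) f)" .
qed

lemma degree_part_homog: "f \<in> carrier FA \<Longrightarrow> degree_part n f \<in> homog n"
proof -
  assume f: "f \<in> carrier FA"
  have "{w. degree_part n f w \<noteq> 0} \<subseteq> {w. f w \<noteq> 0}" by (auto simp: degree_part_def split: if_splits)
  then show ?thesis using f unfolding homog_def free_algebra_simps
    by (auto simp: degree_part_def intro: finite_subset split: if_splits)
qed

lemma evalw_degree_part:
  assumes "f \<in> carrier FA"
  shows "evalw \<phi> vs (degree_part (length vs) f) = evalw \<phi> vs f"
proof -
  have fin: "finite {u. f u \<noteq> 0}" using assms by (simp add: free_algebra_simps)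
  have "{u. degree_part (length vs) f u \<noteq> 0} \<subseteq> {u. f u \<noteq> 0}" by (auto simp: degree_part_def split: if_splits)
  then have "evalw \<phi> vs (degree_part (length vs) f) = (\<Sum>u | f u \<noteq> 0. degree_part (length vs) f u * pairing \<phi> vs u)"
    by (rule evalw_superset[OF fin])
  also have "\<dots> = evalw \<phi> vs f"
    unfolding evalw_def by (rule sum.cong) (auto simp: degree_part_def pairing_length)
  finally show ?thesis .
qed

definition symmetrized :: "nat \<Rightarrow> (nat \<Rightarrow> 'a) \<Rightarrow> ('m list \<Rightarrow> complex) \<Rightarrow> complex" where
  "symmetrized n v f = (\<Sum>\<pi> | \<pi> permutes {..<n}. inv_prod q v (plist n \<pi>) * evalw \<phi> (map v (plist n \<pi>)) f)"

text \<open>By \<open>evalw_TR\<close> and \<open>kernel_TR\<close> an element of the free algebra is zero in the tensor algebra exactly when all its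
  coordinates are zero; the coordinates of a symmetrized element are the sums \<open>symmetrized\<close>.\<close>

lemma nichols_ideal_iff:
  "f \<in> nichols_ideal G M \<longleftrightarrow> f \<in> carrier FA \<and> (\<forall>n v. v ` {..<n} \<subseteq> I \<longrightarrow> symmetrized n v f = 0)"
proof -
  have "quantum_symmetrizer G M n (degree_part n f) \<in> TR \<longleftrightarrow> (\<forall>v. v ` {..<n} \<subseteq> I \<longrightarrow> symmetrized n v f = 0)"
    if f: "f \<in> carrier FA" for n
  proof -
    have h: "degree_part n f \<in> homog n" by (rule degree_part_homog[OF f])
    have "evalw \<phi> (map v (plist n \<pi>)) (degree_part n f) = evalw \<phi> (map v (plist n \<pi>)) f" for v \<pi>
      using evalw_degree_part[OF f, of "map v (plist n \<pi>)"] by (simp add: plist_def)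
    then have e: "v ` {..<n} \<subseteq> I \<Longrightarrow> evalw \<phi> (map v [0..<n]) (quantum_symmetrizer G M n (degree_part n f)) = symmetrized n v f" for v
      unfolding symmetrizer_homog(2)[OF h] symmetrized_def by simp
    show ?thesis
    proof
      assume t: "quantum_symmetrizer G M n (degree_part n f) \<in> TR"
      show "\<forall>v. v ` {..<n} \<subseteq> I \<longrightarrow> symmetrized n v f = 0"
      proof (intro allI impI)
        fix v assume v: "v ` {..<n} \<subseteq> I"
        then have "set (map v [0..<n]) \<subseteq> I" by (auto simp: atLeast0LessThan)
        from evalw_TR[OF t this] e[OF v] show "symmetrized n v f = 0" by simp
      qed
    next
      assume z: "\<forall>v. v ` {..<n} \<subseteq> I \<longrightarrow> symmetrized n v f = 0"
      show "quantum_symmetrizer G M n (degree_part n f) \<in> TR"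
      proof (rule kernel_TR)
        show "quantum_symmetrizer G M n (degree_part n f) \<in> carrier FA"
          "\<And>u. quantum_symmetrizer G M n (degree_part n f) u \<noteq> 0 \<Longrightarrow> length u = n"
          using symmetrizer_homog(1)[OF h] by (auto simp: homog_def)
        fix vs assume vs: "vs \<in> words_of n"
        then have m: "vs = map (\<lambda>k. vs ! k) [0..<n]" unfolding words_of_def using map_nth[of vs] by auto
        have s: "(\<lambda>k. vs ! k) ` {..<n} \<subseteq> I" using vs unfolding words_of_def by (auto simp: subset_iff)
        show "evalw \<phi> vs (quantum_symmetrizer G M n (degree_part n f)) = 0"
          by (subst m) (use e[OF s] z s in simp)
      qed
    qed
  qed
  then show ?thesis unfolding nichols_ideal_def by blast
qed

lemma symmetrized_linear:
  assumes "f \<in> carrier FA" "g \<in> carrier FA"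
  shows "symmetrized n v (\<lambda>t. f t + g t) = symmetrized n v f + symmetrized n v g"
    and "symmetrized n v (\<lambda>t. c * f t) = c * symmetrized n v f"
proof -
  have fin: "finite {u. f u \<noteq> 0}" "finite {u. g u \<noteq> 0}" using assms by (auto simp: free_algebra_simps)
  show "symmetrized n v (\<lambda>t. f t + g t) = symmetrized n v f + symmetrized n v g"
    unfolding symmetrized_def evalw_add[OF fin] by (simp add: distrib_left sum.distrib)
  show "symmetrized n v (\<lambda>t. c * f t) = c * symmetrized n v f"
    unfolding symmetrized_def evalw_smult[OF fin(1)] sum_distrib_left by (simp add: mult_ac)
qed

lemma nichols_ideal_submodule: "submodule CC (nichols_ideal G M) FA"
proof (rule submoduleI_CC[OF free_vectorspace])
  show "nichols_ideal G M \<subseteq> carrier FA" by (auto simp: nichols_ideal_def)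
  show "\<zero>\<^bsub>FA\<^esub> \<in> nichols_ideal G M"
    unfolding nichols_ideal_iff using vs_zero[OF free_vectorspace[of "carrier M"]]
    by (auto simp: free_algebra_simps(2) symmetrized_def evalw_def)
  show "f \<oplus>\<^bsub>FA\<^esub> g \<in> nichols_ideal G M" if "f \<in> nichols_ideal G M" "g \<in> nichols_ideal G M" for f g
    using that symmetrized_linear(1)[of f g] free_carrier_add[of f "carrier M" g] unfolding nichols_ideal_iff free_algebra_simps(3) by simp
  show "c \<odot>\<^bsub>FA\<^esub> f \<in> nichols_ideal G M" if "f \<in> nichols_ideal G M" for c f
    using that symmetrized_linear(2)[of f f] free_carrier_smult[of f "carrier M" c] unfolding nichols_ideal_iff free_algebra_simps(4) by simp
qed

lemma TR_subset_ideal: "TR \<subseteq> nichols_ideal G M"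
proof
  fix f assume f: "f \<in> TR"
  have "f \<in> carrier FA" using f TR_closed(1) by blast
  moreover have "symmetrized n v f = 0" if v: "v ` {..<n} \<subseteq> I" for n v
    unfolding symmetrized_def
  proof (rule sum.neutral, rule ballI)
    fix \<pi> assume "\<pi> \<in> {\<pi>. \<pi> permutes {..<n}}"
    then have "set (map v (plist n \<pi>)) \<subseteq> I" using plist_permutes(2)[of \<pi> n] v by auto
    then show "inv_prod q v (plist n \<pi>) * evalw \<phi> (map v (plist n \<pi>)) f = 0" using evalw_TR[OF f] by simp
  qed
  ultimately show "f \<in> nichols_ideal G M" unfolding nichols_ideal_iff by blast
qed

lemma nichols_vectorspace: "vectorspace CC (nichols_algebra G M)"
  unfolding nichols_algebra_def by (rule quot_vectorspace[OF free_vectorspace nichols_ideal_submodule])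

lemma symmetrized_other_degree:
  assumes "f \<in> carrier FA" "\<And>u. length u = n \<Longrightarrow> f u = 0"
  shows "symmetrized n v f = 0"
  unfolding symmetrized_def
proof (rule sum.neutral, rule ballI)
  fix \<pi>
  have "f u * pairing \<phi> (map v (plist n \<pi>)) u = 0" for u
    using assms(2)[of u] pairing_length[of "map v (plist n \<pi>)" u \<phi>] by (cases "length u = n") (auto simp: plist_def)
  then show "inv_prod q v (plist n \<pi>) * evalw \<phi> (map v (plist n \<pi>)) f = 0" unfolding evalw_def by simp
qed

text \<open>A finite-dimensional quotient is spanned by classes of elements of degree at most some \<open>D\<close>.  A word longer
  than \<open>D\<close> is then congruent to an element without components of its own degree, so, the ideal being
  graded, it belongs to the ideal.\<close>

lemma nichols_infinite:
  assumes "\<And>N. \<exists>w\<in>lists (carrier M). length w \<ge> N \<and> word w \<notin> nichols_ideal G M"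
  shows "\<not> vectorspace.fin_dim CC (nichols_algebra G M)"
proof
  let ?N = "nichols_ideal G M"
  let ?Q = "nichols_algebra G M"
  note N = nichols_ideal_submodule
  note FV = free_vectorspace[of "carrier M"]
  assume "vectorspace.fin_dim CC ?Q"
  then obtain S where S: "finite S" "S \<subseteq> carrier ?Q" "lin_span ?Q S = carrier ?Q"
    unfolding fin_dim_iff[OF nichols_vectorspace] by blast
  have Q: "carrier ?Q = coset FA ?N ` carrier FA" unfolding nichols_algebra_def by (rule quot_carrier[OF FV N])
  have "\<exists>r. \<forall>s\<in>S. r s \<in> carrier FA \<and> s = coset FA ?N (r s)" using S(2) unfolding Q by (intro bchoice) blast
  then obtain r where r: "\<And>s. s \<in> S \<Longrightarrow> r s \<in> carrier FA" "\<And>s. s \<in> S \<Longrightarrow> s = coset FA ?N (r s)" by blast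
  define U where "U = (\<Union>s\<in>S. {u. r s u \<noteq> 0})"
  have "finite U" unfolding U_def using S(1) r(1) by (auto simp: free_algebra_simps)
  \<comment> \<open>A bound for the degrees of representatives of a finite spanning set.\<close>
  define D where "D = Max (length ` U)"
  have D: "length u \<le> D" if "s \<in> S" "r s u \<noteq> 0" for s u
    unfolding D_def by (rule Max_ge) (use \<open>finite U\<close> that in \<open>auto simp: U_def\<close>)
  define T where "T = {X. \<exists>f\<in>carrier FA. X = coset FA ?N f \<and> (\<forall>u. f u \<noteq> 0 \<longrightarrow> length u \<le> D)}"
  have T: "submodule CC T ?Q"
  proof (rule submoduleI_CC[OF nichols_vectorspace])
    show "T \<subseteq> carrier ?Q" unfolding T_def Q by blast
    have z: "\<zero>\<^bsub>FA\<^esub> \<in> ?N" by (rule submoduleD_CC(2)[OF N])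
    have "\<zero>\<^bsub>?Q\<^esub> = coset FA ?N \<zero>\<^bsub>FA\<^esub>" unfolding nichols_algebra_def quot_zero[OF FV N] coset_zero[OF FV N z] ..
    then show "\<zero>\<^bsub>?Q\<^esub> \<in> T" unfolding T_def using vs_zero[OF FV] by (auto simp: free_algebra_simps(2) intro!: bexI[of _ "\<lambda>_. 0"])
  next
    fix X Y assume "X \<in> T" "Y \<in> T"
    then obtain f g where f: "f \<in> carrier FA" "X = coset FA ?N f" "\<And>u. f u \<noteq> 0 \<Longrightarrow> length u \<le> D"
      and g: "g \<in> carrier FA" "Y = coset FA ?N g" "\<And>u. g u \<noteq> 0 \<Longrightarrow> length u \<le> D" unfolding T_def by blast
    have "X \<oplus>\<^bsub>?Q\<^esub> Y = coset FA ?N (f \<oplus>\<^bsub>FA\<^esub> g)" unfolding f(2) g(2) nichols_algebra_def by (rule quot_add[OF FV N f(1) g(1)])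
    moreover have "f \<oplus>\<^bsub>FA\<^esub> g \<in> carrier FA" by (rule vs_add[OF FV f(1) g(1)])
    moreover have "length u \<le> D" if "(f \<oplus>\<^bsub>FA\<^esub> g) u \<noteq> 0" for u using that f(3)[of u] g(3)[of u] by (cases "f u = 0") (simp_all add: free_algebra_simps(3))
    ultimately show "X \<oplus>\<^bsub>?Q\<^esub> Y \<in> T" unfolding T_def by blast
  next
    fix c X assume "X \<in> T"
    then obtain f where f: "f \<in> carrier FA" "X = coset FA ?N f" "\<And>u. f u \<noteq> 0 \<Longrightarrow> length u \<le> D" unfolding T_def by blast
    have "c \<odot>\<^bsub>?Q\<^esub> X = coset FA ?N (c \<odot>\<^bsub>FA\<^esub> f)" unfolding f(2) nichols_algebra_def by (rule quot_smult[OF FV N f(1)])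
    moreover have "c \<odot>\<^bsub>FA\<^esub> f \<in> carrier FA" by (rule vs_smult[OF FV f(1)])
    moreover have "length u \<le> D" if "(c \<odot>\<^bsub>FA\<^esub> f) u \<noteq> 0" for u using that f(3)[of u] by (simp add: free_algebra_simps(4))
    ultimately show "c \<odot>\<^bsub>?Q\<^esub> X \<in> T" unfolding T_def by blast
  qed
  have "S \<subseteq> T" unfolding T_def using r D by blast
  then have CT: "carrier ?Q \<subseteq> T" using lin_span_least[OF nichols_vectorspace S(2) _ T] S(3) by blast
  obtain w where w: "w \<in> lists (carrier M)" "length w \<ge> Suc D" "word w \<notin> ?N" using assms by blast
  have wc: "word w \<in> carrier FA" by (rule word_carrier[OF w(1)])
  then have "coset FA ?N (word w) \<in> T" using CT Q by blast
  then obtain f where f: "f \<in> carrier FA" "coset FA ?N (word w) = coset FA ?N f" "\<And>u. f u \<noteq> 0 \<Longrightarrow> length u \<le> D" unfolding T_def by blast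
  from coset_eqD[OF FV N f(2) wc] obtain k where k: "k \<in> ?N" "word w = (\<lambda>t. k t + f t)" unfolding free_algebra_simps(3) by blast
  have kc: "k \<in> carrier FA" using k(1) submoduleD_CC(1)[OF N] by blast
  have "symmetrized n v (word w) = 0" if v: "v ` {..<n} \<subseteq> I" for n v
  proof (cases "n = length w")
    case True
    have "f u = 0" if "length u = n" for u using f(3)[of u] that True w(2) by auto
    then have "symmetrized n v f = 0" by (rule symmetrized_other_degree[OF f(1)])
    moreover have "symmetrized n v k = 0" using k(1) v unfolding nichols_ideal_iff by blast
    ultimately show ?thesis unfolding k(2) symmetrized_linear(1)[OF kc f(1)] by simp
  next
    case False
    then show ?thesis by (intro symmetrized_other_degree[OF wc]) (auto simp: word_def)
  qed
  then have "word w \<in> ?N" unfolding nichols_ideal_iff using wc by blast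
  then show False using w(3) by simp
qed

text \<open>The quotient is spanned by words of bounded length in the finitely many frame vectors.\<close>

lemma nichols_finite:
  assumes "\<And>w. w \<in> lists (carrier M) \<Longrightarrow> length w > D \<Longrightarrow> word w \<in> nichols_ideal G M"
  shows "vectorspace.fin_dim CC (nichols_algebra G M)"
proof -
  let ?N = "nichols_ideal G M"
  let ?Q = "nichols_algebra G M"
  note N = nichols_ideal_submodule
  note FV = free_vectorspace[of "carrier M"]
  define S where "S = (\<lambda>vs. coset FA ?N (word (map x vs))) ` (\<Union>n\<le>D. words_of n)"
  have Q: "carrier ?Q = coset FA ?N ` carrier FA" unfolding nichols_algebra_def by (rule quot_carrier[OF FV N])
  have mx: "map x vs \<in> lists (carrier M)" if "vs \<in> words_of n" for vs n
    using that x_closed by (auto simp: words_of_def in_lists_conv_set)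
  have S: "finite S" unfolding S_def by (intro finite_imageI finite_UN_I finite_words_of) simp
  have SC: "S \<subseteq> carrier ?Q"
    unfolding S_def Q by (rule image_subsetI, rule imageI, rule word_carrier) (use mx in blast)
  note SP = lin_span_submodule[OF nichols_vectorspace SC]
  define W where "W = {f \<in> carrier FA. coset FA ?N f \<in> lin_span ?Q S}"
  have NW: "?N \<subseteq> W"
  proof
    fix f assume f: "f \<in> ?N"
    have "coset FA ?N f = \<zero>\<^bsub>?Q\<^esub>" unfolding nichols_algebra_def quot_zero[OF FV N] by (rule coset_zero[OF FV N f])
    then have "coset FA ?N f \<in> lin_span ?Q S" using submoduleD_CC(2)[OF SP] by (simp only:)
    then show "f \<in> W" unfolding W_def using f submoduleD_CC(1)[OF N] by blast
  qed
  have W: "submodule CC W FA"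
  proof (rule submoduleI_CC[OF FV])
    show "W \<subseteq> carrier FA" unfolding W_def by blast
    show "\<zero>\<^bsub>FA\<^esub> \<in> W" using NW submoduleD_CC(2)[OF N] by blast
    show "f \<oplus>\<^bsub>FA\<^esub> g \<in> W" if "f \<in> W" "g \<in> W" for f g
    proof -
      have fg: "f \<in> carrier FA" "g \<in> carrier FA" "coset FA ?N f \<in> lin_span ?Q S" "coset FA ?N g \<in> lin_span ?Q S"
        using that unfolding W_def by auto
      from submoduleD_CC(3)[OF SP fg(3,4)] have "coset FA ?N (f \<oplus>\<^bsub>FA\<^esub> g) \<in> lin_span ?Q S"
        unfolding nichols_algebra_def quot_add[OF FV N fg(1,2)] .
      then show ?thesis unfolding W_def using vs_add[OF FV fg(1,2)] by blast
    qed
    show "c \<odot>\<^bsub>FA\<^esub> f \<in> W" if "f \<in> W" for c f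
    proof -
      have fg: "f \<in> carrier FA" "coset FA ?N f \<in> lin_span ?Q S" using that unfolding W_def by auto
      from submoduleD_CC(4)[OF SP fg(2)] have "coset FA ?N (c \<odot>\<^bsub>FA\<^esub> f) \<in> lin_span ?Q S"
        unfolding nichols_algebra_def quot_smult[OF FV N fg(1)] .
      then show ?thesis unfolding W_def using vs_smult[OF FV fg(1)] by blast
    qed
  qed
  have word_W: "word u \<in> W" if u: "u \<in> lists (carrier M)" for u
  proof (cases "length u > D")
    case True
    then show ?thesis using assms[OF u] NW by blast
  next
    case False
    have 1: "(\<lambda>t. word ([] @ u) t - expand_word u [] t) \<in> W" by (rule subsetD[OF NW subsetD[OF TR_subset_ideal expand_word_TR[OF u]]]) simp
    have "word (map x vs) \<in> W" if "vs \<in> words_of (length u)" for vs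
    proof -
      have "coset FA ?N (word (map x vs)) \<in> S" unfolding S_def using that False by (intro imageI) auto
      then show ?thesis unfolding W_def using lin_span_superset[OF nichols_vectorspace SC] word_carrier[OF mx[OF that]] by blast
    qed
    then have "(\<lambda>t. \<Sum>vs\<in>words_of (length u). pairing \<phi> vs u * word (map x vs) t) \<in> W"
      by (rule free_submodule_sum[OF W finite_words_of])
    from free_submoduleD(3)[OF W 1 this] show ?thesis unfolding expand_word_sum append_Nil diff_add_cancel .
  qed
  have "f \<in> W" if f: "f \<in> carrier FA" for f
  proof -
    have fin: "finite {u. f u \<noteq> 0}" and sub: "{u. f u \<noteq> 0} \<subseteq> lists (carrier M)"
      using f by (auto simp: free_algebra_simps)
    have "(\<lambda>t. \<Sum>u\<in>{u. f u \<noteq> 0}. f u * word u t) \<in> W"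
      by (rule free_submodule_sum[OF W fin], rule word_W, rule subsetD[OF sub])
    moreover have "(\<lambda>t. \<Sum>u\<in>{u. f u \<noteq> 0}. f u * word u t) = f" by (rule ext, rule free_expand[OF f, symmetric])
    ultimately show ?thesis by (simp only:)
  qed
  then have "carrier ?Q \<subseteq> lin_span ?Q S" unfolding Q W_def by blast
  then have "lin_span ?Q S = carrier ?Q" using submoduleD_CC(1)[OF SP] by blast
  then show ?thesis unfolding fin_dim_iff[OF nichols_vectorspace] using S SC by blast
qed

text \<open>A word longer than the number of coordinates repeats a coordinate, and then \<open>nichols_word_repeated\<close> makes its
  symmetrization vanish: the algebra is a quotient of a quantum exterior algebra.\<close>

theorem finite_if_disconnected:
  assumes "sign_matrix q" "\<And>a b. \<not> adjacent q a b"
  shows "vectorspace.fin_dim CC (nichols_algebra G M)"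
proof (rule nichols_finite[of "card I"])
  fix w assume w: "w \<in> lists (carrier M)" "length w > card I"
  have wc: "word w \<in> carrier FA" by (rule word_carrier[OF w(1)])
  have "symmetrized n v (word w) = 0" if v: "v ` {..<n} \<subseteq> I" for n v
  proof (cases "n = length w")
    case True
    have nd: "\<not> distinct (map v [0..<n])"
    proof
      assume "distinct (map v [0..<n])"
      from distinct_card[OF this] have c: "card (set (map v [0..<n])) = n" by simp
      have "set (map v [0..<n]) \<subseteq> I" using v by (auto simp: atLeast0LessThan)
      from card_mono[OF finI this] show False unfolding c using w(2) True by simp
    qed
    have "nichols_word q u (map v [0..<n]) = 0" for u
    proof (rule ccontr)
      assume nz: "nichols_word q u (map v [0..<n]) \<noteq> 0"
      have "\<not> distinct u"
      proof
        assume "distinct u"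
        from distinct_card[OF this] have "card (set (map v [0..<n])) = length (map v [0..<n])"
          unfolding hw_word_letters[OF nz] .
        then show False using nd card_distinct by blast
      qed
      from nichols_word_repeated[OF assms this] nz show False by (simp add: pointwise)
    qed
    from symmetrizer_vanishes[of q v n "\<lambda>u. evalw \<phi> u (word w)", OF this] show ?thesis unfolding symmetrized_def .
  next
    case False
    then show ?thesis by (intro symmetrized_other_degree[OF wc]) (auto simp: word_def)
  qed
  then show "word w \<in> nichols_ideal G M" unfolding nichols_ideal_iff using wc by blast
qed

text \<open>On words in the vectors \<open>y j\<close>, the coordinates \<open>idx j\<close> of the symmetrizer are the numbers \<open>nichols_word q'\<close>, because the
  chosen vectors and coordinates are dual to each other.\<close>

theorem infinite_if_subdiagram:
  fixes idx :: "nat \<Rightarrow> 'a" and y :: "nat \<Rightarrow> 'm"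
  assumes idx: "\<And>j. j < m \<Longrightarrow> idx j \<in> I" and y: "\<And>j. j < m \<Longrightarrow> y j \<in> carrier M"
    and dual: "\<And>i j. i < m \<Longrightarrow> j < m \<Longrightarrow> \<phi> (idx i) (y j) = (if i = j then 1 else 0)"
    and q': "\<And>i j. i < m \<Longrightarrow> j < m \<Longrightarrow> q (idx i) (idx j) = q' i j"
    and nz: "\<And>N. \<exists>w v. set w \<subseteq> {..<m} \<and> set v \<subseteq> {..<m} \<and> length w \<ge> N \<and> length v = length w \<and> nichols_word q' w v \<noteq> 0"
  shows "\<not> vectorspace.fin_dim CC (nichols_algebra G M)"
proof (rule nichols_infinite)
  fix N
  obtain w v where wv: "set w \<subseteq> {..<m}" "set v \<subseteq> {..<m}" "length w \<ge> N" "length v = length w" "nichols_word q' w v \<noteq> 0"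
    using nz by blast
  let ?n = "length w"
  let ?v = "\<lambda>k. idx (v ! k)"
  have vk: "v ! k < m" if "k < ?n" for k proof -
    have "v ! k \<in> set v" using that wv(4) by (intro nth_mem) simp
    then show ?thesis using wv(2) by blast
  qed
  have pr: "pairing \<phi> (map idx u) (map y w) = (if u = w then 1 else 0)" if "set u \<subseteq> {..<m}" "length u = length w" for u
    using that(2,1) wv(1) by (induction u w rule: list_induct2) (auto simp: dual)
  have "symmetrized ?n ?v (word (map y w)) = nichols_word q' w v"
  proof -
    have "symmetrized ?n ?v (word (map y w)) =
      (\<Sum>\<pi> | \<pi> permutes {..<?n}. inv_prod q' (\<lambda>k. v ! k) (plist ?n \<pi>) * (if map (\<lambda>k. v ! k) (plist ?n \<pi>) = w then 1 else 0))"
      unfolding symmetrized_def evalw_word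
    proof (rule sum.cong[OF refl])
      fix \<pi> assume "\<pi> \<in> {\<pi>. \<pi> permutes {..<?n}}"
      then have s: "set (plist ?n \<pi>) = {..<?n}" using plist_permutes(2) by blast
      have "inv_prod q ?v (plist ?n \<pi>) = inv_prod q' (\<lambda>k. v ! k) (plist ?n \<pi>)"
        by (rule inv_prod_cong, rule q') (use s vk in auto)
      moreover have "pairing \<phi> (map idx (map (\<lambda>k. v ! k) (plist ?n \<pi>))) (map y w) =
         (if map (\<lambda>k. v ! k) (plist ?n \<pi>) = w then 1 else 0)"
      proof (rule pr)
        show "set (map (\<lambda>k. v ! k) (plist ?n \<pi>)) \<subseteq> {..<m}" using s vk by auto
        show "length (map (\<lambda>k. v ! k) (plist ?n \<pi>)) = length w" by (simp add: plist_def)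
      qed
      ultimately show "inv_prod q ?v (plist ?n \<pi>) * pairing \<phi> (map ?v (plist ?n \<pi>)) (map y w) =
        inv_prod q' (\<lambda>k. v ! k) (plist ?n \<pi>) * (if map (\<lambda>k. v ! k) (plist ?n \<pi>) = w then 1 else 0)"
        by (simp add: comp_def)
    qed
    also have "\<dots> = nichols_word q' w (map (\<lambda>k. v ! k) [0..<?n])" by (rule symmetrizer_nichols_word)
    also have "map (\<lambda>k. v ! k) [0..<?n] = v" using wv(4) map_nth[of v] by simp
    finally show ?thesis .
  qed
  then have "symmetrized ?n ?v (word (map y w)) \<noteq> 0" using wv(5) by simp
  moreover have "?v ` {..<?n} \<subseteq> I" using vk idx by auto
  ultimately have "word (map y w) \<notin> nichols_ideal G M" unfolding nichols_ideal_iff by blast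
  moreover have "map y w \<in> lists (carrier M)" using y wv(1) by (auto simp: in_lists_conv_set)
  ultimately show "\<exists>w\<in>lists (carrier M). length w \<ge> N \<and> word w \<notin> nichols_ideal G M"
    using wv(3) by (intro bexI[of _ "map y w"]) auto
qed

end

section \<open>Separating functionals and frames\<close>

definition linear_functional :: "(complex, 'v, 'c) module_scheme \<Rightarrow> ('v \<Rightarrow> complex) \<Rightarrow> bool" where
  "linear_functional V \<psi> \<longleftrightarrow> (\<forall>y\<in>carrier V. \<forall>z\<in>carrier V. \<psi> (y \<oplus>\<^bsub>V\<^esub> z) = \<psi> y + \<psi> z) \<and>
     (\<forall>c. \<forall>y\<in>carrier V. \<psi> (c \<odot>\<^bsub>V\<^esub> y) = c * \<psi> y)"

lemma linear_functionalD:
  assumes "linear_functional V \<psi>"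
  shows "\<And>y z. y \<in> carrier V \<Longrightarrow> z \<in> carrier V \<Longrightarrow> \<psi> (y \<oplus>\<^bsub>V\<^esub> z) = \<psi> y + \<psi> z"
    "\<And>c y. y \<in> carrier V \<Longrightarrow> \<psi> (c \<odot>\<^bsub>V\<^esub> y) = c * \<psi> y"
  using assms unfolding linear_functional_def by auto

lemma linear_functional_zero:
  assumes "vectorspace CC V" "linear_functional V \<psi>"
  shows "\<psi> \<zero>\<^bsub>V\<^esub> = 0"
  using linear_functionalD(2)[OF assms(2) vs_zero[OF assms(1)], of 0] vs_smult_zero[OF assms(1), of 0] by simp

definition separating :: "(complex, 'v, 'c) module_scheme \<Rightarrow> 'j set \<Rightarrow> ('j \<Rightarrow> 'v \<Rightarrow> complex) \<Rightarrow> bool" where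
  "separating V J \<psi> \<longleftrightarrow> finite J \<and> (\<forall>j\<in>J. linear_functional V (\<psi> j)) \<and>
     (\<forall>y\<in>carrier V. (\<forall>j\<in>J. \<psi> j y = 0) \<longrightarrow> y = \<zero>\<^bsub>V\<^esub>)"

text \<open>Induction on the family: the frame of the smaller family on the kernel of \<open>\<phi> a\<close> extends by one vector: by
  \<open>u\<close> with \<open>\<phi> a u = 1\<close> minus the expansion of \<open>u\<close> in the smaller frame, or by \<open>0\<close> if \<open>\<phi> a\<close> vanishes on \<open>U\<close>.\<close>

lemma frame_aux:
  assumes V: "vectorspace CC (V :: (complex, 'v, 'c) module_scheme)" and "finite I"
    "\<And>a. a \<in> I \<Longrightarrow> linear_functional V (\<phi> a)" "submodule CC U V"
    "\<And>y. y \<in> U \<Longrightarrow> (\<forall>a\<in>I. \<phi> a y = 0) \<Longrightarrow> y = \<zero>\<^bsub>V\<^esub>"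
  shows "\<exists>x. (\<forall>a\<in>I. x a \<in> U) \<and> (\<forall>y\<in>U. finsum V (\<lambda>a. \<phi> a y \<odot>\<^bsub>V\<^esub> x a) I = y)"
  using assms(2-)
proof (induction I arbitrary: U)
  interpret v: abelian_group V by (rule vs_abelian[OF V])
  case empty
  then have "\<forall>y\<in>U. y = \<zero>\<^bsub>V\<^esub>" by simp
  then show ?case by auto
next
  interpret v: abelian_group V by (rule vs_abelian[OF V])
  interpret vm: Module.module CC V by (rule vs_module[OF V])
  case (insert a I)
  note U = submoduleD_CC[OF insert.prems(2)]
  have Uc: "y \<in> carrier V" if "y \<in> U" for y using that U(1) by blast
  have la: "linear_functional V (\<phi> a)" and lI: "\<And>b. b \<in> I \<Longrightarrow> linear_functional V (\<phi> b)" using insert.prems(1) by auto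
  define U' where "U' = {y \<in> U. \<phi> a y = 0}"
  have U': "submodule CC U' V"
  proof (rule submoduleI_CC[OF V])
    show "U' \<subseteq> carrier V" unfolding U'_def using U(1) by blast
    show "\<zero>\<^bsub>V\<^esub> \<in> U'" unfolding U'_def using U(2) linear_functional_zero[OF V la] by simp
    show "y \<oplus>\<^bsub>V\<^esub> z \<in> U'" if "y \<in> U'" "z \<in> U'" for y z
      using that U(3) Uc linear_functionalD(1)[OF la] unfolding U'_def by simp
    show "c \<odot>\<^bsub>V\<^esub> y \<in> U'" if "y \<in> U'" for c y
      using that U(4) Uc linear_functionalD(2)[OF la] unfolding U'_def by simp
  qed
  have "\<exists>x. (\<forall>b\<in>I. x b \<in> U') \<and> (\<forall>y\<in>U'. finsum V (\<lambda>b. \<phi> b y \<odot>\<^bsub>V\<^esub> x b) I = y)"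
    by (rule insert.IH[OF _ U']) (use insert.prems(3) lI in \<open>auto simp: U'_def\<close>)
  then obtain x where x: "\<And>b. b \<in> I \<Longrightarrow> x b \<in> U'" "\<And>y. y \<in> U' \<Longrightarrow> finsum V (\<lambda>b. \<phi> b y \<odot>\<^bsub>V\<^esub> x b) I = y" by blast
  have xc: "x b \<in> carrier V" "x b \<in> U" if "b \<in> I" for b using x(1)[OF that] Uc unfolding U'_def by auto
  define F where "F y = finsum V (\<lambda>b. \<phi> b y \<odot>\<^bsub>V\<^esub> x b) I" for y
  have Fc: "F y \<in> carrier V" for y unfolding F_def by (rule v.finsum_closed) (use xc vs_smult[OF V] in auto)
  have FU: "F y \<in> U" for y
  proof -
    have "finsum V (\<lambda>b. \<phi> b y \<odot>\<^bsub>V\<^esub> x b) K \<in> U" if "finite K" "K \<subseteq> I" for K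
      using that
    proof (induction K)
      case (insert b K)
      have "finsum V (\<lambda>b. \<phi> b y \<odot>\<^bsub>V\<^esub> x b) (insert b K) = \<phi> b y \<odot>\<^bsub>V\<^esub> x b \<oplus>\<^bsub>V\<^esub> finsum V (\<lambda>b. \<phi> b y \<odot>\<^bsub>V\<^esub> x b) K"
        by (rule v.finsum_insert) (use insert xc vs_smult[OF V] in auto)
      then show ?case using insert xc U(3,4) by simp
    qed (use U(2) in simp)
    then show ?thesis unfolding F_def using insert.hyps(1) by blast
  qed
  have Fadd: "F (y \<oplus>\<^bsub>V\<^esub> z) = F y \<oplus>\<^bsub>V\<^esub> F z" if "y \<in> U" "z \<in> U" for y z
  proof -
    have "F (y \<oplus>\<^bsub>V\<^esub> z) = finsum V (\<lambda>b. \<phi> b y \<odot>\<^bsub>V\<^esub> x b \<oplus>\<^bsub>V\<^esub> \<phi> b z \<odot>\<^bsub>V\<^esub> x b) I"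
      unfolding F_def
      by (rule v.finsum_cong')
        (use linear_functionalD(1)[OF lI Uc[OF that(1)] Uc[OF that(2)]] vs_ldist[OF V xc(1)] xc vs_smult[OF V] vs_add[OF V] in auto)
    also have "\<dots> = F y \<oplus>\<^bsub>V\<^esub> F z"
      unfolding F_def by (rule v.finsum_addf) (use xc vs_smult[OF V] in auto)
    finally show ?thesis .
  qed
  have Fsm: "F (c \<odot>\<^bsub>V\<^esub> y) = c \<odot>\<^bsub>V\<^esub> F y" if "y \<in> U" for c y
  proof -
    have "F (c \<odot>\<^bsub>V\<^esub> y) = finsum V (\<lambda>b. c \<odot>\<^bsub>V\<^esub> (\<phi> b y \<odot>\<^bsub>V\<^esub> x b)) I"
      unfolding F_def
      by (rule v.finsum_cong')
        (use linear_functionalD(2)[OF lI Uc[OF that]] vs_compat[OF V xc(1)] xc vs_smult[OF V] in auto)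
    also have "\<dots> = c \<odot>\<^bsub>V\<^esub> F y"
      unfolding F_def by (rule vm.finsum_smult_ldistr[symmetric]) (use insert.hyps(1) xc vs_smult[OF V] in auto)
    finally show ?thesis .
  qed
  have ins: "finsum V (\<lambda>b. \<phi> b y \<odot>\<^bsub>V\<^esub> (x(a := z)) b) (insert a I) = \<phi> a y \<odot>\<^bsub>V\<^esub> z \<oplus>\<^bsub>V\<^esub> F y" if "z \<in> carrier V" for y z
  proof -
    have "finsum V (\<lambda>b. \<phi> b y \<odot>\<^bsub>V\<^esub> (x(a := z)) b) (insert a I) =
        \<phi> a y \<odot>\<^bsub>V\<^esub> (x(a := z)) a \<oplus>\<^bsub>V\<^esub> finsum V (\<lambda>b. \<phi> b y \<odot>\<^bsub>V\<^esub> (x(a := z)) b) I"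
      by (rule v.finsum_insert) (use insert.hyps xc that vs_smult[OF V] in auto)
    also have "finsum V (\<lambda>b. \<phi> b y \<odot>\<^bsub>V\<^esub> (x(a := z)) b) I = F y"
      unfolding F_def by (rule v.finsum_cong') (use insert.hyps xc vs_smult[OF V] in auto)
    finally show ?thesis by simp
  qed
  show ?case
  proof (cases "\<forall>u\<in>U. \<phi> a u = 0")
    case True
    have "U' = U" unfolding U'_def using True by blast
    then have "\<phi> a y \<odot>\<^bsub>V\<^esub> \<zero>\<^bsub>V\<^esub> \<oplus>\<^bsub>V\<^esub> F y = y" if "y \<in> U" for y
      using x(2)[of y] that Uc[OF that] vs_smult_zero[OF V] unfolding F_def by simp
    then show ?thesis using ins[OF vs_zero[OF V]] xc(2) U(2) by (intro exI[of _ "x(a := \<zero>\<^bsub>V\<^esub>)"]) auto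
  next
    case False
    then obtain u0 where u0: "u0 \<in> U" "\<phi> a u0 \<noteq> 0" by blast
    define u where "u = (1 / \<phi> a u0) \<odot>\<^bsub>V\<^esub> u0"
    have u: "u \<in> U" "\<phi> a u = 1" unfolding u_def using u0 U(4) linear_functionalD(2)[OF la Uc[OF u0(1)]] by auto
    define z where "z = u \<oplus>\<^bsub>V\<^esub> (-1) \<odot>\<^bsub>V\<^esub> F u"
    have z: "z \<in> U" unfolding z_def by (intro U(3,4) u FU)
    have "\<phi> a y \<odot>\<^bsub>V\<^esub> z \<oplus>\<^bsub>V\<^esub> F y = y" if y: "y \<in> U" for y
    proof -
      let ?c = "\<phi> a y"
      let ?y = "y \<oplus>\<^bsub>V\<^esub> (-?c) \<odot>\<^bsub>V\<^esub> u"
      have yU: "?y \<in> U" by (intro U(3,4) y u)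
      have "\<phi> a ?y = 0"
        using linear_functionalD(1)[OF la Uc[OF y] Uc[OF U(4)[OF u(1)]]] linear_functionalD(2)[OF la Uc[OF u(1)]] u(2) by simp
      then have "F ?y = ?y" unfolding F_def using x(2) yU unfolding U'_def by blast
      then have e: "F y \<oplus>\<^bsub>V\<^esub> (-?c) \<odot>\<^bsub>V\<^esub> F u = ?y"
        unfolding Fadd[OF y U(4)[OF u(1)]] Fsm[OF u(1)] .
      have cl: "?c \<odot>\<^bsub>V\<^esub> u \<in> carrier V" "(-?c) \<odot>\<^bsub>V\<^esub> u \<in> carrier V" "(-?c) \<odot>\<^bsub>V\<^esub> F u \<in> carrier V" "(-1) \<odot>\<^bsub>V\<^esub> F u \<in> carrier V"
        using vs_smult[OF V] Uc[OF u(1)] Fc by auto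
      have "?c \<odot>\<^bsub>V\<^esub> z = ?c \<odot>\<^bsub>V\<^esub> u \<oplus>\<^bsub>V\<^esub> (-?c) \<odot>\<^bsub>V\<^esub> F u"
        unfolding z_def vs_rdist[OF V Uc[OF u(1)] cl(4)] vs_compat[OF V Fc, symmetric] by simp
      then have "?c \<odot>\<^bsub>V\<^esub> z \<oplus>\<^bsub>V\<^esub> F y = ?c \<odot>\<^bsub>V\<^esub> u \<oplus>\<^bsub>V\<^esub> (F y \<oplus>\<^bsub>V\<^esub> (-?c) \<odot>\<^bsub>V\<^esub> F u)"
        using cl Fc by (simp only: v.a_ac v.add.m_closed)
      also have "\<dots> = y \<oplus>\<^bsub>V\<^esub> (?c \<odot>\<^bsub>V\<^esub> u \<oplus>\<^bsub>V\<^esub> (-?c) \<odot>\<^bsub>V\<^esub> u)"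
        unfolding e using cl Uc[OF y] by (simp only: v.a_ac v.add.m_closed)
      also have "?c \<odot>\<^bsub>V\<^esub> u \<oplus>\<^bsub>V\<^esub> (-?c) \<odot>\<^bsub>V\<^esub> u = \<zero>\<^bsub>V\<^esub>"
        unfolding vs_ldist[OF V Uc[OF u(1)], symmetric] using vs_zero_smult[OF V Uc[OF u(1)]] by simp
      finally show ?thesis unfolding vs_add_zero[OF V Uc[OF y]] .
    qed
    then show ?thesis using ins[OF Uc[OF z]] xc(2) z by (intro exI[of _ "x(a := z)"]) auto
  qed
qed

lemma frame_exists:
  assumes V: "vectorspace CC (V :: (complex, 'v, 'c) module_scheme)" and "separating V I \<phi>"
  shows "\<exists>x. (\<forall>a\<in>I. x a \<in> carrier V) \<and> (\<forall>y\<in>carrier V. finsum V (\<lambda>a. \<phi> a y \<odot>\<^bsub>V\<^esub> x a) I = y)"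
proof (rule frame_aux[OF V])
  show "submodule CC (carrier V) V"
    by (rule submoduleI_CC[OF V]) (use vs_zero[OF V] vs_add[OF V] vs_smult[OF V] in auto)
qed (use assms(2) in \<open>auto simp: separating_def\<close>)

lemma vectorspace_transfer:
  assumes V: "vectorspace CC (V :: (complex, 'v, 'c) module_scheme)"
    and e: "carrier V' = carrier V" "\<zero>\<^bsub>V'\<^esub> = \<zero>\<^bsub>V\<^esub>" "add V' = add V" "smult V' = smult V"
  shows "vectorspace CC (V' :: (complex, 'v, 'd) module_scheme)"
  by (rule CC_vectorspaceI; unfold e)
    (fact vs_zero[OF V] vs_add[OF V] vs_smult[OF V] vs_comm[OF V] vs_assoc[OF V] vs_add_zero[OF V] vs_compat[OF V]
      vs_one[OF V] vs_ldist[OF V] vs_rdist[OF V] vs_zero_smult[OF V])+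

lemma representationD:
  assumes "representation G W"
  shows "group G" "vectorspace CC W"
    "\<And>g y. g \<in> carrier G \<Longrightarrow> y \<in> carrier W \<Longrightarrow> rep_act W g y \<in> carrier W"
    "\<And>g y z. g \<in> carrier G \<Longrightarrow> y \<in> carrier W \<Longrightarrow> z \<in> carrier W \<Longrightarrow> rep_act W g (y \<oplus>\<^bsub>W\<^esub> z) = rep_act W g y \<oplus>\<^bsub>W\<^esub> rep_act W g z"
    "\<And>g c y. g \<in> carrier G \<Longrightarrow> y \<in> carrier W \<Longrightarrow> rep_act W g (c \<odot>\<^bsub>W\<^esub> y) = c \<odot>\<^bsub>W\<^esub> rep_act W g y"
    "\<And>y. y \<in> carrier W \<Longrightarrow> rep_act W \<one>\<^bsub>G\<^esub> y = y"
    "\<And>g h y. g \<in> carrier G \<Longrightarrow> h \<in> carrier G \<Longrightarrow> y \<in> carrier W \<Longrightarrow> rep_act W (g \<otimes>\<^bsub>G\<^esub> h) y = rep_act W g (rep_act W h y)"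
  using assms unfolding representation_def LinearCombinations.module_hom_def by (auto simp: Pi_iff)

section \<open>Induced representations\<close>

text \<open>A representation \<open>W\<close> of a subgroup \<open>H\<close> with a separating family of functionals.  All properties of the induced
  representation are read off from functionals on it: this turns questions about a quotient into
  computations with complex numbers.\<close>

locale induction_data = group G for G :: "('g, 'b) monoid_scheme" (structure) +
  fixes H :: "'g set" and W :: "('g, 'v, 'c) rep_scheme" and J :: "'j set" and \<psi> :: "'j \<Rightarrow> 'v \<Rightarrow> complex"
  assumes finG: "finite (carrier G)" and H: "subgroup H G"
    and W: "representation (G\<lparr>carrier := H\<rparr>) W"
    and sep: "separating W J \<psi>"
begin

lemma W_vs: "vectorspace CC W" by (rule representationD(2)[OF W])

lemma H_carrier: "h \<in> H \<Longrightarrow> h \<in> carrier G" using subgroup.subset[OF H] by blast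

lemma act:
  "\<And>h y. h \<in> H \<Longrightarrow> y \<in> carrier W \<Longrightarrow> rep_act W h y \<in> carrier W"
  "\<And>h y z. h \<in> H \<Longrightarrow> y \<in> carrier W \<Longrightarrow> z \<in> carrier W \<Longrightarrow> rep_act W h (y \<oplus>\<^bsub>W\<^esub> z) = rep_act W h y \<oplus>\<^bsub>W\<^esub> rep_act W h z"
  "\<And>h c y. h \<in> H \<Longrightarrow> y \<in> carrier W \<Longrightarrow> rep_act W h (c \<odot>\<^bsub>W\<^esub> y) = c \<odot>\<^bsub>W\<^esub> rep_act W h y"
  "\<And>y. y \<in> carrier W \<Longrightarrow> rep_act W \<one> y = y"
  "\<And>g h y. g \<in> H \<Longrightarrow> h \<in> H \<Longrightarrow> y \<in> carrier W \<Longrightarrow> rep_act W (g \<otimes> h) y = rep_act W g (rep_act W h y)"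
  using representationD(3-)[OF W] by simp_all

lemma act_zero: "h \<in> H \<Longrightarrow> rep_act W h \<zero>\<^bsub>W\<^esub> = \<zero>\<^bsub>W\<^esub>"
  using act(3)[OF _ vs_zero[OF W_vs], of h 0] vs_zero_smult[OF W_vs act(1)[OF _ vs_zero[OF W_vs]], of h]
    vs_smult_zero[OF W_vs, of 0] by simp

abbreviation "T \<equiv> grp_tensor G W"
abbreviation "B \<equiv> balancing G H W"
abbreviation "R \<equiv> induced G H W"

lemma T_vs: "vectorspace CC T"
  unfolding grp_tensor_def by (rule prod_vectorspace) (rule W_vs)

lemma T_simps:
  "carrier T = (\<Pi>\<^sub>E i\<in>carrier G. carrier W)"
  "\<zero>\<^bsub>T\<^esub> = (\<lambda>i\<in>carrier G. \<zero>\<^bsub>W\<^esub>)"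
  "f \<oplus>\<^bsub>T\<^esub> f' = (\<lambda>i\<in>carrier G. f i \<oplus>\<^bsub>W\<^esub> f' i)"
  "c \<odot>\<^bsub>T\<^esub> f = (\<lambda>i\<in>carrier G. c \<odot>\<^bsub>W\<^esub> f i)"
  unfolding grp_tensor_def prod_module_simps by auto

lemma T_val: "f \<in> carrier T \<Longrightarrow> g \<in> carrier G \<Longrightarrow> f g \<in> carrier W"
  unfolding T_simps by (rule PiE_mem)

lemma restrict_T: "(\<And>g. g \<in> carrier G \<Longrightarrow> f g \<in> carrier W) \<Longrightarrow> (\<lambda>g\<in>carrier G. f g) \<in> carrier T"
  unfolding T_simps by auto

lemma pure_T: "v \<in> carrier W \<Longrightarrow> pure_tensor G W g v \<in> carrier T"
  unfolding pure_tensor_def by (rule restrict_T) (use vs_zero[OF W_vs] in auto)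

text \<open>The functional \<open>\<theta>\<close> applied to the component in the coset \<open>g H\<close>, every \<open>g h \<otimes> w\<close> being rewritten as \<open>g \<otimes> h w\<close>.\<close>

definition coset_fun :: "'g \<Rightarrow> ('v \<Rightarrow> complex) \<Rightarrow> ('g \<Rightarrow> 'v) \<Rightarrow> complex" where
  "coset_fun g \<theta> f = (\<Sum>h\<in>H. \<theta> (rep_act W h (f (g \<otimes> h))))"

lemma finH: "finite H" using finite_subset[OF subgroup.subset[OF H] finG] .

lemma coset_fun_linear:
  assumes "linear_functional W \<theta>" "g \<in> carrier G"
  shows "linear_functional T (coset_fun g \<theta>)"
  unfolding linear_functional_def
proof (intro conjI ballI allI)
  fix f f' assume f: "f \<in> carrier T" "f' \<in> carrier T"
  show "coset_fun g \<theta> (f \<oplus>\<^bsub>T\<^esub> f') = coset_fun g \<theta> f + coset_fun g \<theta> f'"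
    unfolding coset_fun_def sum.distrib[symmetric] T_simps
    by (rule sum.cong[OF refl])
      (use assms(2) T_val[OF f(1)] T_val[OF f(2)] H_carrier in \<open>simp add: act linear_functionalD(1)[OF assms(1)]\<close>)
next
  fix c f assume f: "f \<in> carrier T"
  show "coset_fun g \<theta> (c \<odot>\<^bsub>T\<^esub> f) = c * coset_fun g \<theta> f"
    unfolding coset_fun_def sum_distrib_left T_simps
    by (rule sum.cong[OF refl])
      (use assms(2) T_val[OF f(1)] H_carrier in \<open>simp add: act linear_functionalD(2)[OF assms(1)]\<close>)
qed

lemma coset_fun_pure:
  assumes \<theta>: "linear_functional W \<theta>" and g: "g \<in> carrier G" and k: "k \<in> carrier G" and v: "v \<in> carrier W"
  shows "coset_fun g \<theta> (pure_tensor G W k v) = (if inv g \<otimes> k \<in> H then \<theta> (rep_act W (inv g \<otimes> k) v) else 0)"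
proof -
  have e: "g \<otimes> h = k \<longleftrightarrow> h = inv g \<otimes> k" if "h \<in> H" for h
    using g k H_carrier[OF that] by (metis inv_closed inv_solve_left)
  have "coset_fun g \<theta> (pure_tensor G W k v) = (\<Sum>h\<in>H. if h = inv g \<otimes> k then \<theta> (rep_act W (inv g \<otimes> k) v) else 0)"
    unfolding coset_fun_def
  proof (rule sum.cong[OF refl])
    fix h assume h: "h \<in> H"
    have "g \<otimes> h \<in> carrier G" using g H_carrier[OF h] by simp
    then show "\<theta> (rep_act W h (pure_tensor G W k v (g \<otimes> h))) = (if h = inv g \<otimes> k then \<theta> (rep_act W (inv g \<otimes> k) v) else 0)"
      using e[OF h] act_zero[OF h] linear_functional_zero[OF W_vs \<theta>] by (auto simp: pure_tensor_def)
  qed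
  also have "\<dots> = (if inv g \<otimes> k \<in> H then \<theta> (rep_act W (inv g \<otimes> k) v) else 0)"
    using finH by (simp add: sum.delta)
  finally show ?thesis .
qed

lemma gens_T: "{pure_tensor G W (g \<otimes> h) v \<ominus>\<^bsub>T\<^esub> pure_tensor G W g (rep_act W h v) | g h v.
      g \<in> carrier G \<and> h \<in> H \<and> v \<in> carrier W} \<subseteq> carrier T"
proof -
  interpret t: abelian_group T by (rule vs_abelian[OF T_vs])
  show ?thesis using pure_T act(1) by auto
qed

lemma B_sub: "submodule CC B T"
  unfolding balancing_def by (rule lin_span_submodule[OF T_vs gens_T])

lemma B_gen:
  assumes "g \<in> carrier G" "h \<in> H" "v \<in> carrier W"
  shows "pure_tensor G W (g \<otimes> h) v \<oplus>\<^bsub>T\<^esub> (-1) \<odot>\<^bsub>T\<^esub> pure_tensor G W g (rep_act W h v) \<in> B"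
proof -
  have "pure_tensor G W (g \<otimes> h) v \<ominus>\<^bsub>T\<^esub> pure_tensor G W g (rep_act W h v) \<in> B"
    unfolding balancing_def by (rule subsetD[OF lin_span_superset[OF T_vs gens_T]]) (use assms in blast)
  then show ?thesis unfolding vs_minus[OF T_vs pure_T[OF assms(3)] pure_T[OF act(1)[OF assms(2,3)]]] .
qed

lemma coset_fun_B:
  assumes \<theta>: "linear_functional W \<theta>" and g: "g \<in> carrier G" and f: "f \<in> B"
  shows "coset_fun g \<theta> f = 0"
proof -
  let ?N = "{f \<in> carrier T. coset_fun g \<theta> f = 0}"
  note L = coset_fun_linear[OF \<theta> g]
  have N: "submodule CC ?N T"
    by (rule submoduleI_CC[OF T_vs])
      (use vs_zero[OF T_vs] vs_add[OF T_vs] vs_smult[OF T_vs] linear_functional_zero[OF T_vs L] linear_functionalD[OF L] in auto)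
  have "B \<subseteq> ?N"
    unfolding balancing_def
  proof (rule lin_span_least[OF T_vs gens_T _ N], rule subsetI)
    fix f assume fg: "f \<in> {pure_tensor G W (g \<otimes> h) v \<ominus>\<^bsub>T\<^esub> pure_tensor G W g (rep_act W h v) | g h v.
      g \<in> carrier G \<and> h \<in> H \<and> v \<in> carrier W}"
    then obtain k h v where k: "k \<in> carrier G" "h \<in> H" "v \<in> carrier W"
      "f = pure_tensor G W (k \<otimes> h) v \<ominus>\<^bsub>T\<^esub> pure_tensor G W k (rep_act W h v)" by blast
    have hc: "h \<in> carrier G" by (rule H_carrier[OF k(2)])
    have a: "inv g \<otimes> (k \<otimes> h) = (inv g \<otimes> k) \<otimes> h" using g k(1) hc by (simp add: m_assoc)
    have i: "inv g \<otimes> (k \<otimes> h) \<in> H \<longleftrightarrow> inv g \<otimes> k \<in> H"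
    proof
      assume "inv g \<otimes> (k \<otimes> h) \<in> H"
      from subgroup.m_closed[OF H this subgroup.m_inv_closed[OF H k(2)]]
      have "(inv g \<otimes> k) \<otimes> h \<otimes> inv h \<in> H" unfolding a .
      then show "inv g \<otimes> k \<in> H" using g k(1) hc by (simp add: m_assoc)
    next
      assume "inv g \<otimes> k \<in> H"
      then show "inv g \<otimes> (k \<otimes> h) \<in> H" unfolding a by (rule subgroup.m_closed[OF H _ k(2)])
    qed
    have "coset_fun g \<theta> f = coset_fun g \<theta> (pure_tensor G W (k \<otimes> h) v) + (-1) * coset_fun g \<theta> (pure_tensor G W k (rep_act W h v))"
      unfolding k(4) vs_minus[OF T_vs pure_T[OF k(3)] pure_T[OF act(1)[OF k(2,3)]]]
      using linear_functionalD(1)[OF L pure_T[OF k(3)] vs_smult[OF T_vs pure_T[OF act(1)[OF k(2,3)]]]]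
        linear_functionalD(2)[OF L pure_T[OF act(1)[OF k(2,3)]]] by simp
    also have "\<dots> = 0"
      unfolding coset_fun_pure[OF \<theta> g m_closed[OF k(1) hc] k(3)] coset_fun_pure[OF \<theta> g k(1) act(1)[OF k(2,3)]] i
      unfolding a using act(5)[OF _ k(2,3)] by simp
    finally show "f \<in> ?N" using subsetD[OF gens_T fg] by simp
  qed
  then show ?thesis using f by blast
qed

definition coset_rep :: "'g \<Rightarrow> 'g" where "coset_rep k = (SOME x. x \<in> carrier G \<and> inv x \<otimes> k \<in> H)"

lemma coset_rep: "k \<in> carrier G \<Longrightarrow> coset_rep k \<in> carrier G \<and> inv (coset_rep k) \<otimes> k \<in> H"
proof -
  assume "k \<in> carrier G"
  then have "k \<in> carrier G \<and> inv k \<otimes> k \<in> H" using subgroup.one_closed[OF H] by simp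
  then show ?thesis unfolding coset_rep_def by (rule someI)
qed

lemma coset_rep_eq:
  assumes "k \<in> carrier G" "h \<in> H"
  shows "coset_rep (k \<otimes> h) = coset_rep k"
proof -
  have hc: "h \<in> carrier G" by (rule H_carrier[OF assms(2)])
  have "inv x \<otimes> (k \<otimes> h) \<in> H \<longleftrightarrow> inv x \<otimes> k \<in> H" if x: "x \<in> carrier G" for x
  proof
    assume "inv x \<otimes> (k \<otimes> h) \<in> H"
    from subgroup.m_closed[OF H this subgroup.m_inv_closed[OF H assms(2)]] show "inv x \<otimes> k \<in> H" using x assms(1) hc by (simp add: m_assoc)
  next
    assume "inv x \<otimes> k \<in> H"
    from subgroup.m_closed[OF H this assms(2)] show "inv x \<otimes> (k \<otimes> h) \<in> H" using x assms(1) hc by (simp add: m_assoc)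
  qed
  then have "(\<lambda>x. x \<in> carrier G \<and> inv x \<otimes> (k \<otimes> h) \<in> H) = (\<lambda>x. x \<in> carrier G \<and> inv x \<otimes> k \<in> H)" by blast
  then show ?thesis unfolding coset_rep_def by (rule arg_cong)
qed

text \<open>Modulo the balancing relations \<open>k \<otimes> w\<close> can be moved to the representative of the coset of \<open>k\<close>; this is done for one
  group element at a time.\<close>

lemma transversal_form:
  assumes f: "f \<in> carrier T"
  shows "\<exists>f'\<in>carrier T. f \<oplus>\<^bsub>T\<^esub> (-1) \<odot>\<^bsub>T\<^esub> f' \<in> B \<and> (\<forall>g\<in>carrier G. coset_rep g \<noteq> g \<longrightarrow> f' g = \<zero>\<^bsub>W\<^esub>)"
proof -
  interpret t: abelian_group T by (rule vs_abelian[OF T_vs])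
  let ?r = "\<lambda>S. (\<lambda>g\<in>carrier G. if g \<in> S then f g else \<zero>\<^bsub>W\<^esub>)"
  let ?P = "\<lambda>f. \<exists>f'\<in>carrier T. f \<oplus>\<^bsub>T\<^esub> (-1) \<odot>\<^bsub>T\<^esub> f' \<in> B \<and> (\<forall>g\<in>carrier G. coset_rep g \<noteq> g \<longrightarrow> f' g = \<zero>\<^bsub>W\<^esub>)"
  have wz: "\<And>w. w \<in> carrier W \<Longrightarrow> \<zero>\<^bsub>W\<^esub> \<oplus>\<^bsub>W\<^esub> w = w"
    using vs_comm[OF W_vs vs_zero[OF W_vs]] vs_add_zero[OF W_vs] by simp
  have rT: "?r S \<in> carrier T" for S by (rule restrict_T) (use T_val[OF f] vs_zero[OF W_vs] in auto)
  have "?P (?r S)" if "finite S" "S \<subseteq> carrier G" for S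
    using that
  proof (induction S)
    case empty
    have e: "?r {} = \<zero>\<^bsub>T\<^esub>" unfolding T_simps by simp
    have "\<zero>\<^bsub>T\<^esub> \<oplus>\<^bsub>T\<^esub> (-1) \<odot>\<^bsub>T\<^esub> \<zero>\<^bsub>T\<^esub> \<in> B"
      using submoduleD_CC(2)[OF B_sub] vs_smult_zero[OF T_vs] vs_add_zero[OF T_vs vs_zero[OF T_vs]] by simp
    moreover have "\<forall>g\<in>carrier G. coset_rep g \<noteq> g \<longrightarrow> \<zero>\<^bsub>T\<^esub> g = \<zero>\<^bsub>W\<^esub>" unfolding T_simps by simp
    ultimately show ?case unfolding e using vs_zero[OF T_vs] by blast
  next
    case (insert k S)
    have k: "k \<in> carrier G" using insert by simp
    have fk: "f k \<in> carrier W" by (rule T_val[OF f k])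
    obtain f' where f': "f' \<in> carrier T" "?r S \<oplus>\<^bsub>T\<^esub> (-1) \<odot>\<^bsub>T\<^esub> f' \<in> B" "\<And>g. g \<in> carrier G \<Longrightarrow> coset_rep g \<noteq> g \<Longrightarrow> f' g = \<zero>\<^bsub>W\<^esub>"
      using insert.IH insert.prems by blast
    let ?h = "inv (coset_rep k) \<otimes> k"
    have r: "coset_rep k \<in> carrier G" "?h \<in> H" using coset_rep[OF k] by auto
    have rk: "coset_rep k \<otimes> ?h = k" using r k by (simp add: m_assoc[symmetric])
    have rr: "coset_rep (coset_rep k) = coset_rep k" using coset_rep_eq[OF r] unfolding rk by simp
    let ?w = "rep_act W ?h (f k)"
    have w: "?w \<in> carrier W" by (rule act(1)[OF r(2) fk])
    let ?p = "pure_tensor G W k (f k)" and ?p' = "pure_tensor G W (coset_rep k) ?w"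
    have pB: "?p \<oplus>\<^bsub>T\<^esub> (-1) \<odot>\<^bsub>T\<^esub> ?p' \<in> B" using B_gen[OF r fk] unfolding rk .
    have e: "?r (insert k S) = ?r S \<oplus>\<^bsub>T\<^esub> ?p"
      unfolding T_simps pure_tensor_def
      by (rule restrict_ext) (use insert.hyps(2) wz T_val[OF f] vs_add_zero[OF W_vs] vs_zero[OF W_vs] in auto)
    note cl = rT[of S] pure_T[OF fk, of k] pure_T[OF w, of "coset_rep k"] f'(1)
    have s: "?r (insert k S) \<oplus>\<^bsub>T\<^esub> (-1) \<odot>\<^bsub>T\<^esub> (f' \<oplus>\<^bsub>T\<^esub> ?p') = (?r S \<oplus>\<^bsub>T\<^esub> (-1) \<odot>\<^bsub>T\<^esub> f') \<oplus>\<^bsub>T\<^esub> (?p \<oplus>\<^bsub>T\<^esub> (-1) \<odot>\<^bsub>T\<^esub> ?p')"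
      unfolding e vs_rdist[OF T_vs cl(4,3)]
      using cl vs_smult[OF T_vs cl(3)] vs_smult[OF T_vs cl(4)] by (simp only: t.a_ac t.add.m_closed)
    have "(f' \<oplus>\<^bsub>T\<^esub> ?p') g = \<zero>\<^bsub>W\<^esub>" if g: "g \<in> carrier G" "coset_rep g \<noteq> g" for g
      using f'(3)[OF g] g rr vs_add_zero[OF W_vs vs_zero[OF W_vs]] unfolding T_simps pure_tensor_def by auto
    moreover have "?r (insert k S) \<oplus>\<^bsub>T\<^esub> (-1) \<odot>\<^bsub>T\<^esub> (f' \<oplus>\<^bsub>T\<^esub> ?p') \<in> B"
      unfolding s by (rule submoduleD_CC(3)[OF B_sub f'(2) pB])
    ultimately show ?case using vs_add[OF T_vs cl(4,3)] by blast
  qed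
  from this[OF finG subset_refl] have "?P (?r (carrier G))" .
  moreover have "?r (carrier G) = f"
    by (rule extensionalityI[of _ "carrier G"]) (use f in \<open>auto simp: T_simps PiE_iff\<close>)
  ultimately show ?thesis by simp
qed

text \<open>The balancing relations are exactly the joint kernel of the functionals \<open>coset_fun\<close>.  For \<open>f'\<close> supported on coset
  representatives the sum over the coset has a single term, so its components are zero by separation.\<close>

lemma kernel_B:
  assumes f: "f \<in> carrier T" and z: "\<And>g j. g \<in> carrier G \<Longrightarrow> j \<in> J \<Longrightarrow> coset_fun g (\<psi> j) f = 0"
  shows "f \<in> B"
proof -
  obtain f' where f': "f' \<in> carrier T" "f \<oplus>\<^bsub>T\<^esub> (-1) \<odot>\<^bsub>T\<^esub> f' \<in> B" "\<And>g. g \<in> carrier G \<Longrightarrow> coset_rep g \<noteq> g \<Longrightarrow> f' g = \<zero>\<^bsub>W\<^esub>"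
    using transversal_form[OF f] by auto
  have "f' g = \<zero>\<^bsub>W\<^esub>" if g: "g \<in> carrier G" for g
  proof (cases "coset_rep g = g")
    case True
    have "\<psi> j (f' g) = 0" if j: "j \<in> J" for j
    proof -
      have l: "linear_functional W (\<psi> j)" using sep j unfolding separating_def by blast
      have "\<psi> j (rep_act W h (f' (g \<otimes> h))) = 0" if h: "h \<in> H" "h \<noteq> \<one>" for h
      proof -
        have "coset_rep (g \<otimes> h) = g" using coset_rep_eq[OF g h(1)] True by simp
        moreover have "g \<otimes> h \<noteq> g" using h H_carrier[OF h(1)] g by simp
        ultimately have "f' (g \<otimes> h) = \<zero>\<^bsub>W\<^esub>" using f'(3)[OF m_closed[OF g H_carrier[OF h(1)]]] by simp
        then show ?thesis using act_zero[OF h(1)] linear_functional_zero[OF W_vs l] by simp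
      qed
      then have "coset_fun g (\<psi> j) f' = (\<Sum>h\<in>{\<one>}. \<psi> j (rep_act W h (f' (g \<otimes> h))))"
        unfolding coset_fun_def by (intro sum.mono_neutral_right finH) (use subgroup.one_closed[OF H] in auto)
      also have "\<dots> = \<psi> j (f' g)" using act(4)[OF T_val[OF f'(1) g]] g by simp
      finally have "\<psi> j (f' g) = coset_fun g (\<psi> j) f'" ..
      moreover have "coset_fun g (\<psi> j) (f \<oplus>\<^bsub>T\<^esub> (-1) \<odot>\<^bsub>T\<^esub> f') = coset_fun g (\<psi> j) f + (-1) * coset_fun g (\<psi> j) f'"
        using linear_functionalD(1)[OF coset_fun_linear[OF l g] f vs_smult[OF T_vs f'(1)]] linear_functionalD(2)[OF coset_fun_linear[OF l g] f'(1)] by simp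
      ultimately show ?thesis using coset_fun_B[OF l g f'(2)] z[OF g j] by simp
    qed
    then show ?thesis using sep T_val[OF f'(1) g] unfolding separating_def by blast
  qed (use f'(3) g in simp)
  then have "f' = \<zero>\<^bsub>T\<^esub>"
    by (intro extensionalityI[of _ "carrier G"]) (use f'(1) in \<open>auto simp: T_simps PiE_iff\<close>)
  then show ?thesis using f'(2) vs_smult_zero[OF T_vs] vs_add_zero[OF T_vs f] by simp
qed

lemma R_simps:
  "carrier R = coset T B ` carrier T" "\<zero>\<^bsub>R\<^esub> = B"
  "add R = add (quot_module T B)" "smult R = smult (quot_module T B)"
  "rep_act R k X = (\<Union>f\<in>X. coset T B (\<lambda>x\<in>carrier G. f (inv k \<otimes> x)))"
  using quot_carrier[OF T_vs B_sub] quot_zero[OF T_vs B_sub]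
  by (simp_all add: induced_def module.defs rep.defs)

lemma R_vs: "vectorspace CC R"
  by (rule vectorspace_transfer[OF quot_vectorspace[OF T_vs B_sub]])
    (use quot_carrier[OF T_vs B_sub] quot_zero[OF T_vs B_sub] in \<open>simp_all add: R_simps\<close>)

lemma R_rep_ex: "X \<in> carrier R \<Longrightarrow> \<exists>f\<in>carrier T. X = coset T B f"
  unfolding R_simps by blast

lemma R_add: "f \<in> carrier T \<Longrightarrow> f' \<in> carrier T \<Longrightarrow> coset T B f \<oplus>\<^bsub>R\<^esub> coset T B f' = coset T B (f \<oplus>\<^bsub>T\<^esub> f')"
  unfolding R_simps by (rule quot_add[OF T_vs B_sub])

lemma R_smult: "f \<in> carrier T \<Longrightarrow> c \<odot>\<^bsub>R\<^esub> coset T B f = coset T B (c \<odot>\<^bsub>T\<^esub> f)"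
  unfolding R_simps by (rule quot_smult[OF T_vs B_sub])

text \<open>\<open>translate\<close> is the action on \<open>\<complex>G \<otimes> W\<close>, and \<open>keep_on\<close>, with \<open>C\<close> a union of cosets of \<open>H\<close>, gives the components of the coaction.\<close>

definition translate :: "'g \<Rightarrow> ('g \<Rightarrow> 'v) \<Rightarrow> 'g \<Rightarrow> 'v" where "translate k f = (\<lambda>x\<in>carrier G. f (inv k \<otimes> x))"

definition keep_on :: "('g \<Rightarrow> bool) \<Rightarrow> ('g \<Rightarrow> 'v) \<Rightarrow> 'g \<Rightarrow> 'v" where "keep_on C f = (\<lambda>h\<in>carrier G. if C h then f h else \<zero>\<^bsub>W\<^esub>)"

lemma translate_T: "k \<in> carrier G \<Longrightarrow> f \<in> carrier T \<Longrightarrow> translate k f \<in> carrier T"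
  unfolding translate_def by (rule restrict_T) (simp add: T_val)

lemma keep_on_T: "f \<in> carrier T \<Longrightarrow> keep_on C f \<in> carrier T"
  unfolding keep_on_def by (rule restrict_T) (simp add: T_val vs_zero[OF W_vs])

lemma translate_add: "k \<in> carrier G \<Longrightarrow> translate k (f \<oplus>\<^bsub>T\<^esub> f') = translate k f \<oplus>\<^bsub>T\<^esub> translate k f'"
  unfolding translate_def T_simps by (rule restrict_ext) simp

lemma translate_smult: "k \<in> carrier G \<Longrightarrow> translate k (c \<odot>\<^bsub>T\<^esub> f) = c \<odot>\<^bsub>T\<^esub> translate k f"
  unfolding translate_def T_simps by (rule restrict_ext) simp

lemma keep_on_add: "keep_on C (f \<oplus>\<^bsub>T\<^esub> f') = keep_on C f \<oplus>\<^bsub>T\<^esub> keep_on C f'"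
  unfolding keep_on_def T_simps by (rule restrict_ext) (simp add: vs_add_zero[OF W_vs vs_zero[OF W_vs]])

lemma coset_fun_translate:
  assumes "k \<in> carrier G" "g \<in> carrier G"
  shows "coset_fun g \<theta> (translate k f) = coset_fun (inv k \<otimes> g) \<theta> f"
  unfolding coset_fun_def translate_def
  by (rule sum.cong[OF refl]) (use assms H_carrier in \<open>simp add: m_assoc\<close>)

lemma coset_fun_keep_on:
  assumes "linear_functional W \<theta>" "g \<in> carrier G" "\<And>h. h \<in> H \<Longrightarrow> C (g \<otimes> h) \<longleftrightarrow> C g"
  shows "coset_fun g \<theta> (keep_on C f) = (if C g then coset_fun g \<theta> f else 0)"
proof (cases "C g")
  case True
  have "coset_fun g \<theta> (keep_on C f) = coset_fun g \<theta> f"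
    unfolding coset_fun_def keep_on_def by (rule sum.cong[OF refl]) (use assms(2,3) True H_carrier in simp)
  then show ?thesis using True by simp
next
  case False
  have "coset_fun g \<theta> (keep_on C f) = 0"
    unfolding coset_fun_def keep_on_def
    by (rule sum.neutral) (use assms(2,3) False H_carrier act_zero linear_functional_zero[OF W_vs assms(1)] in simp)
  then show ?thesis using False by simp
qed

lemma psi_linear: "j \<in> J \<Longrightarrow> linear_functional W (\<psi> j)"
  using sep unfolding separating_def by blast

lemma translate_B:
  assumes k: "k \<in> carrier G" and f: "f \<in> B"
  shows "translate k f \<in> B"
proof (rule kernel_B)
  show "translate k f \<in> carrier T" by (rule translate_T[OF k]) (use f submoduleD_CC(1)[OF B_sub] in blast)
  fix g j assume g: "g \<in> carrier G" and j: "j \<in> J"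
  show "coset_fun g (\<psi> j) (translate k f) = 0"
    unfolding coset_fun_translate[OF k g] by (rule coset_fun_B[OF psi_linear[OF j] _ f]) (use k g in simp)
qed

lemma keep_on_B:
  assumes C: "\<And>g h. g \<in> carrier G \<Longrightarrow> h \<in> H \<Longrightarrow> C (g \<otimes> h) \<longleftrightarrow> C g" and f: "f \<in> B"
  shows "keep_on C f \<in> B"
proof (rule kernel_B)
  show "keep_on C f \<in> carrier T" by (rule keep_on_T) (use f submoduleD_CC(1)[OF B_sub] in blast)
  fix g j assume g: "g \<in> carrier G" and j: "j \<in> J"
  have "coset_fun g (\<psi> j) (keep_on C f) = (if C g then coset_fun g (\<psi> j) f else 0)"
    by (rule coset_fun_keep_on[OF psi_linear[OF j] g]) (rule C[OF g])
  then show "coset_fun g (\<psi> j) (keep_on C f) = 0" using coset_fun_B[OF psi_linear[OF j] g f] by simp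
qed

lemma R_act:
  assumes k: "k \<in> carrier G" and f: "f \<in> carrier T"
  shows "rep_act R k (coset T B f) = coset T B (translate k f)"
  unfolding R_simps translate_def[symmetric]
proof (rule coset_Union[OF T_vs B_sub f])
  fix n assume "n \<in> B"
  then show "coset T B (translate k (n \<oplus>\<^bsub>T\<^esub> f)) = coset T B (translate k f)"
    unfolding translate_add[OF k] by (intro coset_shift[OF T_vs B_sub] translate_B[OF k] translate_T[OF k f])
qed

lemma R_coact:
  assumes C: "\<And>g h. g \<in> carrier G \<Longrightarrow> h \<in> H \<Longrightarrow> C (g \<otimes> h) \<longleftrightarrow> C g" and f: "f \<in> carrier T"
  shows "(\<Union>f\<in>coset T B f. coset T B (keep_on C f)) = coset T B (keep_on C f)"
proof (rule coset_Union[OF T_vs B_sub f])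
  fix n assume "n \<in> B"
  then show "coset T B (keep_on C (n \<oplus>\<^bsub>T\<^esub> f)) = coset T B (keep_on C f)"
    unfolding keep_on_add by (intro coset_shift[OF T_vs B_sub] keep_on_B[OF C] keep_on_T[OF f])
qed

definition ind_fun :: "'g \<Rightarrow> ('v \<Rightarrow> complex) \<Rightarrow> ('g \<Rightarrow> 'v) set \<Rightarrow> complex" where
  "ind_fun g \<theta> X = coset_fun g \<theta> (SOME f. f \<in> X)"

lemma ind_fun_coset:
  assumes \<theta>: "linear_functional W \<theta>" and g: "g \<in> carrier G" and f: "f \<in> carrier T"
  shows "ind_fun g \<theta> (coset T B f) = coset_fun g \<theta> f"
proof -
  have "(SOME f'. f' \<in> coset T B f) \<in> coset T B f" using coset_self[OF T_vs B_sub f] by (rule someI[of "\<lambda>f'. f' \<in> coset T B f"])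
  then obtain n where n: "n \<in> B" "(SOME f'. f' \<in> coset T B f) = n \<oplus>\<^bsub>T\<^esub> f" unfolding coset_iff by blast
  have nT: "n \<in> carrier T" using n(1) submoduleD_CC(1)[OF B_sub] by blast
  show ?thesis
    unfolding ind_fun_def n(2) linear_functionalD(1)[OF coset_fun_linear[OF \<theta> g] nT f] using coset_fun_B[OF \<theta> g n(1)] by simp
qed

lemma ind_fun_linear:
  assumes \<theta>: "linear_functional W \<theta>" and g: "g \<in> carrier G"
  shows "linear_functional R (ind_fun g \<theta>)"
  unfolding linear_functional_def
proof (intro conjI ballI allI)
  note L = coset_fun_linear[OF \<theta> g]
  fix X assume "X \<in> carrier R"
  then obtain f where f: "f \<in> carrier T" "X = coset T B f" using R_rep_ex by blast
  show "ind_fun g \<theta> (c \<odot>\<^bsub>R\<^esub> X) = c * ind_fun g \<theta> X" for c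
    unfolding f(2) R_smult[OF f(1)] ind_fun_coset[OF \<theta> g f(1)] ind_fun_coset[OF \<theta> g vs_smult[OF T_vs f(1)]]
    by (rule linear_functionalD(2)[OF L f(1)])
  fix Y assume "Y \<in> carrier R"
  then obtain f' where f': "f' \<in> carrier T" "Y = coset T B f'" using R_rep_ex by blast
  show "ind_fun g \<theta> (X \<oplus>\<^bsub>R\<^esub> Y) = ind_fun g \<theta> X + ind_fun g \<theta> Y"
    unfolding f(2) f'(2) R_add[OF f(1) f'(1)] ind_fun_coset[OF \<theta> g f(1)] ind_fun_coset[OF \<theta> g f'(1)]
      ind_fun_coset[OF \<theta> g vs_add[OF T_vs f(1) f'(1)]]
    by (rule linear_functionalD(1)[OF L f(1) f'(1)])
qed

lemma ind_fun_separating: "separating R (carrier G \<times> J) (\<lambda>(g, j). ind_fun g (\<psi> j))"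
proof -
  have "finite (carrier G \<times> J)" using finG sep unfolding separating_def by simp
  moreover have "X = \<zero>\<^bsub>R\<^esub>" if X: "X \<in> carrier R" and z: "\<forall>a\<in>carrier G \<times> J. (case a of (g, j) \<Rightarrow> ind_fun g (\<psi> j)) X = 0" for X
  proof -
    obtain f where f: "f \<in> carrier T" "X = coset T B f" using R_rep_ex[OF X] by blast
    have "f \<in> B"
    proof (rule kernel_B[OF f(1)])
      fix g j assume g: "g \<in> carrier G" and j: "j \<in> J"
      then have "ind_fun g (\<psi> j) X = 0" using z by auto
      then show "coset_fun g (\<psi> j) f = 0" unfolding f(2) ind_fun_coset[OF psi_linear[OF j] g f(1)] .
    qed
    then show ?thesis unfolding f(2) R_simps(2) by (rule coset_zero[OF T_vs B_sub])
  qed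
  moreover have "linear_functional R (case a of (g, j) \<Rightarrow> ind_fun g (\<psi> j))" if "a \<in> carrier G \<times> J" for a
    using that ind_fun_linear[OF psi_linear] by auto
  ultimately show ?thesis unfolding separating_def by blast
qed

lemma R_representation: "representation G R"
proof -
  have cl: "rep_act R k X \<in> carrier R" if k: "k \<in> carrier G" and X: "X \<in> carrier R" for k X
  proof -
    obtain f where f: "f \<in> carrier T" "X = coset T B f" using R_rep_ex[OF X] by blast
    show ?thesis unfolding f(2) R_act[OF k f(1)] R_simps(1) by (rule imageI) (rule translate_T[OF k f(1)])
  qed
  have "rep_act R k \<in> LinearCombinations.module_hom CC R R" if k: "k \<in> carrier G" for k
    unfolding LinearCombinations.module_hom_def
  proof (rule CollectI, intro conjI allI impI)
    show "rep_act R k \<in> carrier R \<rightarrow> carrier R" using cl[OF k] by blast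
    fix X Y assume "X \<in> carrier R \<and> Y \<in> carrier R"
    then obtain f f' where f: "f \<in> carrier T" "X = coset T B f" and f': "f' \<in> carrier T" "Y = coset T B f'" using R_rep_ex by blast
    show "rep_act R k (X \<oplus>\<^bsub>R\<^esub> Y) = rep_act R k X \<oplus>\<^bsub>R\<^esub> rep_act R k Y"
      unfolding f(2) f'(2) R_add[OF f(1) f'(1)] R_act[OF k f(1)] R_act[OF k f'(1)] R_act[OF k vs_add[OF T_vs f(1) f'(1)]]
        translate_add[OF k] R_add[OF translate_T[OF k f(1)] translate_T[OF k f'(1)]] ..
  next
    fix c X assume "c \<in> carrier CC \<and> X \<in> carrier R"
    then obtain f where f: "f \<in> carrier T" "X = coset T B f" using R_rep_ex by blast
    show "rep_act R k (c \<odot>\<^bsub>R\<^esub> X) = c \<odot>\<^bsub>R\<^esub> rep_act R k X"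
      unfolding f(2) R_smult[OF f(1)] R_act[OF k f(1)] R_act[OF k vs_smult[OF T_vs f(1)]] translate_smult[OF k] R_smult[OF translate_T[OF k f(1)]] ..
  qed
  moreover have "rep_act R \<one> X = X" if X: "X \<in> carrier R" for X
  proof -
    obtain f where f: "f \<in> carrier T" "X = coset T B f" using R_rep_ex[OF X] by blast
    have "translate \<one> f = f"
      by (rule extensionalityI[of _ "carrier G"]) (use f(1) in \<open>auto simp: translate_def T_simps PiE_iff\<close>)
    then show ?thesis unfolding f(2) R_act[OF one_closed f(1)] by simp
  qed
  moreover have "rep_act R (g \<otimes> h) X = rep_act R g (rep_act R h X)" if g: "g \<in> carrier G" and h: "h \<in> carrier G" and X: "X \<in> carrier R" for g h X
  proof -
    obtain f where f: "f \<in> carrier T" "X = coset T B f" using R_rep_ex[OF X] by blast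
    have "translate (g \<otimes> h) f = translate g (translate h f)"
      unfolding translate_def by (rule restrict_ext) (use g h in \<open>simp add: inv_mult_group m_assoc\<close>)
    then show ?thesis unfolding f(2) R_act[OF m_closed[OF g h] f(1)] R_act[OF h f(1)] R_act[OF g translate_T[OF h f(1)]] by simp
  qed
  ultimately show ?thesis unfolding representation_def using R_vs group_axioms by blast
qed

text \<open>Since \<open>k g = g (g\<inverse> k g)\<close>, the action of \<open>k\<close> on the component at \<open>g\<close> is the action of \<open>g\<inverse> k g\<close> on \<open>W\<close>.\<close>

lemma ind_fun_scalar:
  assumes \<theta>: "linear_functional W \<theta>" and g: "g \<in> carrier G" and k: "k \<in> carrier G" and m: "inv g \<otimes> k \<otimes> g \<in> H"
    and c: "\<And>w. w \<in> carrier W \<Longrightarrow> \<theta> (rep_act W (inv g \<otimes> k \<otimes> g) w) = c * \<theta> w" and X: "X \<in> carrier R"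
  shows "ind_fun g \<theta> (rep_act R k X) = c * ind_fun g \<theta> X"
proof -
  let ?m = "inv g \<otimes> k \<otimes> g"
  obtain f where f: "f \<in> carrier T" "X = coset T B f" using R_rep_ex[OF X] by blast
  have mi: "inv ?m \<in> H" by (rule subgroup.m_inv_closed[OF H m])
  have mc: "?m \<in> carrier G" "inv ?m \<in> carrier G" by (rule H_carrier[OF m], rule H_carrier[OF mi])
  have km: "inv k \<otimes> g \<otimes> (?m \<otimes> h) = g \<otimes> h" if "h \<in> carrier G" for h
    using g k that by (simp add: m_assoc inv_mult_group) (simp add: m_assoc[symmetric])
  have "coset_fun (inv k \<otimes> g) \<theta> f = (\<Sum>h\<in>H. \<theta> (rep_act W (?m \<otimes> h) (f (inv k \<otimes> g \<otimes> (?m \<otimes> h)))))"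
    unfolding coset_fun_def
  proof (rule sum.reindex_bij_witness[of _ "\<lambda>h. ?m \<otimes> h" "\<lambda>h. inv ?m \<otimes> h"])
    fix h assume h: "h \<in> H"
    have hc: "h \<in> carrier G" by (rule H_carrier[OF h])
    show "inv ?m \<otimes> h \<in> H" "?m \<otimes> h \<in> H" using subgroup.m_closed[OF H] m mi h by blast+
    show r: "?m \<otimes> (inv ?m \<otimes> h) = h" "inv ?m \<otimes> (?m \<otimes> h) = h"
      using mc hc by (simp_all only: m_assoc[symmetric] r_inv l_inv l_one)
    show "\<theta> (rep_act W (?m \<otimes> (inv ?m \<otimes> h)) (f (inv k \<otimes> g \<otimes> (?m \<otimes> (inv ?m \<otimes> h))))) = \<theta> (rep_act W h (f (inv k \<otimes> g \<otimes> h)))"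
      unfolding r(1) ..
  qed
  also have "\<dots> = (\<Sum>h\<in>H. c * \<theta> (rep_act W h (f (g \<otimes> h))))"
  proof (rule sum.cong[OF refl])
    fix h assume h: "h \<in> H"
    have hc: "h \<in> carrier G" by (rule H_carrier[OF h])
    have fh: "f (g \<otimes> h) \<in> carrier W" by (rule T_val[OF f(1) m_closed[OF g hc]])
    show "\<theta> (rep_act W (?m \<otimes> h) (f (inv k \<otimes> g \<otimes> (?m \<otimes> h)))) = c * \<theta> (rep_act W h (f (g \<otimes> h)))"
      unfolding km[OF hc] act(5)[OF m h fh] by (rule c[OF act(1)[OF h fh]])
  qed
  also have "\<dots> = c * coset_fun g \<theta> f" unfolding coset_fun_def sum_distrib_left ..
  finally have "coset_fun (inv k \<otimes> g) \<theta> f = c * coset_fun g \<theta> f" .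
  then show ?thesis
    unfolding f(2) R_act[OF k f(1)] ind_fun_coset[OF \<theta> g f(1)] ind_fun_coset[OF \<theta> g translate_T[OF k f(1)]] coset_fun_translate[OF k g] .
qed

text \<open>The class of \<open>k \<otimes> w\<close>.\<close>

definition ind_vec :: "'g \<Rightarrow> 'v \<Rightarrow> ('g \<Rightarrow> 'v) set" where "ind_vec k w = coset T B (pure_tensor G W k w)"

lemma ind_vec_R: "w \<in> carrier W \<Longrightarrow> ind_vec k w \<in> carrier R"
  unfolding ind_vec_def R_simps(1) by (rule imageI) (rule pure_T)

lemma act_ind_vec:
  assumes k: "k \<in> carrier G" and w: "w \<in> carrier W"
  shows "rep_act R k (ind_vec \<one> w) = ind_vec k w"
proof -
  have "inv k \<otimes> x = \<one> \<longleftrightarrow> x = k" if "x \<in> carrier G" for x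
    using that k by (metis inv_closed inv_inv inv_equality l_inv)
  then have "translate k (pure_tensor G W \<one> w) = pure_tensor G W k w"
    unfolding translate_def pure_tensor_def by (intro restrict_ext) (use k in simp)
  then show ?thesis unfolding ind_vec_def R_act[OF k pure_T[OF w]] by simp
qed

lemma ind_fun_ind_vec:
  assumes \<theta>: "linear_functional W \<theta>" and g: "g \<in> carrier G" and k: "k \<in> carrier G" and w: "w \<in> carrier W"
  shows "ind_fun g \<theta> (ind_vec k w) = (if inv g \<otimes> k \<in> H then \<theta> (rep_act W (inv g \<otimes> k) w) else 0)"
  unfolding ind_vec_def ind_fun_coset[OF \<theta> g pure_T[OF w]] by (rule coset_fun_pure[OF \<theta> g k w])

end

section \<open>Induced Yetter-Drinfeld modules\<close>

locale yd_data = induction_data G H W J \<psi>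
  for G :: "('g, 'b) monoid_scheme" (structure) and H :: "'g set" and W :: "('g, 'v, 'c) rep_scheme" and J :: "'j set"
    and \<psi> :: "'j \<Rightarrow> 'v \<Rightarrow> complex" +
  fixes s :: 'g
  assumes s: "s \<in> carrier G" and Hs: "H = centralizer G s"
begin

abbreviation "M \<equiv> yd_induced G s W"

lemma M_simps:
  "carrier M = carrier R" "\<zero>\<^bsub>M\<^esub> = \<zero>\<^bsub>R\<^esub>" "add M = add R" "smult M = smult R" "rep_act M = rep_act R"
  "coact M X y = (\<Union>f\<in>X. coset T B (keep_on (\<lambda>h. h \<otimes> s \<otimes> inv h = y) f))"
  by (simp_all add: yd_induced_def Let_def Hs[symmetric] rep.defs yd_module.defs keep_on_def)

lemma M_vs: "vectorspace CC M"
  by (rule vectorspace_transfer[OF R_vs]) (simp_all add: M_simps)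

lemma conj_coset:
  assumes "g \<in> carrier G" "h \<in> H"
  shows "g \<otimes> h \<otimes> s \<otimes> inv (g \<otimes> h) = g \<otimes> s \<otimes> inv g"
proof -
  have h: "h \<in> carrier G" "h \<otimes> s = s \<otimes> h" using assms(2) unfolding Hs centralizer_def by auto
  have e: "h \<otimes> (inv h \<otimes> inv g) = inv g" using assms(1) h(1) by (simp add: m_assoc[symmetric])
  have "g \<otimes> h \<otimes> s \<otimes> inv (g \<otimes> h) = g \<otimes> (h \<otimes> s) \<otimes> (inv h \<otimes> inv g)"
    using assms(1) h(1) s by (simp add: m_assoc inv_mult_group)
  also have "\<dots> = g \<otimes> s \<otimes> inv g" unfolding h(2) using assms(1) h(1) s e by (simp add: m_assoc)
  finally show ?thesis .
qed

lemma coact_coset: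
  assumes "f \<in> carrier T"
  shows "coact M (coset T B f) y = coset T B (keep_on (\<lambda>h. h \<otimes> s \<otimes> inv h = y) f)"
  unfolding M_simps by (rule R_coact[OF _ assms]) (simp only: conj_coset)

text \<open>On the component at \<open>g\<close> the degree is \<open>g s g\<inverse>\<close>.\<close>

lemma coact_M:
  assumes X: "X \<in> carrier M"
  shows "coact M X y \<in> carrier M"
    and "linear_functional W \<theta> \<Longrightarrow> g \<in> carrier G \<Longrightarrow>
      ind_fun g \<theta> (coact M X y) = (if y = g \<otimes> s \<otimes> inv g then ind_fun g \<theta> X else 0)"
proof -
  obtain f where f: "f \<in> carrier T" "X = coset T B f" using R_rep_ex X unfolding M_simps by blast
  show "coact M X y \<in> carrier M"
    unfolding f(2) coact_coset[OF f(1)] unfolding M_simps(1) R_simps(1) by (rule imageI) (rule keep_on_T[OF f(1)])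
  assume \<theta>: "linear_functional W \<theta>" and g: "g \<in> carrier G"
  have "ind_fun g \<theta> (coact M X y) = (if g \<otimes> s \<otimes> inv g = y then coset_fun g \<theta> f else 0)"
    unfolding f(2) coact_coset[OF f(1)] ind_fun_coset[OF \<theta> g keep_on_T[OF f(1)]]
    by (rule coset_fun_keep_on[OF \<theta> g]) (simp only: conj_coset[OF g])
  then show "ind_fun g \<theta> (coact M X y) = (if y = g \<otimes> s \<otimes> inv g then ind_fun g \<theta> X else 0)"
    unfolding f(2) ind_fun_coset[OF \<theta> g f(1)] by auto
qed

end

section \<open>Functionals on irreducible representations\<close>

text \<open>The coordinates with respect to a basis.\<close>

lemma finite_dim_separating:
  assumes V: "vectorspace CC (V :: (complex, 'v, 'c) module_scheme)" and fd: "vectorspace.fin_dim CC V"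
  shows "\<exists>(J :: 'v set) \<psi>. separating V J \<psi>"
proof -
  interpret va: abelian_group V by (rule vs_abelian[OF V])
  interpret v: vectorspace CC V by fact
  obtain \<beta> where \<beta>: "finite \<beta>" "v.basis \<beta>" using v.finite_basis_exists[OF fd] by blast
  have bc: "\<beta> \<subseteq> carrier V" and li: "\<not> v.lin_dep \<beta>" and gen: "v.span \<beta> = carrier V" using \<beta>(2) unfolding v.basis_def by auto
  define F where "F a = finsum V (\<lambda>b. a b \<odot>\<^bsub>V\<^esub> b) \<beta>" for a
  have sm: "c \<odot>\<^bsub>V\<^esub> b \<in> carrier V" if "b \<in> \<beta>" for b c using vs_smult[OF V] bc that by blast
  have ex: "\<exists>a. F a = y" if "y \<in> carrier V" for y
    using that unfolding gen[symmetric] v.finite_span[OF \<beta>(1) bc] v.lincomb_def F_def by blast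
  have add: "F (\<lambda>b. a b + a' b) = F a \<oplus>\<^bsub>V\<^esub> F a'" for a a'
  proof -
    have "F (\<lambda>b. a b + a' b) = finsum V (\<lambda>b. a b \<odot>\<^bsub>V\<^esub> b \<oplus>\<^bsub>V\<^esub> a' b \<odot>\<^bsub>V\<^esub> b) \<beta>"
      unfolding F_def by (rule va.finsum_cong') (use sm vs_ldist[OF V] bc in auto)
    also have "\<dots> = F a \<oplus>\<^bsub>V\<^esub> F a'" unfolding F_def by (rule va.finsum_addf) (use sm in auto)
    finally show ?thesis .
  qed
  have smul: "F (\<lambda>b. c * a b) = c \<odot>\<^bsub>V\<^esub> F a" for c a
  proof -
    have "F (\<lambda>b. c * a b) = finsum V (\<lambda>b. c \<odot>\<^bsub>V\<^esub> (a b \<odot>\<^bsub>V\<^esub> b)) \<beta>"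
      unfolding F_def by (rule va.finsum_cong') (use sm vs_compat[OF V] vs_smult[OF V] bc in auto)
    also have "\<dots> = c \<odot>\<^bsub>V\<^esub> F a" unfolding F_def by (rule v.finsum_smult_ldistr[symmetric]) (use \<beta>(1) sm in auto)
    finally show ?thesis .
  qed
  have Fc: "F a \<in> carrier V" for a unfolding F_def by (rule va.finsum_closed) (use sm in auto)
  have uniq: "a b = a' b" if e: "F a = F a'" and b: "b \<in> \<beta>" for a a' b
  proof -
    have "F (\<lambda>b. a b + (-1) * a' b) = \<zero>\<^bsub>V\<^esub>"
      unfolding add smul e using vs_neg[OF V Fc[of a']] vs_comm[OF V Fc[of a'] vs_smult[OF V Fc[of a']]] by simp
    then have "v.lincomb (\<lambda>b. a b + (-1) * a' b) \<beta> = \<zero>\<^bsub>V\<^esub>" unfolding v.lincomb_def F_def .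
    from v.not_lindepD[OF li \<beta>(1) subset_refl _ this] b show ?thesis by auto
  qed
  define \<psi> where "\<psi> b y = (SOME a. F a = y) b" for b y
  have \<psi>F: "F (\<lambda>b. \<psi> b y) = y" if "y \<in> carrier V" for y
    unfolding \<psi>_def using someI_ex[OF ex[OF that]] .
  have "linear_functional V (\<psi> b)" if b: "b \<in> \<beta>" for b
    unfolding linear_functional_def
  proof (intro conjI ballI allI)
    fix y z assume y: "y \<in> carrier V" and z: "z \<in> carrier V"
    show "\<psi> b (y \<oplus>\<^bsub>V\<^esub> z) = \<psi> b y + \<psi> b z"
      by (rule uniq[OF _ b, of "\<lambda>b. \<psi> b (y \<oplus>\<^bsub>V\<^esub> z)" "\<lambda>b. \<psi> b y + \<psi> b z"]) (simp only: add \<psi>F y z vs_add[OF V])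
  next
    fix c y assume y: "y \<in> carrier V"
    show "\<psi> b (c \<odot>\<^bsub>V\<^esub> y) = c * \<psi> b y"
      by (rule uniq[OF _ b, of "\<lambda>b. \<psi> b (c \<odot>\<^bsub>V\<^esub> y)" "\<lambda>b. c * \<psi> b y"]) (simp only: smul \<psi>F y vs_smult[OF V])
  qed
  moreover have "y = \<zero>\<^bsub>V\<^esub>" if y: "y \<in> carrier V" and z: "\<forall>b\<in>\<beta>. \<psi> b y = 0" for y
  proof -
    have "F (\<lambda>b. \<psi> b y) = finsum V (\<lambda>b. \<zero>\<^bsub>V\<^esub>) \<beta>"
      unfolding F_def by (rule va.finsum_cong') (use z vs_zero_smult[OF V] vs_zero[OF V] bc in auto)
    then show ?thesis unfolding \<psi>F[OF y] by simp
  qed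
  ultimately show ?thesis unfolding separating_def using \<beta>(1) by blast
qed

text \<open>The orbit of a nonzero vector is finite and spans a nonzero stable subspace.\<close>

lemma irreducible_fin_dim:
  assumes irr: "irreducible_rep K W" and fin: "finite (carrier K)"
  shows "vectorspace.fin_dim CC W"
proof -
  have rep: "representation K W" using irr unfolding irreducible_rep_def by simp
  note R = representationD[OF rep]
  interpret K: group K by (rule R(1))
  obtain v where v: "v \<in> carrier W" "v \<noteq> \<zero>\<^bsub>W\<^esub>"
    using irr vs_zero[OF R(2)] unfolding irreducible_rep_def by blast
  define S where "S = (\<lambda>k. rep_act W k v) ` carrier K"
  have S: "S \<subseteq> carrier W" unfolding S_def using R(3) v(1) by blast
  define U where "U = lin_span W S"
  have U: "submodule CC U W" unfolding U_def by (rule lin_span_submodule[OF R(2) S])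
  have SU: "S \<subseteq> U" unfolding U_def by (rule lin_span_superset[OF R(2) S])
  have inv: "rep_act W g ` U \<subseteq> U" if g: "g \<in> carrier K" for g
  proof -
    let ?N = "{y \<in> carrier W. rep_act W g y \<in> U}"
    have z: "rep_act W g \<zero>\<^bsub>W\<^esub> = \<zero>\<^bsub>W\<^esub>"
      using R(5)[OF g vs_zero[OF R(2)], of 0] vs_zero_smult[OF R(2) R(3)[OF g vs_zero[OF R(2)]]] vs_smult_zero[OF R(2), of 0] by simp
    have N: "submodule CC ?N W"
      by (rule submoduleI_CC[OF R(2)])
        (use z submoduleD_CC(2-4)[OF U] vs_zero[OF R(2)] vs_add[OF R(2)] vs_smult[OF R(2)] R(4,5)[OF g] in auto)
    have "S \<subseteq> ?N"
    proof
      fix y assume "y \<in> S"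
      then obtain k where k: "k \<in> carrier K" "y = rep_act W k v" unfolding S_def by blast
      have "rep_act W g y = rep_act W (g \<otimes>\<^bsub>K\<^esub> k) v" unfolding k(2) using R(7)[OF g k(1) v(1)] by simp
      then have "rep_act W g y \<in> S" unfolding S_def using g k(1) by simp
      then show "y \<in> ?N" using \<open>y \<in> S\<close> S SU by blast
    qed
    then have "U \<subseteq> ?N" unfolding U_def by (rule lin_span_least[OF R(2) S]) (use N[unfolded U_def] in simp)
    then show ?thesis by blast
  qed
  have "VectorSpace.subspace CC U W" unfolding VectorSpace.subspace_def using R(2) U by simp
  then have "U = {\<zero>\<^bsub>W\<^esub>} \<or> U = carrier W" using irr inv unfolding irreducible_rep_def by blast
  moreover have "v \<in> U" using SU R(6)[OF v(1)] unfolding S_def by force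
  ultimately have "U = carrier W" using v(2) by blast
  moreover have "finite S" unfolding S_def using fin by simp
  ultimately show ?thesis unfolding fin_dim_iff[OF R(2)] U_def using S by blast
qed

lemma irreducible_separating:
  assumes "irreducible_rep K (W :: ('g, 'v, 'c) rep_scheme)" "finite (carrier K)"
  obtains J :: "'v set" and \<psi> j v where "separating W J \<psi>" "j \<in> J" "v \<in> carrier W" "\<psi> j v = 1"
proof -
  have rep: "representation K W" using assms(1) unfolding irreducible_rep_def by simp
  note V = representationD(2)[OF rep]
  obtain J :: "'v set" and \<psi> where s: "separating W J \<psi>"
    using finite_dim_separating[OF V irreducible_fin_dim[OF assms]] by blast
  obtain v where v: "v \<in> carrier W" "v \<noteq> \<zero>\<^bsub>W\<^esub>"
    using assms(1) vs_zero[OF V] unfolding irreducible_rep_def by blast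
  obtain j where j: "j \<in> J" "\<psi> j v \<noteq> 0" using s v unfolding separating_def by blast
  have l: "linear_functional W (\<psi> j)" using s j unfolding separating_def by blast
  have "\<psi> j ((1 / \<psi> j v) \<odot>\<^bsub>W\<^esub> v) = 1" using linear_functionalD(2)[OF l v(1)] j(2) by simp
  then show thesis using that s j(1) vs_smult[OF V v(1)] by blast
qed

section \<open>The semidirect product\<close>

locale AS =
  fixes n :: nat and A :: "(nat \<Rightarrow> int) set" and \<sigma> :: "nat \<Rightarrow> int" and \<chi> :: "(nat \<Rightarrow> int) \<Rightarrow> complex"
  assumes A_sub: "subgroup A (Z2_power n)"
    and A_stable: "\<forall>h\<in>carrier (sym_group n). \<forall>a\<in>A. perm_act h a \<in> A"
    and \<sigma>: "\<sigma> \<in> A"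
    and \<chi>: "\<chi> \<in> characters n A"
begin

abbreviation "G \<equiv> AS_group n A"
abbreviation "S \<equiv> carrier (sym_group n)"
abbreviation plus2 (infixl "+\<^sub>2" 65) where "a +\<^sub>2 b \<equiv> a \<otimes>\<^bsub>Z2_power n\<^esub> b"
abbreviation "zero2 \<equiv> \<one>\<^bsub>Z2_power n\<^esub>"

lemma Z2_simps:
  "carrier (Z2_power n) = (\<Pi>\<^sub>E i\<in>{1..n}. {0..<2})"
  "a +\<^sub>2 b = (\<lambda>i\<in>{1..n}. (a i + b i) mod 2)" "zero2 = (\<lambda>i\<in>{1..n}. 0)"
  by (simp_all add: Z2_power_def product_group_def carrier_integer_mod_group)

lemma Z2_group: "group (Z2_power n)"
  unfolding Z2_power_def by (rule product_group) (rule group_integer_mod_group)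

lemma A_carrier: "a \<in> A \<Longrightarrow> a \<in> carrier (Z2_power n)" using subgroup.subset[OF A_sub] by blast

lemma finite_A: "finite A"
  by (rule finite_subset[OF subgroup.subset[OF A_sub]]) (simp add: Z2_simps finite_PiE)

lemma A_closed: "a \<in> A \<Longrightarrow> b \<in> A \<Longrightarrow> a +\<^sub>2 b \<in> A" by (rule subgroup.m_closed[OF A_sub])
lemma A_zero: "zero2 \<in> A" by (rule subgroup.one_closed[OF A_sub])

lemma plus2_comm: "a +\<^sub>2 b = b +\<^sub>2 a" unfolding Z2_simps by (simp add: add.commute)
lemma plus2_assoc: "a \<in> A \<Longrightarrow> b \<in> A \<Longrightarrow> c \<in> A \<Longrightarrow> a +\<^sub>2 b +\<^sub>2 c = a +\<^sub>2 (b +\<^sub>2 c)"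
  by (intro monoid.m_assoc[OF group.is_monoid[OF Z2_group]] A_carrier)
lemma plus2_self: "a +\<^sub>2 a = zero2" unfolding Z2_simps by (rule restrict_ext) simp
lemma plus2_zero: "a \<in> A \<Longrightarrow> a +\<^sub>2 zero2 = a" "a \<in> A \<Longrightarrow> zero2 +\<^sub>2 a = a"
  using group.is_monoid[OF Z2_group] A_carrier by (simp_all add: monoid.r_one monoid.l_one)
lemma plus2_cancel: "a \<in> A \<Longrightarrow> b \<in> A \<Longrightarrow> c \<in> A \<Longrightarrow> a +\<^sub>2 b = a +\<^sub>2 c \<longleftrightarrow> b = c"
  by (metis plus2_assoc plus2_self plus2_zero(2))

lemma perm_id: "perm_act id a = a" unfolding perm_act_def by simp

lemma S_iff: "g \<in> S \<longleftrightarrow> g permutes {1..n}" by (simp add: sym_group_def)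

lemma S_bij: "g \<in> S \<Longrightarrow> bij g" unfolding S_iff by (rule permutes_bij)
lemma S_id: "id \<in> S" unfolding S_iff by (rule permutes_id)
lemma S_comp: "g \<in> S \<Longrightarrow> h \<in> S \<Longrightarrow> g \<circ> h \<in> S" unfolding S_iff by (rule permutes_compose)
lemma S_inv: "g \<in> S \<Longrightarrow> Hilbert_Choice.inv g \<in> S" unfolding S_iff by (rule permutes_inv)
lemma S_inv_simps: "g \<in> S \<Longrightarrow> g \<circ> Hilbert_Choice.inv g = id" "g \<in> S \<Longrightarrow> Hilbert_Choice.inv g \<circ> g = id"
  "g \<in> S \<Longrightarrow> Hilbert_Choice.inv (Hilbert_Choice.inv g) = g"
  unfolding S_iff by (fact permutes_inv_o permutes_inv_inv)+
lemma S_inv_comp: "g \<in> S \<Longrightarrow> h \<in> S \<Longrightarrow> Hilbert_Choice.inv (g \<circ> h) = Hilbert_Choice.inv h \<circ> Hilbert_Choice.inv g"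
  by (rule o_inv_distrib[OF S_bij S_bij])
lemma finite_S: "finite S" unfolding sym_group_def using finite_permutations[of "{1..n}"] by simp

lemma perm_comp: "g \<in> S \<Longrightarrow> h \<in> S \<Longrightarrow> perm_act (g \<circ> h) a = perm_act g (perm_act h a)"
  unfolding perm_act_def S_inv_comp by simp

lemma perm_inv: "g \<in> S \<Longrightarrow> perm_act (Hilbert_Choice.inv g) (perm_act g a) = a"
  "g \<in> S \<Longrightarrow> perm_act g (perm_act (Hilbert_Choice.inv g) a) = a"
  using perm_comp[OF S_inv, symmetric] perm_comp[OF _ S_inv, symmetric] by (simp_all only: S_inv_simps perm_id)

lemma perm_A: "g \<in> S \<Longrightarrow> a \<in> A \<Longrightarrow> perm_act g a \<in> A" using A_stable by blast

lemma perm_plus2: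
  assumes "g \<in> S"
  shows "perm_act g (a +\<^sub>2 b) = perm_act g a +\<^sub>2 perm_act g b"
proof
  fix i
  have "Hilbert_Choice.inv g i \<in> {1..n} \<longleftrightarrow> i \<in> {1..n}" by (rule permutes_in_image[OF S_inv[OF assms, unfolded S_iff]])
  then show "perm_act g (a +\<^sub>2 b) i = (perm_act g a +\<^sub>2 perm_act g b) i"
    unfolding perm_act_def Z2_simps by simp
qed

lemma perm_zero2: "g \<in> S \<Longrightarrow> perm_act g zero2 = zero2"
  using perm_plus2[of g zero2 zero2] unfolding plus2_self plus2_self[of "perm_act g zero2"] .

lemma G_simps:
  "carrier G = A \<times> S" "(a, x) \<otimes>\<^bsub>G\<^esub> (b, y) = (a +\<^sub>2 perm_act x b, x \<circ> y)" "\<one>\<^bsub>G\<^esub> = (zero2, id)"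
  by (simp_all add: AS_group_def semidirect_def A_group_def sym_group_def[THEN arg_cong[of _ _ mult]] sym_group_def[THEN arg_cong[of _ _ one]])

lemma G_inv_aux:
  assumes "a \<in> A" "x \<in> S"
  shows "(perm_act (Hilbert_Choice.inv x) a, Hilbert_Choice.inv x) \<otimes>\<^bsub>G\<^esub> (a, x) = \<one>\<^bsub>G\<^esub>"
  unfolding G_simps plus2_self S_inv_simps(2)[OF assms(2)] ..

lemma G_group: "group G"
proof (rule groupI)
  fix g assume "g \<in> carrier G"
  then obtain a x where g: "g = (a, x)" "a \<in> A" "x \<in> S" unfolding G_simps by auto
  show "\<one>\<^bsub>G\<^esub> \<otimes>\<^bsub>G\<^esub> g = g" unfolding g(1) G_simps perm_id plus2_zero[OF g(2)] by simp
  show "\<exists>h\<in>carrier G. h \<otimes>\<^bsub>G\<^esub> g = \<one>\<^bsub>G\<^esub>"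
    unfolding g(1)
  proof (rule bexI[of _ "(perm_act (Hilbert_Choice.inv x) a, Hilbert_Choice.inv x)"])
    show "(perm_act (Hilbert_Choice.inv x) a, Hilbert_Choice.inv x) \<otimes>\<^bsub>G\<^esub> (a, x) = \<one>\<^bsub>G\<^esub>" by (rule G_inv_aux[OF g(2,3)])
    show "(perm_act (Hilbert_Choice.inv x) a, Hilbert_Choice.inv x) \<in> carrier G"
      unfolding G_simps by (rule SigmaI[OF perm_A[OF S_inv[OF g(3)] g(2)] S_inv[OF g(3)]])
  qed
  fix h assume "h \<in> carrier G"
  then obtain b y where h: "h = (b, y)" "b \<in> A" "y \<in> S" unfolding G_simps by auto
  show "g \<otimes>\<^bsub>G\<^esub> h \<in> carrier G"
    unfolding g(1) h(1) G_simps by (intro SigmaI A_closed g(2) perm_A g(3) h(2) S_comp h(3))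
  fix k assume "k \<in> carrier G"
  then obtain c z where k: "k = (c, z)" "c \<in> A" "z \<in> S" unfolding G_simps by auto
  show "g \<otimes>\<^bsub>G\<^esub> h \<otimes>\<^bsub>G\<^esub> k = g \<otimes>\<^bsub>G\<^esub> (h \<otimes>\<^bsub>G\<^esub> k)"
    unfolding g(1) h(1) k(1) G_simps perm_comp[OF g(3) h(3)] perm_plus2[OF g(3)]
      plus2_assoc[OF g(2) perm_A[OF g(3) h(2)] perm_A[OF g(3) perm_A[OF h(3) k(2)]]] o_assoc ..
next
  show "\<one>\<^bsub>G\<^esub> \<in> carrier G" unfolding G_simps by (rule SigmaI[OF A_zero S_id])
qed

sublocale G: group G by (rule G_group)

lemma finite_G: "finite (carrier G)" unfolding G_simps using finite_A finite_S by (rule finite_cartesian_product)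

lemma G_carrierD: "g \<in> carrier G \<Longrightarrow> fst g \<in> A" "g \<in> carrier G \<Longrightarrow> snd g \<in> S"
  unfolding G_simps by auto

lemma G_inv: "a \<in> A \<Longrightarrow> x \<in> S \<Longrightarrow> inv\<^bsub>G\<^esub> (a, x) = (perm_act (Hilbert_Choice.inv x) a, Hilbert_Choice.inv x)"
  by (rule G.inv_equality[OF G_inv_aux]) (simp_all add: G_simps perm_A S_inv)

text \<open>As \<open>A\<close> is abelian, conjugation on \<open>A\<close> only involves the permutation.\<close>

lemma G_conj:
  assumes g: "g \<in> carrier G" and b: "b \<in> A"
  shows "g \<otimes>\<^bsub>G\<^esub> (b, id) \<otimes>\<^bsub>G\<^esub> inv\<^bsub>G\<^esub> g = (perm_act (snd g) b, id)"
    and "inv\<^bsub>G\<^esub> g \<otimes>\<^bsub>G\<^esub> (b, id) \<otimes>\<^bsub>G\<^esub> g = (perm_act (Hilbert_Choice.inv (snd g)) b, id)"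
proof -
  obtain a x where ax: "g = (a, x)" "a \<in> A" "x \<in> S" using g unfolding G_simps by auto
  have c: "(c, id) \<in> carrier G" if "c \<in> A" for c unfolding G_simps by (rule SigmaI[OF that S_id])
  have comm: "g \<otimes>\<^bsub>G\<^esub> (c, id) = (perm_act x c, id) \<otimes>\<^bsub>G\<^esub> g" for c
    unfolding ax(1) G_simps perm_id plus2_comm[of a] by simp
  have "g \<otimes>\<^bsub>G\<^esub> (b, id) \<otimes>\<^bsub>G\<^esub> inv\<^bsub>G\<^esub> g = (perm_act x b, id)"
    unfolding comm using g c[OF perm_A[OF ax(3) b]] by (simp add: G.m_assoc)
  then show "g \<otimes>\<^bsub>G\<^esub> (b, id) \<otimes>\<^bsub>G\<^esub> inv\<^bsub>G\<^esub> g = (perm_act (snd g) b, id)" unfolding ax(1) by simp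
  let ?d = "(perm_act (Hilbert_Choice.inv x) b, id) :: (nat \<Rightarrow> int) \<times> (nat \<Rightarrow> nat)"
  have d: "?d \<in> carrier G" by (rule c[OF perm_A[OF S_inv[OF ax(3)] b]])
  have "(b, id) \<otimes>\<^bsub>G\<^esub> g = g \<otimes>\<^bsub>G\<^esub> ?d" unfolding comm perm_inv(2)[OF ax(3)] ..
  then have "inv\<^bsub>G\<^esub> g \<otimes>\<^bsub>G\<^esub> (b, id) \<otimes>\<^bsub>G\<^esub> g = inv\<^bsub>G\<^esub> g \<otimes>\<^bsub>G\<^esub> (g \<otimes>\<^bsub>G\<^esub> ?d)"
    using g c[OF b] by (simp only: G.m_assoc G.inv_closed)
  also have "\<dots> = ?d" using g d by (simp add: G.m_assoc[symmetric])
  finally show "inv\<^bsub>G\<^esub> g \<otimes>\<^bsub>G\<^esub> (b, id) \<otimes>\<^bsub>G\<^esub> g = (perm_act (Hilbert_Choice.inv (snd g)) b, id)" unfolding ax(1) by simp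
qed

lemma G_ratio:
  assumes "u \<in> S" "w \<in> S"
  shows "inv\<^bsub>G\<^esub> (zero2, u) \<otimes>\<^bsub>G\<^esub> (zero2, w) = (zero2, Hilbert_Choice.inv u \<circ> w)"
  unfolding G_inv[OF A_zero assms(1)] G_simps perm_zero2[OF S_inv[OF assms(1)]] plus2_zero[OF A_zero] ..

abbreviation "s \<equiv> (\<sigma>, id) :: (nat \<Rightarrow> int) \<times> (nat \<Rightarrow> nat)"
abbreviation "C \<equiv> centralizer G s"
abbreviation "K \<equiv> char_stab n A \<sigma> \<chi>"
abbreviation "H \<equiv> A \<times> K"

lemma s_G: "s \<in> carrier G" unfolding G_simps by (rule SigmaI[OF \<sigma> S_id])

lemma C_iff: "g \<in> C \<longleftrightarrow> fst g \<in> A \<and> snd g \<in> S \<and> perm_act (snd g) \<sigma> = \<sigma>"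
proof (cases g)
  case (Pair a x)
  have "(a, x) \<otimes>\<^bsub>G\<^esub> s = s \<otimes>\<^bsub>G\<^esub> (a, x) \<longleftrightarrow> perm_act x \<sigma> = \<sigma>" if "a \<in> A" "x \<in> S"
    unfolding G_simps perm_id plus2_comm[of \<sigma>] using plus2_cancel[OF that(1) perm_A[OF that(2) \<sigma>] \<sigma>] by simp
  then show ?thesis unfolding Pair centralizer_def G_simps(1) by auto
qed

lemma K_iff: "x \<in> K \<longleftrightarrow> x \<in> S \<and> perm_act x \<sigma> = \<sigma> \<and> (\<forall>a\<in>A. \<chi> (perm_act (Hilbert_Choice.inv x) a) = \<chi> a)"
  unfolding char_stab_def sym_stab_def by auto

lemma K_chi: "x \<in> K \<Longrightarrow> a \<in> A \<Longrightarrow> \<chi> (perm_act x a) = \<chi> a"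
  unfolding K_iff using perm_A perm_inv(1) by metis

lemma K_id: "id \<in> K" unfolding K_iff using S_id by (simp add: perm_id inv_id)

lemma K_comp:
  assumes "x \<in> K" "y \<in> K" shows "x \<circ> y \<in> K"
proof -
  note x = assms(1)[unfolded K_iff] and y = assms(2)[unfolded K_iff]
  have xS: "x \<in> S" and yS: "y \<in> S" using x y by auto
  note i = S_inv_comp[OF xS yS]
  have "\<chi> (perm_act (Hilbert_Choice.inv (x \<circ> y)) a) = \<chi> a" if "a \<in> A" for a
    unfolding i perm_comp[OF S_inv[OF yS] S_inv[OF xS]] using x y that perm_A[OF S_inv[OF xS]] by simp
  then show ?thesis unfolding K_iff using S_comp[OF xS yS] perm_comp[OF xS yS] x y by simp
qed

lemma K_inv: "x \<in> K \<Longrightarrow> Hilbert_Choice.inv x \<in> K"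
proof -
  assume x: "x \<in> K"
  then have xS: "x \<in> S" and xs: "perm_act x \<sigma> = \<sigma>" unfolding K_iff by auto
  have "perm_act (Hilbert_Choice.inv x) \<sigma> = \<sigma>" using perm_inv(1)[OF xS, of \<sigma>] unfolding xs .
  then show ?thesis unfolding K_iff using S_inv[OF xS] K_chi[OF x] S_inv_simps(3)[OF xS] by simp
qed

lemma C_subgroup: "subgroup C G"
proof (rule G.subgroupI)
  show "C \<subseteq> carrier G" unfolding centralizer_def by blast
  have "\<one>\<^bsub>G\<^esub> \<in> C" unfolding centralizer_def using s_G by simp
  then show "C \<noteq> {}" by blast
next
  fix g assume "g \<in> C"
  then have g: "g \<in> carrier G" "g \<otimes>\<^bsub>G\<^esub> s = s \<otimes>\<^bsub>G\<^esub> g" unfolding centralizer_def by auto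
  have "inv\<^bsub>G\<^esub> g \<otimes>\<^bsub>G\<^esub> s = inv\<^bsub>G\<^esub> g \<otimes>\<^bsub>G\<^esub> (s \<otimes>\<^bsub>G\<^esub> g) \<otimes>\<^bsub>G\<^esub> inv\<^bsub>G\<^esub> g" using g(1) s_G by (simp add: G.m_assoc)
  also have "\<dots> = s \<otimes>\<^bsub>G\<^esub> inv\<^bsub>G\<^esub> g" unfolding g(2)[symmetric] using g(1) s_G by (simp add: G.m_assoc[symmetric])
  finally show "inv\<^bsub>G\<^esub> g \<in> C" unfolding centralizer_def using g(1) by simp
  fix h assume "h \<in> C"
  then have h: "h \<in> carrier G" "h \<otimes>\<^bsub>G\<^esub> s = s \<otimes>\<^bsub>G\<^esub> h" unfolding centralizer_def by auto
  have "g \<otimes>\<^bsub>G\<^esub> h \<otimes>\<^bsub>G\<^esub> s = g \<otimes>\<^bsub>G\<^esub> s \<otimes>\<^bsub>G\<^esub> h" using g(1) h s_G by (simp add: G.m_assoc)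
  also have "\<dots> = s \<otimes>\<^bsub>G\<^esub> (g \<otimes>\<^bsub>G\<^esub> h)" unfolding g(2) using g(1) h s_G by (simp add: G.m_assoc)
  finally show "g \<otimes>\<^bsub>G\<^esub> h \<in> C" unfolding centralizer_def using g(1) h(1) by simp
qed

lemma H_subset: "H \<subseteq> C"
proof
  fix g assume "g \<in> H"
  then show "g \<in> C" unfolding C_iff by (auto simp: K_iff)
qed

lemma H_subgroup: "subgroup H G"
proof (rule G.subgroupI)
  show "H \<subseteq> carrier G" unfolding G_simps by (rule Sigma_mono) (auto simp: K_iff)
  show "H \<noteq> {}" using A_zero K_id by blast
next
  fix g assume "g \<in> H"
  then obtain a x where g: "g = (a, x)" "a \<in> A" "x \<in> K" by blast
  have x: "x \<in> S" using g(3) unfolding K_iff by simp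
  show "inv\<^bsub>G\<^esub> g \<in> H" unfolding g(1) G_inv[OF g(2) x] using perm_A[OF S_inv[OF x] g(2)] K_inv[OF g(3)] by blast
  fix h assume "h \<in> H"
  then obtain b y where h: "h = (b, y)" "b \<in> A" "y \<in> K" by blast
  show "g \<otimes>\<^bsub>G\<^esub> h \<in> H" unfolding g(1) h(1) G_simps using A_closed[OF g(2) perm_A[OF x h(2)]] K_comp[OF g(3) h(3)] by blast
qed

lemma chi_mult: "a \<in> A \<Longrightarrow> b \<in> A \<Longrightarrow> \<chi> (a +\<^sub>2 b) = \<chi> a * \<chi> b"
  using \<chi> unfolding characters_def hom_def by (auto simp: A_group_def units_of_def)

lemma chi_zero2: "\<chi> zero2 = 1"
proof -
  have "\<chi> zero2 \<in> Units CC" using \<chi> A_zero unfolding characters_def hom_def by (auto simp: A_group_def units_of_def)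
  then have "\<chi> zero2 \<noteq> 0" unfolding Units_def by auto
  moreover have "\<chi> zero2 * \<chi> zero2 = \<chi> zero2" using chi_mult[OF A_zero A_zero] unfolding plus2_self by simp
  ultimately show ?thesis by simp
qed

lemma chi_sign: "a \<in> A \<Longrightarrow> \<chi> a = 1 \<or> \<chi> a = -1"
  using chi_mult[of a a] unfolding plus2_self chi_zero2 by (metis square_eq_1_iff)

end

section \<open>The finiteness criterion\<close>

context AS
begin

text \<open>The braiding matrix of the modules considered is \<open>orbit_sign (inv (t b) \<circ> t a)\<close>; by \<open>orbit_sign_K\<close> it
  is a function on double cosets of the stabilizer of \<open>\<sigma>\<close> and \<open>\<chi>\<close>.\<close>

definition orbit_sign :: "(nat \<Rightarrow> nat) \<Rightarrow> complex" where "orbit_sign u = \<chi> (perm_act u \<sigma>)"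

lemma orbit_sign_sign: "u \<in> S \<Longrightarrow> orbit_sign u = 1 \<or> orbit_sign u = -1"
  unfolding orbit_sign_def by (intro chi_sign perm_A \<sigma>)

lemma orbit_sign_id: "orbit_sign id = \<chi> \<sigma>" unfolding orbit_sign_def perm_id ..

lemma orbit_sign_K:
  assumes "g \<in> S" "k \<in> K"
  shows "orbit_sign (g \<circ> k) = orbit_sign g" "orbit_sign (k \<circ> g) = orbit_sign g"
proof -
  have k: "k \<in> S" "perm_act k \<sigma> = \<sigma>" using assms(2) unfolding K_iff by auto
  show "orbit_sign (g \<circ> k) = orbit_sign g" unfolding orbit_sign_def perm_comp[OF assms(1) k(1)] k(2) ..
  show "orbit_sign (k \<circ> g) = orbit_sign g" unfolding orbit_sign_def perm_comp[OF k(1) assms(1)] by (rule K_chi[OF assms(2) perm_A[OF assms(1) \<sigma>]])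
qed

lemma S_pow: "u \<in> S \<Longrightarrow> u ^^ j \<in> S"
  by (induction j) (simp_all only: funpow.simps S_id S_comp)

lemma S_pow_ratio:
  assumes u: "u \<in> S" and "i \<le> j"
  shows "Hilbert_Choice.inv (u ^^ i) \<circ> u ^^ j = u ^^ (j - i)"
proof -
  have "u ^^ j = u ^^ i \<circ> u ^^ (j - i)" unfolding funpow_add[symmetric] using assms(2) by simp
  then show ?thesis unfolding o_assoc by (simp only: o_assoc S_inv_simps(2)[OF S_pow[OF u]] id_o)
qed

text \<open>All vertices carry \<open>-1\<close> and there are no edges.\<close>

definition trivial_braiding :: bool where
  "trivial_braiding \<longleftrightarrow> \<chi> \<sigma> = -1 \<and> (\<forall>u\<in>S. orbit_sign u * orbit_sign (Hilbert_Choice.inv u) = 1)"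

end

text \<open>A Yetter-Drinfeld module with functionals \<open>\<phi> a\<close>, each attached to a permutation \<open>t a\<close>: its degree is the
  translate of \<open>\<sigma>\<close>, and \<open>A\<close> acts on it through the translate of \<open>\<chi>\<close>, by \<open>t a\<close>.  The last condition provides dual
  vectors for each permutation, which are orthogonal for different cosets of \<open>char_stab n A \<sigma> \<chi>\<close>.
  This description is stable under direct sums, and the braiding matrix is the same for all modules
  with the same \<open>\<sigma>\<close> and \<open>\<chi>\<close>.\<close>

locale orbit_frame = AS n A \<sigma> \<chi>
  for n :: nat and A :: "(nat \<Rightarrow> int) set" and \<sigma> :: "nat \<Rightarrow> int" and \<chi> :: "(nat \<Rightarrow> int) \<Rightarrow> complex" +
  fixes M :: "((nat \<Rightarrow> int) \<times> (nat \<Rightarrow> nat), 'm, 'c) yd_module_scheme" and I :: "'a set"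
    and \<phi> :: "'a \<Rightarrow> 'm \<Rightarrow> complex" and t :: "'a \<Rightarrow> nat \<Rightarrow> nat"
  assumes M_vs: "vectorspace CC M"
    and sep: "separating M I \<phi>"
    and act_closed: "\<And>g y. g \<in> carrier G \<Longrightarrow> y \<in> carrier M \<Longrightarrow> rep_act M g y \<in> carrier M"
    and coact_closed: "\<And>g y. g \<in> carrier G \<Longrightarrow> y \<in> carrier M \<Longrightarrow> coact M y g \<in> carrier M"
    and t: "\<And>a. a \<in> I \<Longrightarrow> t a \<in> S"
    and \<phi>_coact: "\<And>a y g. a \<in> I \<Longrightarrow> y \<in> carrier M \<Longrightarrow> g \<in> carrier G \<Longrightarrow>
      \<phi> a (coact M y g) = (if g = (perm_act (t a) \<sigma>, id) then \<phi> a y else 0)"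
    and \<phi>_act: "\<And>a b y. a \<in> I \<Longrightarrow> b \<in> A \<Longrightarrow> y \<in> carrier M \<Longrightarrow>
      \<phi> a (rep_act M (b, id) y) = \<chi> (perm_act (Hilbert_Choice.inv (t a)) b) * \<phi> a y"
    and dual: "\<exists>idx y. \<forall>u\<in>S. idx u \<in> I \<and> t (idx u) = u \<and> y u \<in> carrier M \<and> \<phi> (idx u) (y u) = 1 \<and>
      (\<forall>w\<in>S. Hilbert_Choice.inv u \<circ> w \<notin> K \<longrightarrow> \<phi> (idx u) (y w) = 0)"
begin

definition q :: "'a \<Rightarrow> 'a \<Rightarrow> complex" where
  "q a b = (if a \<in> I \<and> b \<in> I then orbit_sign (Hilbert_Choice.inv (t b) \<circ> t a) else -1)"

lemma frame:
  obtains x where "diag_frame G M I \<phi> x q (\<lambda>a. (perm_act (t a) \<sigma>, id))"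
proof -
  obtain x where x: "\<forall>a\<in>I. x a \<in> carrier M" "\<forall>y\<in>carrier M. finsum M (\<lambda>a. \<phi> a y \<odot>\<^bsub>M\<^esub> x a) I = y"
    using frame_exists[OF M_vs sep] by (elim exE conjE)
  have lin: "linear_functional M (\<phi> a)" if "a \<in> I" for a using sep that unfolding separating_def by blast
  have "diag_frame G M I \<phi> x q (\<lambda>a. (perm_act (t a) \<sigma>, id))"
  proof (intro diag_frame.intro coord_space.intro diag_frame_axioms.intro)
    show "finite I" using sep unfolding separating_def by blast
    show "finite (carrier G)" by (rule finite_G)
    show "vectorspace CC M" by (rule M_vs)
    fix a b g y z c
    show "y \<in> carrier M \<Longrightarrow> finsum M (\<lambda>a. \<phi> a y \<odot>\<^bsub>M\<^esub> x a) I = y" by (rule bspec[OF x(2)])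
    assume a: "a \<in> I"
    show "y \<in> carrier M \<Longrightarrow> z \<in> carrier M \<Longrightarrow> \<phi> a (y \<oplus>\<^bsub>M\<^esub> z) = \<phi> a y + \<phi> a z" by (rule linear_functionalD(1)[OF lin[OF a]])
    show "y \<in> carrier M \<Longrightarrow> \<phi> a (c \<odot>\<^bsub>M\<^esub> y) = c * \<phi> a y" by (rule linear_functionalD(2)[OF lin[OF a]])
    show "x a \<in> carrier M" by (rule bspec[OF x(1) a])
    show "(perm_act (t a) \<sigma>, id) \<in> carrier G" unfolding G_simps by (intro SigmaI perm_A t a \<sigma> S_id)
    show "y \<in> carrier M \<Longrightarrow> g \<in> carrier G \<Longrightarrow> \<phi> a (coact M y g) = (if g = (perm_act (t a) \<sigma>, id) then \<phi> a y else 0)"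
      by (rule \<phi>_coact[OF a])
    assume b: "b \<in> I" and y: "y \<in> carrier M"
    have "q b a = \<chi> (perm_act (Hilbert_Choice.inv (t a)) (perm_act (t b) \<sigma>))"
      unfolding q_def orbit_sign_def perm_comp[OF S_inv[OF t[OF a]] t[OF b]] using a b by (simp only: if_True simp_thms)
    then show "\<phi> a (rep_act M (perm_act (t b) \<sigma>, id) y) = q b a * \<phi> a y"
      using \<phi>_act[OF a perm_A[OF t[OF b] \<sigma>] y] by (simp only:)
  qed (fact act_closed coact_closed)+
  then show thesis by (rule that)
qed

lemma finite_if_trivial:
  assumes "trivial_braiding"
  shows "vectorspace.fin_dim CC (nichols_algebra G M)"
proof -
  obtain x where "diag_frame G M I \<phi> x q (\<lambda>a. (perm_act (t a) \<sigma>, id))" by (rule frame)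
  then interpret d: diag_frame G M I \<phi> x q "\<lambda>a. (perm_act (t a) \<sigma>, id)" .
  have r: "Hilbert_Choice.inv (t b) \<circ> t a \<in> S" if "a \<in> I" "b \<in> I" for a b by (intro S_comp S_inv t that)
  show ?thesis
  proof (rule d.finite_if_disconnected)
    have "q a b = 1 \<or> q a b = -1" for a b unfolding q_def using orbit_sign_sign[OF r] by simp
    moreover have "q a a = -1" for a
      using assms S_inv_simps(2)[OF t] unfolding q_def trivial_braiding_def by (auto simp: orbit_sign_id)
    ultimately show "sign_matrix q" unfolding sign_matrix_def by blast
    have "q a b * q b a = 1" for a b
    proof (cases "a \<in> I \<and> b \<in> I")
      case True
      then have "Hilbert_Choice.inv (Hilbert_Choice.inv (t b) \<circ> t a) = Hilbert_Choice.inv (t a) \<circ> t b"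
        using S_inv_comp[OF S_inv[OF t] t] S_inv_simps(3)[OF t] by simp
      moreover have "orbit_sign (Hilbert_Choice.inv (t b) \<circ> t a) * orbit_sign (Hilbert_Choice.inv (Hilbert_Choice.inv (t b) \<circ> t a)) = 1"
        using assms r True unfolding trivial_braiding_def by blast
      ultimately show ?thesis unfolding q_def using True by simp
    qed (auto simp: q_def)
    then show "\<not> adjacent q a b" for a b unfolding adjacent_def by simp
  qed
qed

lemma infinite_if_one:
  assumes "\<chi> \<sigma> = 1"
  shows "\<not> vectorspace.fin_dim CC (nichols_algebra G M)"
proof -
  obtain x where "diag_frame G M I \<phi> x q (\<lambda>a. (perm_act (t a) \<sigma>, id))" by (rule frame)
  then interpret d: diag_frame G M I \<phi> x q "\<lambda>a. (perm_act (t a) \<sigma>, id)" .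
  obtain idx y where d: "\<And>u. u \<in> S \<Longrightarrow> idx u \<in> I \<and> t (idx u) = u \<and> y u \<in> carrier M \<and> \<phi> (idx u) (y u) = 1"
    using dual by blast
  note d = d[OF S_id]
  show ?thesis
  proof (rule d.infinite_if_subdiagram[of 1 "\<lambda>_. idx id" "\<lambda>_. y id" "\<lambda>_ _. 1"])
    fix i j :: nat
    show "q (idx id) (idx id) = 1" unfolding q_def using d assms S_inv_simps(2)[OF S_id] by (simp only: orbit_sign_id if_True simp_thms)
    fix N
    show "\<exists>w v :: nat list. set w \<subseteq> {..<1} \<and> set v \<subseteq> {..<1} \<and> N \<le> length w \<and> length v = length w \<and> nichols_word (\<lambda>_ _. 1) w v \<noteq> 0"
      by (rule exI[of _ "replicate N (0::nat)"], rule exI[of _ "replicate N (0::nat)"]) (use nichols_word_all_ones[of "\<lambda>_ _. 1" 0 N] in auto)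
  qed (use d in simp_all)
qed

text \<open>Let \<open>m\<close> be the least positive exponent with \<open>u\<^bsup>m\<^esup>\<close> in the stabilizer \<open>K\<close>.  The powers \<open>1, u, \<dots>,
  u\<^bsup>m-1\<^esup>\<close> are consecutively joined, and so are the last and the first, because \<open>orbit_sign\<close> is invariant
  under \<open>K\<close>.  Moreover \<open>m \<ge> 3\<close>: if \<open>u\<close> or \<open>u\<^sup>2\<close> were in \<open>K\<close>, then \<open>u\<close> and \<open>u\<inverse>\<close> would have the same sign.
  So the diagram contains the vertices of a cycle with all consecutive pairs joined.\<close>

lemma infinite_if_edge:
  assumes m1: "\<chi> \<sigma> = -1" and u: "u \<in> S" and edge: "orbit_sign u * orbit_sign (Hilbert_Choice.inv u) \<noteq> 1"
  shows "\<not> vectorspace.fin_dim CC (nichols_algebra G M)"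
proof -
  obtain x where "diag_frame G M I \<phi> x q (\<lambda>a. (perm_act (t a) \<sigma>, id))" by (rule frame)
  then interpret d: diag_frame G M I \<phi> x q "\<lambda>a. (perm_act (t a) \<sigma>, id)" .
  obtain idx y where idx: "\<And>u. u \<in> S \<Longrightarrow> idx u \<in> I" "\<And>u. u \<in> S \<Longrightarrow> t (idx u) = u" and y: "\<And>u. u \<in> S \<Longrightarrow> y u \<in> carrier M"
    and d1: "\<And>u. u \<in> S \<Longrightarrow> \<phi> (idx u) (y u) = 1"
    and d0: "\<And>u w. u \<in> S \<Longrightarrow> w \<in> S \<Longrightarrow> Hilbert_Choice.inv u \<circ> w \<notin> K \<Longrightarrow> \<phi> (idx u) (y w) = 0"
    using dual by blast
  let ?P = "\<lambda>m. 0 < m \<and> u ^^ m \<in> K"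
  have "\<exists>m. ?P m"
  proof -
    obtain m where "u ^^ m = id" "m > 0" using permutation_is_nilpotent[OF sym_group_carrier'[OF u]] by blast
    then show ?thesis using K_id by auto
  qed
  define m where "m = (LEAST m. ?P m)"
  have Pm: "?P m" unfolding m_def by (rule LeastI_ex[OF \<open>\<exists>m. ?P m\<close>])
  have least: "u ^^ k \<notin> K" if "0 < k" "k < m" for k
    using not_less_Least[of k ?P] that unfolding m_def by blast
  let ?iu = "Hilbert_Choice.inv u"
  have iu: "?iu \<in> S" by (rule S_inv[OF u])
  have e: "orbit_sign u * orbit_sign ?iu = -1" using edge orbit_sign_sign[OF u] orbit_sign_sign[OF iu] by auto
  have "m \<noteq> 1"
  proof
    assume "m = 1"
    then have "u \<in> K" using Pm by simp
    then have "orbit_sign u = -1" "orbit_sign ?iu = -1"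
      using orbit_sign_K(1)[OF S_id, of u] orbit_sign_K(1)[OF S_id, of ?iu] K_inv[of u] m1 by (simp_all only: id_o orbit_sign_id)
    then show False using edge by simp
  qed
  \<comment> \<open>\<open>u = u\<^sup>2 u\<inverse>\<close>, so \<open>u\<close> and \<open>u\<inverse>\<close> lie in the same coset of the stabilizer.\<close>
  moreover have "m \<noteq> 2"
  proof
    assume "m = 2"
    then have "u \<circ> u \<in> K" using Pm by (simp add: numeral_2_eq_2)
    from orbit_sign_K(2)[OF iu this] have "orbit_sign u = orbit_sign ?iu"
      unfolding comp_assoc S_inv_simps(1)[OF u] o_id .
    then show False using edge orbit_sign_sign[OF u] by auto
  qed
  ultimately have m3: "3 \<le> m" using Pm by linarith
  define q' where "q' i j = orbit_sign (Hilbert_Choice.inv (u ^^ j) \<circ> u ^^ i)" for i j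
  have rS: "Hilbert_Choice.inv (u ^^ j) \<circ> u ^^ i \<in> S" for i j by (intro S_comp S_inv S_pow u)
  have rinv: "Hilbert_Choice.inv (Hilbert_Choice.inv (u ^^ j) \<circ> u ^^ i) = Hilbert_Choice.inv (u ^^ i) \<circ> u ^^ j" for i j
    unfolding S_inv_comp[OF S_inv[OF S_pow[OF u]] S_pow[OF u]] S_inv_simps(3)[OF S_pow[OF u]] ..
  have notK: "Hilbert_Choice.inv (u ^^ i) \<circ> u ^^ j \<notin> K" if "i < m" "j < m" "i \<noteq> j" for i j
  proof (cases "i < j")
    case True
    then show ?thesis unfolding S_pow_ratio[OF u less_imp_le[OF True]] using least[of "j - i"] that by simp
  next
    case False
    have "Hilbert_Choice.inv (u ^^ j) \<circ> u ^^ i \<notin> K"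
      unfolding S_pow_ratio[OF u not_less[THEN iffD1, OF False]] using least[of "i - j"] that False by simp
    then show ?thesis using K_inv[of "Hilbert_Choice.inv (u ^^ i) \<circ> u ^^ j"] unfolding rinv by blast
  qed
  have sgn: "sign_matrix q'"
    unfolding sign_matrix_def q'_def using orbit_sign_sign[OF rS] m1 by (simp add: S_inv_simps(2)[OF S_pow[OF u]] orbit_sign_id)
  have one: "q' i (Suc i) = orbit_sign ?iu" "q' (Suc i) i = orbit_sign u" for i
  proof -
    have a: "Hilbert_Choice.inv (u ^^ i) \<circ> u ^^ Suc i = u" using S_pow_ratio[OF u, of i "Suc i"] by simp
    show "q' (Suc i) i = orbit_sign u" unfolding q'_def a ..
    show "q' i (Suc i) = orbit_sign ?iu" unfolding q'_def using rinv[of i "Suc i"] unfolding a by simp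
  qed
  have last: "q' (m - 1) 0 = orbit_sign ?iu" "q' 0 (m - 1) = orbit_sign u"
  proof -
    \<comment> \<open>Closing the cycle: \<open>u\<^bsup>m-1\<^esup>\<close> is \<open>u\<inverse>\<close> up to a factor in the stabilizer.\<close>
    have um: "u ^^ m = u \<circ> u ^^ (m - 1)" using Pm funpow.simps(2)[of "m - 1" u] by (simp only: Suc_diff_1)
    have a: "Hilbert_Choice.inv (u ^^ 0) \<circ> u ^^ (m - 1) = ?iu \<circ> u ^^ m"
      unfolding um o_assoc S_inv_simps(2)[OF u] by (simp add: inv_id)
    show "q' (m - 1) 0 = orbit_sign ?iu" unfolding q'_def a using orbit_sign_K(1)[OF iu, of "u ^^ m"] Pm by simp
    have b: "Hilbert_Choice.inv (u ^^ (m - 1)) \<circ> u ^^ 0 = Hilbert_Choice.inv (u ^^ m) \<circ> u"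
      using rinv[of 0 "m - 1"] unfolding a S_inv_comp[OF iu S_pow[OF u]] S_inv_simps(3)[OF u] by simp
    show "q' 0 (m - 1) = orbit_sign u" unfolding q'_def b using orbit_sign_K(2)[OF u K_inv, of "u ^^ m"] Pm by simp
  qed
  have adj: "adjacent q' (k mod m) (Suc k mod m)" for k
  proof (cases "Suc (k mod m) = m")
    case True
    then have "k mod m = m - 1" "Suc k mod m = 0" by (simp_all add: mod_Suc)
    then show ?thesis unfolding adjacent_def using last e by (simp add: mult.commute)
  next
    case False
    then have "Suc k mod m = Suc (k mod m)" by (simp add: mod_Suc)
    then show ?thesis unfolding adjacent_def using one e by (simp add: mult.commute)
  qed
  show ?thesis
  proof (rule d.infinite_if_subdiagram[of m "\<lambda>j. idx (u ^^ j)" "\<lambda>j. y (u ^^ j)" q'])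
    fix i j assume ij: "i < m" "j < m"
    show "idx (u ^^ j) \<in> I" "y (u ^^ j) \<in> carrier M" using idx(1) y S_pow[OF u] by blast+
    show "\<phi> (idx (u ^^ i)) (y (u ^^ j)) = (if i = j then 1 else 0)"
      using d1[OF S_pow[OF u]] d0[OF S_pow[OF u] S_pow[OF u] notK[OF ij]] by simp
    show "q (idx (u ^^ i)) (idx (u ^^ j)) = q' i j"
      unfolding q_def q'_def using idx[OF S_pow[OF u]] by simp
  next
    fix N
    show "\<exists>w v. set w \<subseteq> {..<m} \<and> set v \<subseteq> {..<m} \<and> N \<le> length w \<and> length v = length w \<and> nichols_word q' w v \<noteq> 0"
      by (rule nichols_cycle_infinite[OF m3 sgn adj])
  qed
qed

theorem fin_dim_criterion: "vectorspace.fin_dim CC (nichols_algebra G M) \<longleftrightarrow> trivial_braiding"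
  using finite_if_trivial infinite_if_one infinite_if_edge chi_sign[OF \<sigma>] unfolding trivial_braiding_def by blast

end

section \<open>The modules of the theorem\<close>

lemma char_tensor_simps:
  "carrier (char_tensor \<chi> \<mu>) = carrier \<mu>" "\<zero>\<^bsub>char_tensor \<chi> \<mu>\<^esub> = \<zero>\<^bsub>\<mu>\<^esub>"
  "add (char_tensor \<chi> \<mu>) = add \<mu>" "smult (char_tensor \<chi> \<mu>) = smult \<mu>"
  "rep_act (char_tensor \<chi> \<mu>) (a, x) v = \<chi> a \<odot>\<^bsub>\<mu>\<^esub> rep_act \<mu> x v"
  by (simp_all add: char_tensor_def module.defs rep.defs)

lemma (in AS) char_tensor_representation:
  assumes "representation ((sym_group n)\<lparr>carrier := K\<rparr>) (\<mu> :: (nat \<Rightarrow> nat, 'v, 'c) rep_scheme)"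
  shows "representation (G\<lparr>carrier := H\<rparr>) (char_tensor \<chi> \<mu>)"
proof -
  note R = representationD[OF assms, simplified]
  let ?W = "char_tensor \<chi> \<mu>"
  have W: "vectorspace CC ?W" by (rule vectorspace_transfer[OF R(2)]) (simp_all only: char_tensor_simps)
  have cl: "rep_act \<mu> x y \<in> carrier \<mu>" if "x \<in> K" "y \<in> carrier \<mu>" for x y using R(3) that by blast
  have "rep_act ?W g \<in> LinearCombinations.module_hom CC ?W ?W" if g: "g \<in> H" for g
  proof -
    obtain a x where ax: "g = (a, x)" "a \<in> A" "x \<in> K" using g by blast
    show ?thesis
      unfolding LinearCombinations.module_hom_def ax(1)
    proof (rule CollectI, intro conjI allI impI)
      show "rep_act ?W (a, x) \<in> carrier ?W \<rightarrow> carrier ?W"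
        unfolding char_tensor_simps(1) by (rule funcsetI) (unfold char_tensor_simps, rule vs_smult[OF R(2) cl[OF ax(3)]])
      fix y z assume yz: "y \<in> carrier ?W \<and> z \<in> carrier ?W"
      then have y: "y \<in> carrier \<mu>" and z: "z \<in> carrier \<mu>" unfolding char_tensor_simps by auto
      show "rep_act ?W (a, x) (y \<oplus>\<^bsub>?W\<^esub> z) = rep_act ?W (a, x) y \<oplus>\<^bsub>?W\<^esub> rep_act ?W (a, x) z"
        unfolding char_tensor_simps R(4)[OF ax(3) y z] by (rule vs_rdist[OF R(2) cl[OF ax(3) y] cl[OF ax(3) z]])
    next
      fix c y assume "c \<in> carrier CC \<and> y \<in> carrier ?W"
      then have y: "y \<in> carrier \<mu>" unfolding char_tensor_simps by auto
      show "rep_act ?W (a, x) (c \<odot>\<^bsub>?W\<^esub> y) = c \<odot>\<^bsub>?W\<^esub> rep_act ?W (a, x) y"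
        unfolding char_tensor_simps R(5)[OF ax(3) y] vs_compat[OF R(2) cl[OF ax(3) y], symmetric] mult.commute[of c] ..
    qed
  qed
  moreover have "rep_act ?W \<one>\<^bsub>G\<^esub> y = y" if "y \<in> carrier ?W" for y
  proof -
    have y: "y \<in> carrier \<mu>" using that unfolding char_tensor_simps .
    have "rep_act \<mu> id y = y" using R(6)[OF y] by (simp add: sym_group_def)
    then show ?thesis unfolding G_simps char_tensor_simps chi_zero2 using vs_one[OF R(2) y] by simp
  qed
  moreover have "rep_act ?W (g \<otimes>\<^bsub>G\<^esub> h) y = rep_act ?W g (rep_act ?W h y)" if g: "g \<in> H" and h: "h \<in> H" and yW: "y \<in> carrier ?W" for g h y
  proof -
    obtain a x where ax: "g = (a, x)" "a \<in> A" "x \<in> K" using g by blast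
    obtain b z where bz: "h = (b, z)" "b \<in> A" "z \<in> K" using h by blast
    have y: "y \<in> carrier \<mu>" using yW unfolding char_tensor_simps .
    have xS: "x \<in> S" using ax(3) unfolding K_iff by blast
    have m: "rep_act \<mu> (x \<circ> z) y = rep_act \<mu> x (rep_act \<mu> z y)" using R(7)[OF ax(3) bz(3) y] by (simp add: sym_group_def)
    have "\<chi> (a +\<^sub>2 perm_act x b) = \<chi> a * \<chi> b"
      unfolding chi_mult[OF ax(2) perm_A[OF xS bz(2)]] K_chi[OF ax(3) bz(2)] ..
    then show ?thesis
      unfolding ax(1) bz(1) G_simps char_tensor_simps m R(5)[OF ax(3) cl[OF bz(3) y]]
      using vs_compat[OF R(2) cl[OF ax(3) cl[OF bz(3) y]], of "\<chi> a" "\<chi> b"] by simp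
  qed
  moreover have "group (G\<lparr>carrier := H\<rparr>)" by (rule subgroup.subgroup_is_group[OF H_subgroup G_group])
  ultimately show ?thesis unfolding representation_def using W by simp
qed

text \<open>Two induction steps are combined: \<open>T\<close> from \<open>A \<times> K\<close> to the centralizer, giving \<open>theta\<close>, and \<open>Y\<close> from the centralizer
  to the whole group, giving the Yetter-Drinfeld module.\<close>

locale theta_data = AS +
  fixes \<mu> :: "(nat \<Rightarrow> nat, 'v) rep" and J :: "'v set" and \<psi> :: "'v \<Rightarrow> 'v \<Rightarrow> complex" and j0 v0
  assumes \<mu>: "representation ((sym_group n)\<lparr>carrier := K\<rparr>) \<mu>"
    and sep\<mu>: "separating \<mu> J \<psi>"
    and j0: "j0 \<in> J" and v0: "v0 \<in> carrier \<mu>" "\<psi> j0 v0 = 1"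
begin

abbreviation "G1 \<equiv> G\<lparr>carrier := C\<rparr>"

lemma G1_inv: "g \<in> C \<Longrightarrow> inv\<^bsub>G1\<^esub> g = inv\<^bsub>G\<^esub> g" by (rule G.m_inv_consistent[OF C_subgroup])

sublocale T: induction_data G1 H "char_tensor \<chi> \<mu>" J \<psi>
proof (intro induction_data.intro induction_data_axioms.intro)
  show "group G1" by (rule subgroup.subgroup_is_group[OF C_subgroup G_group])
  show "finite (carrier G1)" using finite_subset[OF subgroup.subset[OF C_subgroup] finite_G] by simp
  show "subgroup H G1" by (rule G.subgroup_incl[OF H_subgroup C_subgroup H_subset])
  show "representation (G1\<lparr>carrier := H\<rparr>) (char_tensor \<chi> \<mu>)" using char_tensor_representation[OF \<mu>] by simp
  show "separating (char_tensor \<chi> \<mu>) J \<psi>"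
    using sep\<mu> unfolding separating_def linear_functional_def char_tensor_simps .
qed

lemma theta_eq: "theta n A \<sigma> \<chi> \<mu> = T.R" by (simp only: theta_def)

sublocale Y: yd_data G C T.R "C \<times> J" "\<lambda>(k, j). T.ind_fun k (\<psi> j)" s
proof (intro yd_data.intro induction_data.intro induction_data_axioms.intro yd_data_axioms.intro)
  show "separating T.R (C \<times> J) (\<lambda>(k, j). T.ind_fun k (\<psi> j))" using T.ind_fun_separating by simp
qed (fact G_group finite_G C_subgroup T.R_representation s_G refl)+

lemma rep_act_id:
  assumes "w \<in> carrier \<mu>" "j \<in> J"
  shows "\<psi> j (rep_act (char_tensor \<chi> \<mu>) (b, id) w) = \<chi> b * \<psi> j w"
proof -
  have "rep_act \<mu> id w = w" using representationD(6)[OF \<mu> assms(1)] by (simp add: sym_group_def)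
  then have e: "rep_act (char_tensor \<chi> \<mu>) (b, id) w = \<chi> b \<odot>\<^bsub>char_tensor \<chi> \<mu>\<^esub> w" unfolding char_tensor_simps by simp
  show ?thesis unfolding e by (rule linear_functionalD(2)[OF T.psi_linear[OF assms(2)]]) (simp only: char_tensor_simps assms(1))
qed

text \<open>A functional is chosen by an element \<open>g\<close> of the group, an element \<open>k\<close> of the centralizer and a functional on
  \<open>\<mu>\<close>; the corresponding permutation is that of the product \<open>g k\<close>.\<close>

definition \<Phi> where "\<Phi> = (\<lambda>(g, kj). Y.ind_fun g ((\<lambda>(k, j). T.ind_fun k (\<psi> j)) kj))"
definition \<tau> :: "((nat \<Rightarrow> int) \<times> (nat \<Rightarrow> nat)) \<times> ((nat \<Rightarrow> int) \<times> (nat \<Rightarrow> nat)) \<times> 'v \<Rightarrow> nat \<Rightarrow> nat"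
  where "\<tau> = (\<lambda>(g, k, j). snd g \<circ> snd k)"

lemma Y_functional: "k \<in> C \<Longrightarrow> j \<in> J \<Longrightarrow> linear_functional T.R (T.ind_fun k (\<psi> j))"
  by (rule T.ind_fun_linear[OF T.psi_linear]) simp_all

lemma C_G: "k \<in> C \<Longrightarrow> k \<in> carrier G" using subgroup.subset[OF C_subgroup] by blast

lemma A_in_C: "b \<in> A \<Longrightarrow> (b, id) \<in> C" unfolding C_iff using S_id perm_id by simp

lemma T_scalar:
  assumes k: "k \<in> C" and j: "j \<in> J" and b: "b \<in> A" and X: "X \<in> carrier T.R"
  shows "T.ind_fun k (\<psi> j) (rep_act T.R (b, id) X) = \<chi> (perm_act (Hilbert_Choice.inv (snd k)) b) * T.ind_fun k (\<psi> j) X"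
proof -
  let ?b = "perm_act (Hilbert_Choice.inv (snd k)) b"
  have e: "inv\<^bsub>G1\<^esub> k \<otimes>\<^bsub>G1\<^esub> (b, id) \<otimes>\<^bsub>G1\<^esub> k = (?b, id)"
    unfolding G1_inv[OF k] using G_conj(2)[OF C_G[OF k] b] by simp
  have kS: "snd k \<in> S" by (rule G_carrierD[OF C_G[OF k]])
  show ?thesis
  proof (rule T.ind_fun_scalar[OF T.psi_linear[OF j] _ _ _ _ X])
    show "k \<in> carrier G1" "(b, id) \<in> carrier G1" using k A_in_C[OF b] by simp_all
    show "inv\<^bsub>G1\<^esub> k \<otimes>\<^bsub>G1\<^esub> (b, id) \<otimes>\<^bsub>G1\<^esub> k \<in> H" unfolding e by (rule SigmaI[OF perm_A[OF S_inv[OF kS] b] K_id])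
    fix w assume "w \<in> carrier (char_tensor \<chi> \<mu>)"
    then show "\<psi> j (rep_act (char_tensor \<chi> \<mu>) (inv\<^bsub>G1\<^esub> k \<otimes>\<^bsub>G1\<^esub> (b, id) \<otimes>\<^bsub>G1\<^esub> k) w) = \<chi> ?b * \<psi> j w"
      unfolding e char_tensor_simps(1) by (rule rep_act_id[OF _ j])
  qed
qed

lemma Y_scalar:
  assumes g: "g \<in> carrier G" and k: "k \<in> C" and j: "j \<in> J" and b: "b \<in> A" and X: "X \<in> carrier Y.M"
  shows "Y.ind_fun g (T.ind_fun k (\<psi> j)) (rep_act Y.M (b, id) X) =
    \<chi> (perm_act (Hilbert_Choice.inv (snd g \<circ> snd k)) b) * Y.ind_fun g (T.ind_fun k (\<psi> j)) X"
proof -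
  let ?b = "perm_act (Hilbert_Choice.inv (snd g)) b"
  note gS = G_carrierD(2)[OF g] and kS = G_carrierD(2)[OF C_G[OF k]]
  have bA: "?b \<in> A" by (rule perm_A[OF S_inv[OF gS] b])
  have c: "perm_act (Hilbert_Choice.inv (snd g \<circ> snd k)) b = perm_act (Hilbert_Choice.inv (snd k)) ?b"
    unfolding S_inv_comp[OF gS kS] by (rule perm_comp[OF S_inv[OF kS] S_inv[OF gS]])
  have e: "inv\<^bsub>G\<^esub> g \<otimes>\<^bsub>G\<^esub> (b, id) \<otimes>\<^bsub>G\<^esub> g = (?b, id)" by (rule G_conj(2)[OF g b])
  have XR: "X \<in> carrier Y.R" using X unfolding Y.M_simps .
  show ?thesis
    unfolding Y.M_simps c
  proof (rule Y.ind_fun_scalar[OF Y_functional[OF k j] g _ _ _ XR])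
    show "(b, id) \<in> carrier G" by (rule C_G[OF A_in_C[OF b]])
    show "inv\<^bsub>G\<^esub> g \<otimes>\<^bsub>G\<^esub> (b, id) \<otimes>\<^bsub>G\<^esub> g \<in> C" unfolding e by (rule A_in_C[OF bA])
    show "T.ind_fun k (\<psi> j) (rep_act T.R (inv\<^bsub>G\<^esub> g \<otimes>\<^bsub>G\<^esub> (b, id) \<otimes>\<^bsub>G\<^esub> g) w) =
        \<chi> (perm_act (Hilbert_Choice.inv (snd k)) ?b) * T.ind_fun k (\<psi> j) w" if "w \<in> carrier T.R" for w
      unfolding e by (rule T_scalar[OF k j bA that])
  qed
qed

lemma Y_coact:
  assumes g: "g \<in> carrier G" and k: "k \<in> C" and j: "j \<in> J" and X: "X \<in> carrier Y.M"
  shows "Y.ind_fun g (T.ind_fun k (\<psi> j)) (coact Y.M X h) =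
    (if h = (perm_act (snd g \<circ> snd k) \<sigma>, id) then Y.ind_fun g (T.ind_fun k (\<psi> j)) X else 0)"
proof -
  have "perm_act (snd g \<circ> snd k) \<sigma> = perm_act (snd g) \<sigma>"
    using perm_comp[OF G_carrierD(2)[OF g] G_carrierD(2)[OF C_G[OF k]], of \<sigma>] k unfolding C_iff by simp
  then show ?thesis
    using Y.coact_M(2)[OF X Y_functional[OF k j] g, of h] unfolding G_conj(1)[OF g \<sigma>] by simp
qed

lemma dual_vectors:
  assumes u: "u \<in> S" and w: "w \<in> S"
  shows "Y.ind_fun (zero2, u) (T.ind_fun \<one>\<^bsub>G\<^esub> (\<psi> j0)) (Y.ind_vec (zero2, w) (T.ind_vec \<one>\<^bsub>G\<^esub> v0)) =
    (if Hilbert_Choice.inv u \<circ> w \<in> K then \<psi> j0 (rep_act (char_tensor \<chi> \<mu>) (zero2, Hilbert_Choice.inv u \<circ> w) v0) else 0)"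
proof -
  let ?h = "(zero2, Hilbert_Choice.inv u \<circ> w)"
  have G: "(zero2, x) \<in> carrier G" if "x \<in> S" for x unfolding G_simps by (rule SigmaI[OF A_zero that])
  have oneC: "\<one>\<^bsub>G\<^esub> \<in> C" by (rule subgroup.one_closed[OF C_subgroup])
  have v: "v0 \<in> carrier (char_tensor \<chi> \<mu>)" unfolding char_tensor_simps by (rule v0)
  have one: "\<one>\<^bsub>G1\<^esub> = \<one>\<^bsub>G\<^esub>" by simp
  have HC: "?h \<in> H \<Longrightarrow> ?h \<in> C" using H_subset by blast
  have H: "?h \<in> H \<longleftrightarrow> Hilbert_Choice.inv u \<circ> w \<in> K" using A_zero by blast
  have iv: "T.ind_vec \<one>\<^bsub>G\<^esub> v0 \<in> carrier T.R" by (rule T.ind_vec_R[OF v])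
  have 1: "Y.ind_fun (zero2, u) (T.ind_fun \<one>\<^bsub>G\<^esub> (\<psi> j0)) (Y.ind_vec (zero2, w) (T.ind_vec \<one>\<^bsub>G\<^esub> v0)) =
    (if ?h \<in> C then T.ind_fun \<one>\<^bsub>G\<^esub> (\<psi> j0) (rep_act T.R ?h (T.ind_vec \<one>\<^bsub>G\<^esub> v0)) else 0)"
    using Y.ind_fun_ind_vec[OF Y_functional[OF oneC j0] G[OF u] G[OF w] iv] unfolding G_ratio[OF u w] .
  have 2: "T.ind_fun \<one>\<^bsub>G\<^esub> (\<psi> j0) (rep_act T.R ?h (T.ind_vec \<one>\<^bsub>G\<^esub> v0)) =
      (if ?h \<in> H then \<psi> j0 (rep_act (char_tensor \<chi> \<mu>) ?h v0) else 0)" if h: "?h \<in> C"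
  proof -
    have hc: "?h \<in> carrier G1" using h by simp
    have l: "inv\<^bsub>G1\<^esub> \<one>\<^bsub>G\<^esub> \<otimes>\<^bsub>G1\<^esub> ?h = ?h" unfolding one[symmetric] T.inv_one by (rule T.l_one[OF hc])
    have "\<one>\<^bsub>G\<^esub> \<in> carrier G1" using oneC by simp
    from T.ind_fun_ind_vec[OF T.psi_linear[OF j0] this hc v] show ?thesis
      unfolding l using T.act_ind_vec[OF hc v] unfolding one by simp
  qed
  show ?thesis unfolding 1 using 2 H HC by auto
qed

text \<open>Each functional is the component at \<open>g k\<close>.  Conjugating by \<open>g\<close> and then by \<open>k\<close> shows that \<open>A\<close> acts on it through
  \<open>\<chi>\<close> translated by \<open>g k\<close>, and its degree is \<open>g \<cdot> \<sigma> = g k \<cdot> \<sigma>\<close>.  The dual vectors are \<open>u \<otimes> (1 \<otimes> v0)\<close>.\<close>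

lemma theta_orbit_frame:
  "orbit_frame n A \<sigma> \<chi> (yd_induced G s (theta n A \<sigma> \<chi> \<mu>)) (carrier G \<times> C \<times> J) \<Phi> \<tau>"
  unfolding theta_eq
proof (intro orbit_frame.intro orbit_frame_axioms.intro)
  show "AS n A \<sigma> \<chi>" by (rule AS_axioms)
  show "vectorspace CC Y.M" by (rule Y.M_vs)
  show "separating Y.M (carrier G \<times> C \<times> J) \<Phi>"
    using Y.ind_fun_separating unfolding \<Phi>_def separating_def linear_functional_def Y.M_simps .
  fix g y assume y: "y \<in> carrier Y.M"
  assume g: "g \<in> carrier G"
  show "rep_act Y.M g y \<in> carrier Y.M"
    using representationD(3)[OF Y.R_representation g] y unfolding Y.M_simps by blast
  show "coact Y.M y g \<in> carrier Y.M" by (rule Y.coact_M(1)[OF y])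
next
  fix a assume "a \<in> carrier G \<times> C \<times> J"
  then obtain g k j where a: "a = (g, k, j)" "g \<in> carrier G" "k \<in> C" "j \<in> J" by blast
  have e: "\<Phi> a = Y.ind_fun g (T.ind_fun k (\<psi> j))" "\<tau> a = snd g \<circ> snd k" unfolding \<Phi>_def \<tau>_def a(1) by simp_all
  show "\<tau> a \<in> S" unfolding e by (rule S_comp[OF G_carrierD(2)[OF a(2)] G_carrierD(2)[OF C_G[OF a(3)]]])
  fix y assume y: "y \<in> carrier Y.M"
  show "\<Phi> a (coact Y.M y h) = (if h = (perm_act (\<tau> a) \<sigma>, id) then \<Phi> a y else 0)" for h
    unfolding e by (rule Y_coact[OF a(2-4) y])
  show "\<Phi> a (rep_act Y.M (b, id) y) = \<chi> (perm_act (Hilbert_Choice.inv (\<tau> a)) b) * \<Phi> a y" if "b \<in> A" for b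
    unfolding e by (rule Y_scalar[OF a(2-4) that y])
next
  let ?idx = "\<lambda>u. ((zero2, u), \<one>\<^bsub>G\<^esub>, j0)" and ?y = "\<lambda>u. Y.ind_vec (zero2, u) (T.ind_vec \<one>\<^bsub>G\<^esub> v0)"
  have oneC: "\<one>\<^bsub>G\<^esub> \<in> C" by (rule subgroup.one_closed[OF C_subgroup])
  have iv: "T.ind_vec \<one>\<^bsub>G\<^esub> v0 \<in> carrier T.R" by (rule T.ind_vec_R) (unfold char_tensor_simps, rule v0)
  have e: "\<Phi> (?idx u) = Y.ind_fun (zero2, u) (T.ind_fun \<one>\<^bsub>G\<^esub> (\<psi> j0))" "\<tau> (?idx u) = u \<circ> snd \<one>\<^bsub>G\<^esub>" for u
    unfolding \<Phi>_def \<tau>_def by simp_all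
  have "?idx u \<in> carrier G \<times> C \<times> J" if "u \<in> S" for u
    using oneC j0 that A_zero unfolding G_simps(1) by blast
  moreover have "\<tau> (?idx u) = u" for u unfolding e by (simp add: G_simps(3))
  moreover have "?y u \<in> carrier Y.M" for u unfolding Y.M_simps by (rule Y.ind_vec_R[OF iv])
  moreover have "\<Phi> (?idx u) (?y u) = 1" if u: "u \<in> S" for u
    unfolding e dual_vectors[OF u u] S_inv_simps(2)[OF u]
    using K_id rep_act_id[OF v0(1) j0, of zero2] v0(2) chi_zero2 by simp
  moreover have "\<Phi> (?idx u) (?y w) = 0" if "u \<in> S" "w \<in> S" "Hilbert_Choice.inv u \<circ> w \<notin> K" for u w
    unfolding e dual_vectors[OF that(1,2)] using that(3) by simp
  ultimately show "\<exists>idx y. \<forall>u\<in>S. idx u \<in> carrier G \<times> C \<times> J \<and> \<tau> (idx u) = u \<and> y u \<in> carrier Y.M \<and> \<Phi> (idx u) (y u) = 1 \<and>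
      (\<forall>w\<in>S. Hilbert_Choice.inv u \<circ> w \<notin> K \<longrightarrow> \<Phi> (idx u) (y w) = 0)"
    by (intro exI[of _ ?idx] exI[of _ ?y] ballI conjI impI) blast+
qed

end

section \<open>Direct sums\<close>

lemma yd_direct_sum_simps:
  "carrier (yd_direct_sum L M) = (\<Pi>\<^sub>E i\<in>L. carrier (M i))" "\<zero>\<^bsub>yd_direct_sum L M\<^esub> = (\<lambda>i\<in>L. \<zero>\<^bsub>M i\<^esub>)"
  "x \<oplus>\<^bsub>yd_direct_sum L M\<^esub> y = (\<lambda>i\<in>L. x i \<oplus>\<^bsub>M i\<^esub> y i)" "c \<odot>\<^bsub>yd_direct_sum L M\<^esub> x = (\<lambda>i\<in>L. c \<odot>\<^bsub>M i\<^esub> x i)"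
  "rep_act (yd_direct_sum L M) g x = (\<lambda>i\<in>L. rep_act (M i) g (x i))"
  "coact (yd_direct_sum L M) x g = (\<lambda>i\<in>L. coact (M i) (x i) g)"
  by (simp_all add: yd_direct_sum_def prod_module_def module.defs rep.defs yd_module.defs)

text \<open>The functionals of all summands are taken together; dual vectors are found in any one summand.\<close>

lemma direct_sum_orbit_frame:
  fixes M :: "'i \<Rightarrow> ((nat \<Rightarrow> int) \<times> (nat \<Rightarrow> nat), 'm, 'c) yd_module_scheme" and I :: "'i \<Rightarrow> 'a set"
  assumes L: "finite L" "l \<in> L" and F: "\<And>i. i \<in> L \<Longrightarrow> orbit_frame n A \<sigma> \<chi> (M i) (I i) (\<phi> i) (t i)"
  shows "orbit_frame n A \<sigma> \<chi> (yd_direct_sum L M) (Sigma L I) (\<lambda>(i, a) y. \<phi> i a (y i)) (\<lambda>(i, a). t i a)"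
proof -
  let ?M = "yd_direct_sum L M"
  interpret l: orbit_frame n A \<sigma> \<chi> "M l" "I l" "\<phi> l" "t l" by (rule F[OF L(2)])
  have V: "vectorspace CC (M i)" if "i \<in> L" for i by (rule orbit_frame.M_vs[OF F[OF that]])
  have sep: "finite (I i)" "\<And>a. a \<in> I i \<Longrightarrow> linear_functional (M i) (\<phi> i a)"
    "\<And>y. y \<in> carrier (M i) \<Longrightarrow> \<forall>a\<in>I i. \<phi> i a y = 0 \<Longrightarrow> y = \<zero>\<^bsub>M i\<^esub>" if "i \<in> L" for i
    using orbit_frame.sep[OF F[OF that]] unfolding separating_def by blast+
  have mem: "y i \<in> carrier (M i)" if "y \<in> carrier ?M" "i \<in> L" for y i
    using that(1) unfolding yd_direct_sum_simps by (rule PiE_mem[OF _ that(2)])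
  show ?thesis
  proof (intro orbit_frame.intro orbit_frame_axioms.intro)
    show "AS n A \<sigma> \<chi>" by (rule l.AS_axioms)
    show "vectorspace CC ?M"
    proof (rule vectorspace_transfer[OF prod_vectorspace[of L M]])
      show "vectorspace CC (M i)" if "i \<in> L" for i by (rule V[OF that])
    qed (simp_all add: yd_direct_sum_def module.defs rep.defs yd_module.defs)
    show "separating ?M (Sigma L I) (\<lambda>(i, a) y. \<phi> i a (y i))"
      unfolding separating_def
    proof (intro conjI ballI impI)
      show "finite (Sigma L I)" using L(1) sep(1) by (rule finite_SigmaI)
      fix p assume "p \<in> Sigma L I"
      then obtain i a where p: "p = (i, a)" "i \<in> L" "a \<in> I i" by blast
      show "linear_functional ?M ((\<lambda>(i, a) y. \<phi> i a (y i)) p)"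
        unfolding p(1) prod.case linear_functional_def yd_direct_sum_simps(3,4)
        using linear_functionalD[OF sep(2)[OF p(2,3)]] mem[OF _ p(2)] p(2) by simp
    next
      fix y assume y: "y \<in> carrier ?M" and z: "\<forall>p\<in>Sigma L I. (\<lambda>(i, a) y. \<phi> i a (y i)) p y = 0"
      have "y i = \<zero>\<^bsub>M i\<^esub>" if i: "i \<in> L" for i
      proof (rule sep(3)[OF i mem[OF y i]], rule ballI)
        fix a assume "a \<in> I i"
        with i have "(i, a) \<in> Sigma L I" by blast
        from bspec[OF z this] show "\<phi> i a (y i) = 0" by simp
      qed
      then show "y = \<zero>\<^bsub>?M\<^esub>"
        unfolding yd_direct_sum_simps by (intro extensionalityI[of _ L]) (use y in \<open>auto simp: yd_direct_sum_simps PiE_iff\<close>)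
    qed
  next
    fix g y assume g: "g \<in> carrier (AS_group n A)" and y: "y \<in> carrier ?M"
    have "rep_act (M i) g (y i) \<in> carrier (M i)" "coact (M i) (y i) g \<in> carrier (M i)" if "i \<in> L" for i
      by (rule orbit_frame.act_closed[OF F[OF that] g mem[OF y that]], rule orbit_frame.coact_closed[OF F[OF that] g mem[OF y that]])
    then show "rep_act ?M g y \<in> carrier ?M" "coact ?M y g \<in> carrier ?M" unfolding yd_direct_sum_simps by auto
  next
    fix p assume "p \<in> Sigma L I"
    then obtain i a where p: "p = (i, a)" "i \<in> L" "a \<in> I i" by blast
    interpret i: orbit_frame n A \<sigma> \<chi> "M i" "I i" "\<phi> i" "t i" by (rule F[OF p(2)])
    show "(\<lambda>(i, a). t i a) p \<in> carrier (sym_group n)" unfolding p(1) prod.case by (rule i.t[OF p(3)])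
    fix y assume y: "y \<in> carrier ?M"
    note yi = mem[OF y p(2)]
    show "(\<lambda>(i, a) y. \<phi> i a (y i)) p (coact ?M y g) =
        (if g = (perm_act ((\<lambda>(i, a). t i a) p) \<sigma>, id) then (\<lambda>(i, a) y. \<phi> i a (y i)) p y else 0)"
      if "g \<in> carrier (AS_group n A)" for g
      unfolding p(1) prod.case yd_direct_sum_simps restrict_apply'[OF p(2)] by (rule i.\<phi>_coact[OF p(3) yi that])
    show "(\<lambda>(i, a) y. \<phi> i a (y i)) p (rep_act ?M (b, id) y) =
        \<chi> (perm_act (Hilbert_Choice.inv ((\<lambda>(i, a). t i a) p)) b) * (\<lambda>(i, a) y. \<phi> i a (y i)) p y" if "b \<in> A" for b
      unfolding p(1) prod.case yd_direct_sum_simps restrict_apply'[OF p(2)] by (rule i.\<phi>_act[OF p(3) that yi])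
  next
    obtain idx y where d: "\<And>u. u \<in> carrier (sym_group n) \<Longrightarrow> idx u \<in> I l \<and> t l (idx u) = u \<and> y u \<in> carrier (M l) \<and> \<phi> l (idx u) (y u) = 1 \<and>
      (\<forall>w\<in>carrier (sym_group n). Hilbert_Choice.inv u \<circ> w \<notin> char_stab n A \<sigma> \<chi> \<longrightarrow> \<phi> l (idx u) (y w) = 0)"
      using l.dual by blast
    let ?y = "\<lambda>u. \<lambda>i\<in>L. if i = l then y u else \<zero>\<^bsub>M i\<^esub>"
    have "?y u \<in> carrier ?M" if "u \<in> carrier (sym_group n)" for u
      unfolding yd_direct_sum_simps using d[OF that] vs_zero[OF V] by auto
    moreover have "?y u l = y u" for u using L(2) by simp
    ultimately show "\<exists>idx y. \<forall>u\<in>carrier (sym_group n). idx u \<in> Sigma L I \<and> (\<lambda>(i, a). t i a) (idx u) = u \<and> y u \<in> carrier ?M \<and>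
        (\<lambda>(i, a) y. \<phi> i a (y i)) (idx u) (y u) = 1 \<and>
        (\<forall>w\<in>carrier (sym_group n). Hilbert_Choice.inv u \<circ> w \<notin> char_stab n A \<sigma> \<chi> \<longrightarrow> (\<lambda>(i, a) y. \<phi> i a (y i)) (idx u) (y w) = 0)"
      using d L(2) by (intro exI[of _ "\<lambda>u. (l, idx u)"] exI[of _ ?y] ballI) (simp only: prod.case mem_Sigma_iff, blast)
  qed
qed

text \<open>Neither side depends on the representations \<open>\<mu> i\<close>: both are equivalent to \<open>trivial_braiding\<close>.\<close>

theorem theorem3p3:
  fixes n r :: nat
    and A :: "(nat \<Rightarrow> int) set"
    and \<sigma> :: "nat \<Rightarrow> int"
    and \<chi> :: "(nat \<Rightarrow> int) \<Rightarrow> complex"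
    and \<mu> :: "nat \<Rightarrow> (nat \<Rightarrow> nat, 'v) rep"
  assumes "n > 2" and "r \<ge> 1"
    and "subgroup A (Z2_power n)"
    and "\<forall>h\<in>carrier (sym_group n). \<forall>a\<in>A. perm_act h a \<in> A"
    and "\<sigma> \<in> A"
    and "\<chi> \<in> characters n A"
    and "\<forall>i\<in>{1..r}. irreducible_rep ((sym_group n)\<lparr>carrier := char_stab n A \<sigma> \<chi>\<rparr>) (\<mu> i)"
  shows "vectorspace.fin_dim CC (nichols_algebra (AS_group n A)
           (yd_direct_sum {1..r} (\<lambda>i. yd_induced (AS_group n A) (\<sigma>, id) (theta n A \<sigma> \<chi> (\<mu> i)))))
     \<longleftrightarrow> (\<forall>i\<in>{1..r}. vectorspace.fin_dim CC (nichols_algebra (AS_group n A)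
           (yd_induced (AS_group n A) (\<sigma>, id) (theta n A \<sigma> \<chi> (\<mu> i)))))"
proof -
  interpret AS n A \<sigma> \<chi> by (rule AS.intro) (fact assms)+
  let ?M = "\<lambda>i. yd_induced G s (theta n A \<sigma> \<chi> (\<mu> i))"
  have ex: "\<exists>p :: (((nat \<Rightarrow> int) \<times> (nat \<Rightarrow> nat)) \<times> ((nat \<Rightarrow> int) \<times> (nat \<Rightarrow> nat)) \<times> 'v) set \<times> _.
      orbit_frame n A \<sigma> \<chi> (?M i) (fst p) (fst (snd p)) (snd (snd p))" if i: "i \<in> {1..r}" for i
  proof -
    have irr: "irreducible_rep ((sym_group n)\<lparr>carrier := K\<rparr>) (\<mu> i)" using assms(7) i by blast
    have "K \<subseteq> S" using K_iff by blast
    then have "finite (carrier ((sym_group n)\<lparr>carrier := K\<rparr>))" using finite_subset[OF _ finite_S] by simp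
    then obtain J :: "'v set" and \<psi> j v where jv: "separating (\<mu> i) J \<psi>" "j \<in> J" "v \<in> carrier (\<mu> i)" "\<psi> j v = 1"
      by (rule irreducible_separating[OF irr])
    interpret theta_data n A \<sigma> \<chi> "\<mu> i" J \<psi> j v
      by (intro theta_data.intro theta_data_axioms.intro AS_axioms jv) (use irr in \<open>simp add: irreducible_rep_def\<close>)
    show ?thesis using theta_orbit_frame by (intro exI[of _ "(carrier G \<times> C \<times> J, \<Phi>, \<tau>)"]) simp
  qed
  define p where "p i = (SOME p :: (((nat \<Rightarrow> int) \<times> (nat \<Rightarrow> nat)) \<times> ((nat \<Rightarrow> int) \<times> (nat \<Rightarrow> nat)) \<times> 'v) set \<times> _.
      orbit_frame n A \<sigma> \<chi> (?M i) (fst p) (fst (snd p)) (snd (snd p)))" for i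
  have p: "orbit_frame n A \<sigma> \<chi> (?M i) (fst (p i)) (fst (snd (p i))) (snd (snd (p i)))" if "i \<in> {1..r}" for i
    unfolding p_def using ex[OF that] by (rule someI_ex)
  have "orbit_frame n A \<sigma> \<chi> (yd_direct_sum {1..r} ?M) (Sigma {1..r} (\<lambda>i. fst (p i)))
      (\<lambda>(i, a) y. fst (snd (p i)) a (y i)) (\<lambda>(i, a). snd (snd (p i)) a)"
    by (rule direct_sum_orbit_frame[of "{1..r}" 1]) (use assms(2) p in auto)
  from orbit_frame.fin_dim_criterion[OF this] have "vectorspace.fin_dim CC (nichols_algebra G (yd_direct_sum {1..r} ?M)) \<longleftrightarrow> trivial_braiding" .
  moreover have "vectorspace.fin_dim CC (nichols_algebra G (?M i)) \<longleftrightarrow> trivial_braiding" if "i \<in> {1..r}" for i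
    by (rule orbit_frame.fin_dim_criterion[OF p[OF that]])
  moreover have "1 \<in> {1..r}" using assms(2) by simp
  ultimately show ?thesis by blast
qed

end
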